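(* Let $n\in\{3,4\}$, let $a\ge 0$ be a constant, let $\Omega$ be a bounded domain in $\mathbb{R}^n$, and let $\Gamma_j$ denote the $j$-th eigenvalue of the Dirichlet problem $$\Delta^2u-a\Delta u=\Gamma u\ \text{ on }\Omega,\qquad u|_{\partial\Omega}=\frac{\partial u}{\partial\nu}\Big|_{\partial\Omega}=0 .$$ Then for every integer $k\ge 1$ $$\frac1k\sum_{j=1}^k\Gamma_j\ \ge\ \frac{n}{n+4}\,\frac{(2\pi)^4}{(\omega_nV(\Omega))^{\frac4n}}\,k^{\frac4n}+\left(\frac{n}{24}\frac{V(\Omega)}{I(\Omega)}+\frac{na}{n+2}\right)\frac{(2\pi)^2}{(\omega_nV(\Omega))^{\frac2n}}\,k^{\frac2n}+\left[-\frac{n(n^2-4)}{3840}\frac{V(\Omega)}{I(\Omega)}+\frac{na}{48}\,\beta_n\right]\frac{V(\Omega)}{I(\Omega)},$$ where $\beta_3=0.986$ and $\beta_4=0.983$.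
   Context: $\omega_n$ is the volume of the unit ball in $\mathbb{R}^n$; $V(\Omega)$ is the volume of $\Omega$; $I(\Omega)=\min_{c\in\mathbb{R}^n}\int_\Omega |x-c|^2\,dx$ is the moment of inertia of $\Omega$. $\Delta$ is the Laplacian and $\nu$ is the outward unit normal vector field of $\partial\Omega$. The eigenvalues $\Gamma_1\le\Gamma_2\le\cdots\to\infty$ are real and discrete, each repeated according to its multiplicity. (For a general bounded domain the eigenvalue problem is understood in the usual weak sense, in the Sobolev space $H_0^2(\Omega)$.) *)

theory Defs
  imports "HOL-Analysis.Analysis"
begin

definition volume :: "'a::euclidean_space set \<Rightarrow> real" where
  "volume \<Omega> = measure lebesgue \<Omega>"

text \<open>For a bounded \<open>\<Omega>\<close> of positive volume the infimum is a minimum, attained at the centroid.\<close>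

definition moment_of_inertia :: "'a::euclidean_space set \<Rightarrow> real" where
  "moment_of_inertia \<Omega> = (INF c. LINT x|lebesgue_on \<Omega>. (norm (x - c))\<^sup>2)"

definition partial_deriv :: "'a::euclidean_space \<Rightarrow> ('a \<Rightarrow> real) \<Rightarrow> 'a \<Rightarrow> real" where
  "partial_deriv b f x = frechet_derivative f (at x) b"

primrec C_k :: "nat \<Rightarrow> ('a::euclidean_space \<Rightarrow> real) \<Rightarrow> bool" where
  "C_k 0 f \<longleftrightarrow> continuous_on UNIV f"
| "C_k (Suc k) f \<longleftrightarrow>
     (\<forall>x. f differentiable (at x)) \<and> (\<forall>b\<in>Basis. C_k k (partial_deriv b f))"

definition test_functions :: "'a::euclidean_space set \<Rightarrow> ('a \<Rightarrow> real) set" where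
  "test_functions \<Omega> =
     {\<phi>. (\<forall>k. C_k k \<phi>) \<and> compact (closure {x. \<phi> x \<noteq> 0}) \<and> closure {x. \<phi> x \<noteq> 0} \<subseteq> \<Omega>}"

text \<open>Elements of the function spaces below are representatives; their values outside \<open>\<Omega>\<close>
  are irrelevant, and they are identified when they agree almost everywhere on \<open>\<Omega>\<close>.\<close>

definition L2 :: "'a::euclidean_space set \<Rightarrow> ('a \<Rightarrow> real) set" where
  "L2 \<Omega> = {u. u \<in> borel_measurable (lebesgue_on \<Omega>) \<and> integrable (lebesgue_on \<Omega>) (\<lambda>x. (u x)\<^sup>2)}"

definition has_weak_deriv ::
    "'a::euclidean_space set \<Rightarrow> 'a \<Rightarrow> ('a \<Rightarrow> real) \<Rightarrow> ('a \<Rightarrow> real) \<Rightarrow> bool" where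
  "has_weak_deriv \<Omega> b u g \<longleftrightarrow> u \<in> L2 \<Omega> \<and> g \<in> L2 \<Omega> \<and>
     (\<forall>\<phi>\<in>test_functions \<Omega>.
        (LINT x|lebesgue_on \<Omega>. u x * partial_deriv b \<phi> x) = - (LINT x|lebesgue_on \<Omega>. g x * \<phi> x))"

text \<open>Weak derivatives on an open \<open>\<Omega>\<close> are unique almost everywhere, so the choice of
  representative does not affect any of the integrals below.\<close>

definition weak_deriv ::
    "'a::euclidean_space set \<Rightarrow> 'a \<Rightarrow> ('a \<Rightarrow> real) \<Rightarrow> 'a \<Rightarrow> real" where
  "weak_deriv \<Omega> b u = (SOME g. has_weak_deriv \<Omega> b u g)"

definition H1 :: "'a::euclidean_space set \<Rightarrow> ('a \<Rightarrow> real) set" where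
  "H1 \<Omega> = {u \<in> L2 \<Omega>. \<forall>b\<in>Basis. \<exists>g. has_weak_deriv \<Omega> b u g}"

definition H2 :: "'a::euclidean_space set \<Rightarrow> ('a \<Rightarrow> real) set" where
  "H2 \<Omega> = {u \<in> H1 \<Omega>. \<forall>b\<in>Basis. weak_deriv \<Omega> b u \<in> H1 \<Omega>}"

definition H2_norm :: "'a::euclidean_space set \<Rightarrow> ('a \<Rightarrow> real) \<Rightarrow> real" where
  "H2_norm \<Omega> u = sqrt (
     (LINT x|lebesgue_on \<Omega>. (u x)\<^sup>2)
     + (\<Sum>b\<in>Basis. LINT x|lebesgue_on \<Omega>. (weak_deriv \<Omega> b u x)\<^sup>2)
     + (\<Sum>b\<in>Basis. \<Sum>c\<in>Basis. LINT x|lebesgue_on \<Omega>. (weak_deriv \<Omega> c (weak_deriv \<Omega> b u) x)\<^sup>2))"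

text \<open>The closure of the test functions in \<open>H2 \<Omega>\<close>; membership encodes the boundary conditions
  \<open>u = 0\<close> and \<open>\<partial>u/\<partial>\<nu> = 0\<close> on the (possibly irregular) boundary.\<close>

definition H2_0 :: "'a::euclidean_space set \<Rightarrow> ('a \<Rightarrow> real) set" where
  "H2_0 \<Omega> = {u \<in> H2 \<Omega>. \<exists>\<phi>. (\<forall>m. \<phi> m \<in> test_functions \<Omega>) \<and>
     (\<lambda>m::nat. H2_norm \<Omega> (\<lambda>x. \<phi> m x - u x)) \<longlonglongrightarrow> 0}"

definition weak_laplacian :: "'a::euclidean_space set \<Rightarrow> ('a \<Rightarrow> real) \<Rightarrow> 'a \<Rightarrow> real" where
  "weak_laplacian \<Omega> u x = (\<Sum>b\<in>Basis. weak_deriv \<Omega> b (weak_deriv \<Omega> b u) x)"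

text \<open>The weak solutions of \<open>\<Delta>\<^sup>2u - a\<Delta>u = \<Gamma>u\<close> in \<open>H2_0 \<Omega>\<close>, including zero.\<close>

definition eigenspace ::
    "real \<Rightarrow> 'a::euclidean_space set \<Rightarrow> real \<Rightarrow> ('a \<Rightarrow> real) set" where
  "eigenspace a \<Omega> \<Gamma> = {u \<in> H2_0 \<Omega>. \<forall>v\<in>H2_0 \<Omega>.
     (LINT x|lebesgue_on \<Omega>. weak_laplacian \<Omega> u x * weak_laplacian \<Omega> v x)
     + a * (LINT x|lebesgue_on \<Omega>. (\<Sum>b\<in>Basis. weak_deriv \<Omega> b u x * weak_deriv \<Omega> b v x))
     = \<Gamma> * (LINT x|lebesgue_on \<Omega>. u x * v x)}"

text \<open>The dimension of the eigenspace modulo equality almost everywhere on \<open>\<Omega>\<close>: existence of a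
  basis \<open>w 0, \<dots>, w (m - 1)\<close>. Multiplicity \<open>0\<close> means that \<open>\<Gamma>\<close> is not an eigenvalue.\<close>

definition has_multiplicity ::
    "real \<Rightarrow> 'a::euclidean_space set \<Rightarrow> real \<Rightarrow> nat \<Rightarrow> bool" where
  "has_multiplicity a \<Omega> \<Gamma> m \<longleftrightarrow> (\<exists>w :: nat \<Rightarrow> 'a \<Rightarrow> real.
     (\<forall>i<m. w i \<in> eigenspace a \<Omega> \<Gamma>) \<and>
     (\<forall>c :: nat \<Rightarrow> real.
        (AE x in lebesgue_on \<Omega>. (\<Sum>i<m. c i * w i x) = 0) \<longrightarrow> (\<forall>i<m. c i = 0)) \<and>
     (\<forall>u\<in>eigenspace a \<Omega> \<Gamma>. \<exists>c :: nat \<Rightarrow> real.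
        AE x in lebesgue_on \<Omega>. u x = (\<Sum>i<m. c i * w i x)))"

text \<open>\<open>\<Gamma> 1 \<le> \<Gamma> 2 \<le> \<dots> \<rightarrow> \<infinity>\<close> lists all eigenvalues, each repeated according to its
  multiplicity; the value \<open>\<Gamma> 0\<close> is unused.\<close>

definition eigenvalue_sequence ::
    "real \<Rightarrow> 'a::euclidean_space set \<Rightarrow> (nat \<Rightarrow> real) \<Rightarrow> bool" where
  "eigenvalue_sequence a \<Omega> \<Gamma> \<longleftrightarrow>
     mono_on {1..} \<Gamma> \<and> filterlim \<Gamma> at_top sequentially \<and>
     (\<forall>\<mu>. has_multiplicity a \<Omega> \<mu> (card {j. 1 \<le> j \<and> \<Gamma> j = \<mu>}))"

definition beta :: "nat \<Rightarrow> real" where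
  "beta n = (if n = 3 then 0.986 else if n = 4 then 0.983 else undefined)"

end

theory Submission
  imports Defs "HOL-Probability.Characteristic_Functions"
begin

text \<open>
  Let \<open>u\<^sub>1, \<dots>, u\<^sub>k\<close> be orthonormal eigenfunctions, let \<open>\<Phi> \<xi> = (2\<pi>)^(-n) \<Sum>\<^sub>j |\<integral> u\<^sub>j(x) e^(i \<xi>\<bullet>x) dx|\<^sup>2\<close>
  and \<open>V = V(\<Omega>)\<close>, \<open>I = I(\<Omega>)\<close>. By Bessel's inequality \<open>0 \<le> \<Phi> \<le> M = (2\<pi>)^(-n) V\<close>, and \<open>\<Phi>\<close> is Lipschitz
  with constant \<open>L = 2 (2\<pi>)^(-n) sqrt (V I)\<close>; by Parseval \<open>\<integral>\<Phi> = k\<close> and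
  \<open>\<integral> (|\<xi>|\<^sup>4 + a |\<xi>|\<^sup>2) \<Phi>(\<xi>) d\<xi> \<le> \<Gamma>\<^sub>1 + \<dots> + \<Gamma>\<^sub>k\<close>.
  The spherical mean of \<open>\<Phi>\<close> has the same bounds and the same moments, so it can be compared with the
  truncated cone of the same mass that equals \<open>M\<close> on \<open>[0, s]\<close> and then falls to \<open>0\<close> with slope \<open>-L\<close>:
  their difference changes sign only once, hence the cone has the smaller moments. (No decreasing
  rearrangement is needed, because monotonicity plays no role in this argument.) The moments of the cone are
  polynomials in \<open>s\<close> and \<open>d = M / L = sqrt (V / I) / 2\<close>, and the claim becomes an
  inequality for polynomials in \<open>d\<^sup>2\<close>; the constants \<open>\<beta>\<^sub>n\<close> come from the bound on \<open>d\<^sup>2\<close> which follows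
  from \<open>k \<ge> 1\<close> and the fact that balls minimize \<open>I\<close> among domains of given volume.
\<close>

subsection \<open>Moments of a truncated cone\<close>

text \<open>The natural scale is \<open>T = 2 * pi * (k / (\<omega> * V)) powr (1 / n)\<close>: a
  density equal to its upper bound \<open>M\<close> on the ball of radius \<open>T\<close> and to
  \<open>0\<close> outside has mass \<open>k\<close>. The powers \<open>T ^ 4\<close> and
  \<open>T\<^sup>2\<close> give the terms in \<open>k\<close> of the claim; those with
  \<open>V / I\<close> are corrections in \<open>d\<^sup>2 = V / (4 * I)\<close>, the gain from the
  finite slope. The coefficients for the fourth moment are those of its expansion in
  \<open>(d / T)\<^sup>2\<close> up to second order, and the remainder has the favourable sign. For
  the second moment the first-order coefficient is \<open>(n + 2) / 12\<close>, but the next term is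
  negative; a factor \<open>beta n\<close> slightly below \<open>1\<close> leaves a linear gain that
  pays for it when \<open>d / T\<close> is small. The comparison with the cone needs mass exactly
  \<open>k\<close>, so Parseval must be an equality, while for the energy one inequality is enough.
  Eigenfunctions are known only as limits of test functions, so both facts are proved for test
  functions and then carried to the limit. The Lipschitz constant comes from
  \<open>|z|\<^sup>2 - |w|\<^sup>2 = Re ((z - w) * cnj (z + w))\<close> and Bessel's inequality for
  sums and differences of plane waves; the free choice of origin produces the infimum in
  \<open>I\<close>.\<close>

lemma power_le_bounds:
  fixes x b :: real
  assumes "0 \<le> x" "x \<le> b"
  shows "0 \<le> x\<^sup>2" "x\<^sup>2 \<le> b\<^sup>2" "0 \<le> x ^ 3" "x ^ 3 \<le> b ^ 3" "0 \<le> x ^ 4" "x ^ 4 \<le> b ^ 4"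
    "0 \<le> x ^ 5" "x ^ 5 \<le> b ^ 5"
  using assms by (auto intro: power_mono)

text \<open>In the next two proofs \<open>U\<close> is the third order Taylor polynomial of \<open>t\<^sup>2\<close> in \<open>x\<close>.\<close>

lemma cone_moments_normalized_3:
  fixes x t :: real
  assumes x: "0 \<le> x" "x \<le> 4" and t: "0 \<le> t" "t ^ 3 = 1 + x / 4"
  shows "t ^ 3 * (t ^ 4 + 7/6 * x * t\<^sup>2 - 7/48 * x\<^sup>2) \<le> 1 + 7/4 * x + 7/16 * x\<^sup>2 + x ^ 3 / 64"
    and "x \<le> 0.0735 * t\<^sup>2 \<Longrightarrow> t ^ 3 * (t\<^sup>2 + 5/12 * 0.986 * x) \<le> 1 + 5/6 * x + x\<^sup>2 / 16"
proof -
  define U where "U = 1 + x / 6 - x\<^sup>2 / 144 + x ^ 3 / 1296"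
  note xb = power_le_bounds[OF x]
  have x2: "x\<^sup>2 \<le> 4 * x" "x ^ 3 \<le> 4 * x\<^sup>2"
    using x mult_right_mono[OF x(2), of "x"] mult_right_mono[OF x(2), of "x\<^sup>2"]
    by (auto simp: eval_nat_numeral)
  have U1: "U \<ge> 1" using x2 xb x unfolding U_def by linarith
  \<comment> \<open>\<open>t ^ 6 = (1 + x / 4)\<^sup>2\<close> is compared with
    \<open>U ^ 3\<close>: everything below \<open>x ^ 4\<close> cancels and the cofactor is
    nonnegative on \<open>[0, 4]\<close>. This bounds \<open>t\<^sup>2\<close> without fractional
    powers.\<close>
  have "U ^ 3 - (1 + x / 4)\<^sup>2 = x ^ 4 * (7/20736 + 7/124416 * x - 35/8957952 * x\<^sup>2 + 11/26873856 * x ^ 3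
       - 1/80621568 * x ^ 4 + 1/2176782336 * x ^ 5)"
    unfolding U_def by (simp add: field_simps power2_eq_square power3_eq_cube power4_eq_xxxx eval_nat_numeral)
  also have "\<dots> \<ge> 0"
    using xb xb[simplified] x by (intro mult_nonneg_nonneg; (simp; fail | linarith))
  finally have "(t\<^sup>2) ^ 3 \<le> U ^ 3" using t by (metis diff_ge_0_iff_ge mult.commute power_mult)
  then have tU: "t\<^sup>2 \<le> U" using U1 by (meson power_mono_iff zero_le_power2 zero_less_numeral order_trans zero_le_one)
  have A: "1 + x/4 \<ge> 0" using x by simp
  have t4: "t ^ 4 = (t\<^sup>2)\<^sup>2" by simp
  have "t ^ 4 + 7/6 * x * t\<^sup>2 - 7/48 * x\<^sup>2 \<le> U\<^sup>2 + 7/6 * x * U - 7/48 * x\<^sup>2"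
    unfolding t4 using tU x by (intro diff_right_mono add_mono power_mono mult_left_mono) auto
  then have "t ^ 3 * (t ^ 4 + 7/6 * x * t\<^sup>2 - 7/48 * x\<^sup>2) \<le> (1 + x / 4) * (U\<^sup>2 + 7/6 * x * U - 7/48 * x\<^sup>2)"
    unfolding t using A by (rule mult_left_mono)
  \<comment> \<open>All terms up to \<open>x\<^sup>2\<close> agree exactly; this determines the
    coefficients \<open>7/6\<close> and \<open>7/48\<close>.\<close>
  also have "\<dots> = (1 + 7/4 * x + 7/16 * x\<^sup>2 + x ^ 3 / 64) -
      x ^ 3 * (23/2592 + 7/6912 * x - 217/746496 * x\<^sup>2 + 7/3359232 * x ^ 3 - 1/6718464 * x ^ 4)"
    unfolding U_def by (simp add: field_simps eval_nat_numeral)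
  also have "\<dots> \<le> 1 + 7/4 * x + 7/16 * x\<^sup>2 + x ^ 3 / 64"
  proof -
    have "0 \<le> x ^ 3 * (23/2592 + 7/6912 * x - 217/746496 * x\<^sup>2 + 7/3359232 * x ^ 3 - 1/6718464 * x ^ 4)"
      using xb xb[simplified] x by (intro mult_nonneg_nonneg; (simp; fail | linarith))
    then show ?thesis by linarith
  qed
  finally show "t ^ 3 * (t ^ 4 + 7/6 * x * t\<^sup>2 - 7/48 * x\<^sup>2) \<le> 1 + 7/4 * x + 7/16 * x\<^sup>2 + x ^ 3 / 64" .
  assume xt: "x \<le> 0.0735 * t\<^sup>2"
  \<comment> \<open>A cruder bound on \<open>U\<close> turns
    \<open>x \<le> 0.0735 * t\<^sup>2\<close> into the linear inequality
    \<open>x \<le> 0.0735 * (1 + x / 6)\<close>, which forces \<open>x < 0.0745\<close>;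
    \<open>3/40\<close> is a convenient upper bound.\<close>
  have "U \<le> 1 + x / 6"
    unfolding U_def using x2 xb by linarith
  then have xs: "x \<le> 3/40" using xt tU by simp
  note xsb = power_le_bounds[OF x(1) xs]
  have "t ^ 3 * (t\<^sup>2 + 5/12 * 0.986 * x) \<le> (1 + x / 4) * (U + 5/12 * 0.986 * x)"
    unfolding t using A tU by (intro mult_left_mono) auto
  \<comment> \<open>With \<open>1\<close> instead of \<open>0.986\<close> the linear term would
    cancel and a loss of order \<open>x\<^sup>2\<close> would remain. The factor
    \<open>0.986\<close> leaves the gain \<open>7/1200 * x\<close>, which outweighs
    \<open>1079/14400 * x\<^sup>2\<close> up to \<open>x = 3/40\<close>.\<close>
  also have "\<dots> = (1 + 5/6 * x + x\<^sup>2 / 16) - x * (7/1200 - 1079/14400 * x + 5/5184 * x\<^sup>2 - 1/5184 * x ^ 3)"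
    unfolding U_def by (simp add: field_simps eval_nat_numeral)
  also have "\<dots> \<le> 1 + 5/6 * x + x\<^sup>2 / 16"
  proof -
    have "0 \<le> x * (7/1200 - 1079/14400 * x + 5/5184 * x\<^sup>2 - 1/5184 * x ^ 3)"
      using xsb xsb[simplified power_divide, simplified] x xs by (intro mult_nonneg_nonneg; (simp; fail | linarith))
    then show ?thesis by linarith
  qed
  finally show "t ^ 3 * (t\<^sup>2 + 5/12 * 0.986 * x) \<le> 1 + 5/6 * x + x\<^sup>2 / 16" .
qed

lemma cone_moments_normalized_4:
  fixes x t :: real
  assumes x: "0 \<le> x" "x \<le> 4" and t: "0 \<le> t" "t ^ 4 = 1 + x / 2 + x\<^sup>2 / 80"
  shows "t ^ 4 * (t ^ 4 + 4/3 * x * t\<^sup>2 - 2/5 * x\<^sup>2)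
      \<le> 1 + 7/3 * x + 7/8 * x\<^sup>2 + x ^ 3 / 16 + x ^ 4 / 2304"
    and "x \<le> 3/64 * t\<^sup>2 \<Longrightarrow>
      t ^ 4 * (t\<^sup>2 + 1/2 * 0.983 * x) \<le> 1 + 5/4 * x + 3/16 * x\<^sup>2 + x ^ 3 / 448"
proof -
  define U where "U = 1 + x / 4 - x\<^sup>2 / 40 + x ^ 3 / 160"
  note xb = power_le_bounds[OF x]
  have x2: "x\<^sup>2 \<le> 4 * x" "x ^ 3 \<le> 4 * x\<^sup>2"
    using x mult_right_mono[OF x(2), of "x"] mult_right_mono[OF x(2), of "x\<^sup>2"]
    by (auto simp: eval_nat_numeral)
  have U1: "U \<ge> 1" using x2 xb x unfolding U_def by linarith
  have "U ^ 2 - (1 + x / 2 + x\<^sup>2 / 80) = x ^ 4 * (3/800 - x / 3200 + x\<^sup>2 / 25600)"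
    unfolding U_def by (simp add: field_simps eval_nat_numeral)
  also have "\<dots> \<ge> 0"
    using xb xb[simplified] x by (intro mult_nonneg_nonneg; (simp; fail | linarith))
  finally have "(t\<^sup>2)\<^sup>2 \<le> U\<^sup>2" using t by simp
  then have tU: "t\<^sup>2 \<le> U" using U1 by (meson power2_le_imp_le order_trans zero_le_one)
  have A: "1 + x / 2 + x\<^sup>2 / 80 \<ge> 0" using x by simp
  have "t ^ 4 * (t ^ 4 + 4/3 * x * t\<^sup>2 - 2/5 * x\<^sup>2) \<le>
     (1 + x / 2 + x\<^sup>2 / 80) * ((1 + x / 2 + x\<^sup>2 / 80) + 4/3 * x * U - 2/5 * x\<^sup>2)"
    unfolding t using A tU x by (intro mult_left_mono diff_right_mono add_mono) auto
  also have "\<dots> = (1 + 7/3 * x + 7/8 * x\<^sup>2 + x ^ 3 / 16 + x ^ 4 / 2304) -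
      x ^ 3 * (1/10 + 17/1800 * x - 3/800 * x\<^sup>2 - x ^ 3 / 9600)"
    unfolding U_def by (simp add: field_simps eval_nat_numeral)
  also have "\<dots> \<le> 1 + 7/3 * x + 7/8 * x\<^sup>2 + x ^ 3 / 16 + x ^ 4 / 2304"
  proof -
    have "0 \<le> x ^ 3 * (1/10 + 17/1800 * x - 3/800 * x\<^sup>2 - x ^ 3 / 9600)"
      using xb xb[simplified] x by (intro mult_nonneg_nonneg; (simp; fail | linarith))
    then show ?thesis by linarith
  qed
  finally show "t ^ 4 * (t ^ 4 + 4/3 * x * t\<^sup>2 - 2/5 * x\<^sup>2)
      \<le> 1 + 7/3 * x + 7/8 * x\<^sup>2 + x ^ 3 / 16 + x ^ 4 / 2304" .
  assume xt: "x \<le> 3/64 * t\<^sup>2"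
  have "U \<le> 1 + x / 4"
    unfolding U_def using x2 by linarith
  \<comment> \<open>\<open>x \<le> 3/64 * (1 + x / 4)\<close> gives \<open>x \<le> 12/253\<close>,
    just below \<open>6/125\<close>. On this range the gain \<open>17/2000 * x\<close> left by
    \<open>0.983\<close> still exceeds the quadratic loss below.\<close>
  then have xs: "x \<le> 6/125" using xt tU by linarith
  note xsb = power_le_bounds[OF x(1) xs]
  have "t ^ 4 * (t\<^sup>2 + 1/2 * 0.983 * x) \<le> (1 + x / 2 + x\<^sup>2 / 80) * (U + 1/2 * 0.983 * x)"
    unfolding t using A tU by (intro mult_left_mono) auto
  also have "\<dots> = (1 + 5/4 * x + 3/16 * x\<^sup>2 + x ^ 3 / 448) -
     x * (17/2000 - 683/4000 * x - 881/1120000 * x\<^sup>2 - 9/3200 * x ^ 3 - x ^ 4 / 12800)"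
    unfolding U_def by (simp add: field_simps eval_nat_numeral)
  also have "\<dots> \<le> 1 + 5/4 * x + 3/16 * x\<^sup>2 + x ^ 3 / 448"
  proof -
    have "0 \<le> x * (17/2000 - 683/4000 * x - 881/1120000 * x\<^sup>2 - 9/3200 * x ^ 3 - x ^ 4 / 12800)"
      using xsb xsb[simplified power_divide, simplified] x xs by (intro mult_nonneg_nonneg; (simp; fail | linarith))
    then show ?thesis by linarith
  qed
  finally show "t ^ 4 * (t\<^sup>2 + 1/2 * 0.983 * x) \<le> 1 + 5/4 * x + 3/16 * x\<^sup>2 + x ^ 3 / 448" .
qed

text \<open>Centring at \<open>c = s + d / 2\<close> makes \<open>(s + d) ^ m - s ^ m\<close>, for
  even \<open>m\<close>, equal to \<open>d\<close> times an odd polynomial in \<open>c\<close> whose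
  coefficients are powers of \<open>d\<^sup>2\<close>. After division by a power of \<open>c\<close>
  only \<open>x = (d / c)\<^sup>2\<close> and \<open>t = T / c\<close> are left, and
  \<open>s \<ge> 0\<close> means \<open>x \<le> 4\<close>. The hypothesis on \<open>T\<close> says
  that the cone has the mass of the full ball of radius \<open>T\<close>.\<close>

lemma cone_moments_3:
  fixes s d T :: real
  assumes "0 \<le> s" "0 < d" "0 < T" and T: "T ^ 3 * (4 * d) = (s + d) ^ 4 - s ^ 4"
  shows "T ^ 3 * (T ^ 4 + 7/6 * d\<^sup>2 * T\<^sup>2 - 7/48 * d ^ 4) * (8 * d) \<le> (s + d) ^ 8 - s ^ 8"
    and "d\<^sup>2 \<le> 0.0735 * T\<^sup>2 \<Longrightarrow>
      T ^ 3 * (T\<^sup>2 + 5/12 * 0.986 * d\<^sup>2) * (6 * d) \<le> (s + d) ^ 6 - s ^ 6"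
proof -
  define c where "c = s + d / 2"
  define t where "t = T / c"
  define x where "x = d\<^sup>2 / c\<^sup>2"
  have c: "c > 0" and s: "s = c - d / 2" and dc: "d \<le> 2 * c" using assms by (auto simp: c_def)
  have Tt: "T = t * c" and dx: "d\<^sup>2 = x * c\<^sup>2" using c by (auto simp: t_def x_def)
  have x: "0 \<le> x" "x \<le> 4"
    using power_mono[OF dc, of 2] assms c by (auto simp: x_def field_simps)
  have "T ^ 3 * (4 * d) = (c ^ 3 + c * d\<^sup>2 / 4) * (4 * d)"
    unfolding T s by (simp add: field_simps eval_nat_numeral)
  then have "T ^ 3 = c ^ 3 + c * d\<^sup>2 / 4"
    using assms(2) by simp
  then have "T ^ 3 = c ^ 3 * (1 + x / 4)"
    unfolding dx by (simp add: field_simps eval_nat_numeral)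
  then have t: "0 \<le> t" "t ^ 3 = 1 + x / 4" using c assms by (auto simp: t_def power_divide)
  note main = cone_moments_normalized_3[OF x t]
  have "T ^ 3 * (T ^ 4 + 7/6 * d\<^sup>2 * T\<^sup>2 - 7/48 * (d\<^sup>2)\<^sup>2)
      = c ^ 7 * (t ^ 3 * (t ^ 4 + 7/6 * x * t\<^sup>2 - 7/48 * x\<^sup>2))"
    unfolding dx Tt by (simp add: field_simps eval_nat_numeral)
  also have "\<dots> \<le> c ^ 7 * (1 + 7/4 * x + 7/16 * x\<^sup>2 + x ^ 3 / 64)"
    using main(1) c by (intro mult_left_mono) auto
  also have "\<dots> = c ^ 7 + 7/4 * c ^ 5 * d\<^sup>2 + 7/16 * c ^ 3 * (d\<^sup>2)\<^sup>2 + c * (d\<^sup>2) ^ 3 / 64"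
    unfolding dx by (simp add: field_simps eval_nat_numeral)
  finally have "T ^ 3 * (T ^ 4 + 7/6 * d\<^sup>2 * T\<^sup>2 - 7/48 * (d\<^sup>2)\<^sup>2) * (8 * d)
      \<le> (c ^ 7 + 7/4 * c ^ 5 * d\<^sup>2 + 7/16 * c ^ 3 * (d\<^sup>2)\<^sup>2 + c * (d\<^sup>2) ^ 3 / 64) * (8 * d)"
    using assms by (intro mult_right_mono) auto
  also have "\<dots> = (s + d) ^ 8 - s ^ 8"
    unfolding s by (simp add: field_simps eval_nat_numeral)
  finally show "T ^ 3 * (T ^ 4 + 7/6 * d\<^sup>2 * T\<^sup>2 - 7/48 * d ^ 4) * (8 * d) \<le> (s + d) ^ 8 - s ^ 8"
    by simp
  assume "d\<^sup>2 \<le> 0.0735 * T\<^sup>2"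
  then have "x * c\<^sup>2 \<le> (0.0735 * t\<^sup>2) * c\<^sup>2" unfolding dx Tt by (simp add: power_mult_distrib)
  then have "x \<le> 0.0735 * t\<^sup>2" using c by simp
  note main2 = main(2)[OF this]
  have "T ^ 3 * (T\<^sup>2 + 5/12 * 0.986 * d\<^sup>2) = c ^ 5 * (t ^ 3 * (t\<^sup>2 + 5/12 * 0.986 * x))"
    unfolding dx Tt by (simp add: field_simps eval_nat_numeral)
  also have "\<dots> \<le> c ^ 5 * (1 + 5/6 * x + x\<^sup>2 / 16)"
    using main2 c by (intro mult_left_mono) auto
  also have "\<dots> = c ^ 5 + 5/6 * c ^ 3 * d\<^sup>2 + c * (d\<^sup>2)\<^sup>2 / 16"
    unfolding dx by (simp add: field_simps eval_nat_numeral)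
  finally have "T ^ 3 * (T\<^sup>2 + 5/12 * 0.986 * d\<^sup>2) * (6 * d)
      \<le> (c ^ 5 + 5/6 * c ^ 3 * d\<^sup>2 + c * (d\<^sup>2)\<^sup>2 / 16) * (6 * d)"
    using assms by (intro mult_right_mono) auto
  also have "\<dots> = (s + d) ^ 6 - s ^ 6"
    unfolding s by (simp add: field_simps eval_nat_numeral)
  finally show "T ^ 3 * (T\<^sup>2 + 5/12 * 0.986 * d\<^sup>2) * (6 * d) \<le> (s + d) ^ 6 - s ^ 6" .
qed

text \<open>The centring of dimension 3 is used again; now the differences of powers are
  \<open>d\<close> times even polynomials in \<open>c\<close>, so the mass condition reads
  \<open>t ^ 4 = 1 + x / 2 + x\<^sup>2 / 80\<close>.\<close>

lemma cone_moments_4: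
  fixes s d T :: real
  assumes "0 \<le> s" "0 < d" "0 < T" and T: "T ^ 4 * (5 * d) = (s + d) ^ 5 - s ^ 5"
  shows "T ^ 4 * (T ^ 4 + 4/3 * d\<^sup>2 * T\<^sup>2 - 2/5 * d ^ 4) * (9 * d) \<le> (s + d) ^ 9 - s ^ 9"
    and "d\<^sup>2 \<le> 3/64 * T\<^sup>2 \<Longrightarrow>
      T ^ 4 * (T\<^sup>2 + 1/2 * 0.983 * d\<^sup>2) * (7 * d) \<le> (s + d) ^ 7 - s ^ 7"
proof -
  define c where "c = s + d / 2"
  define t where "t = T / c"
  define x where "x = d\<^sup>2 / c\<^sup>2"
  have c: "c > 0" and s: "s = c - d / 2" and dc: "d \<le> 2 * c" using assms by (auto simp: c_def)
  have Tt: "T = t * c" and dx: "d\<^sup>2 = x * c\<^sup>2" using c by (auto simp: t_def x_def)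
  have x: "0 \<le> x" "x \<le> 4"
    using power_mono[OF dc, of 2] assms c by (auto simp: x_def field_simps)
  have "T ^ 4 * (5 * d) = (c ^ 4 + c\<^sup>2 * d\<^sup>2 / 2 + (d\<^sup>2)\<^sup>2 / 80) * (5 * d)"
    unfolding T s by (simp add: field_simps eval_nat_numeral)
  then have "T ^ 4 = c ^ 4 + c\<^sup>2 * d\<^sup>2 / 2 + (d\<^sup>2)\<^sup>2 / 80"
    using assms(2) by simp
  then have "T ^ 4 = c ^ 4 * (1 + x / 2 + x\<^sup>2 / 80)"
    unfolding dx by (simp add: field_simps eval_nat_numeral)
  then have t: "0 \<le> t" "t ^ 4 = 1 + x / 2 + x\<^sup>2 / 80" using c assms by (auto simp: t_def power_divide)
  note main = cone_moments_normalized_4[OF x t]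
  have "T ^ 4 * (T ^ 4 + 4/3 * d\<^sup>2 * T\<^sup>2 - 2/5 * (d\<^sup>2)\<^sup>2)
      = c ^ 8 * (t ^ 4 * (t ^ 4 + 4/3 * x * t\<^sup>2 - 2/5 * x\<^sup>2))"
    unfolding dx Tt by (simp add: field_simps eval_nat_numeral)
  also have "\<dots> \<le> c ^ 8 * (1 + 7/3 * x + 7/8 * x\<^sup>2 + x ^ 3 / 16 + x ^ 4 / 2304)"
    using main(1) c by (intro mult_left_mono) auto
  also have "\<dots> = c ^ 8 + 7/3 * c ^ 6 * d\<^sup>2 + 7/8 * c ^ 4 * (d\<^sup>2)\<^sup>2 + c\<^sup>2 * (d\<^sup>2) ^ 3 / 16 + (d\<^sup>2) ^ 4 / 2304"
    unfolding dx by (simp add: field_simps eval_nat_numeral)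
  finally have "T ^ 4 * (T ^ 4 + 4/3 * d\<^sup>2 * T\<^sup>2 - 2/5 * (d\<^sup>2)\<^sup>2) * (9 * d)
      \<le> (c ^ 8 + 7/3 * c ^ 6 * d\<^sup>2 + 7/8 * c ^ 4 * (d\<^sup>2)\<^sup>2 + c\<^sup>2 * (d\<^sup>2) ^ 3 / 16 + (d\<^sup>2) ^ 4 / 2304) * (9 * d)"
    using assms by (intro mult_right_mono) auto
  also have "\<dots> = (s + d) ^ 9 - s ^ 9"
    unfolding s by (simp add: field_simps eval_nat_numeral)
  finally show "T ^ 4 * (T ^ 4 + 4/3 * d\<^sup>2 * T\<^sup>2 - 2/5 * d ^ 4) * (9 * d) \<le> (s + d) ^ 9 - s ^ 9"
    by simp
  assume "d\<^sup>2 \<le> 3/64 * T\<^sup>2"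
  then have "x * c\<^sup>2 \<le> (3/64 * t\<^sup>2) * c\<^sup>2" unfolding dx Tt by (simp add: power_mult_distrib)
  then have "x \<le> 3/64 * t\<^sup>2" using c by simp
  note main2 = main(2)[OF this]
  have "T ^ 4 * (T\<^sup>2 + 1/2 * 0.983 * d\<^sup>2) = c ^ 6 * (t ^ 4 * (t\<^sup>2 + 1/2 * 0.983 * x))"
    unfolding dx Tt by (simp add: field_simps eval_nat_numeral)
  also have "\<dots> \<le> c ^ 6 * (1 + 5/4 * x + 3/16 * x\<^sup>2 + x ^ 3 / 448)"
    using main2 c by (intro mult_left_mono) auto
  also have "\<dots> = c ^ 6 + 5/4 * c ^ 4 * d\<^sup>2 + 3/16 * c\<^sup>2 * (d\<^sup>2)\<^sup>2 + (d\<^sup>2) ^ 3 / 448"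
    unfolding dx by (simp add: field_simps eval_nat_numeral)
  finally have "T ^ 4 * (T\<^sup>2 + 1/2 * 0.983 * d\<^sup>2) * (7 * d)
      \<le> (c ^ 6 + 5/4 * c ^ 4 * d\<^sup>2 + 3/16 * c\<^sup>2 * (d\<^sup>2)\<^sup>2 + (d\<^sup>2) ^ 3 / 448) * (7 * d)"
    using assms by (intro mult_right_mono) auto
  also have "\<dots> = (s + d) ^ 7 - s ^ 7"
    unfolding s by (simp add: field_simps eval_nat_numeral)
  finally show "T ^ 4 * (T\<^sup>2 + 1/2 * 0.983 * d\<^sup>2) * (7 * d) \<le> (s + d) ^ 7 - s ^ 7" .
qed

subsection \<open>Polar coordinates\<close>

lemma nn_integral_lborel_scaleR:
  fixes f :: "'a::euclidean_space \<Rightarrow> ennreal"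
  assumes [measurable]: "f \<in> borel_measurable borel" and c: "c \<noteq> 0"
  shows "(\<integral>\<^sup>+x. f x \<partial>lborel) = \<bar>c\<bar> ^ DIM('a) * (\<integral>\<^sup>+x. f (c *\<^sub>R x) \<partial>lborel)"
  by (subst lborel_affine[OF c, of 0])
     (simp add: nn_integral_density nn_integral_distr nn_integral_cmult ennreal_power)

text \<open>The substitution \<open>r = \<lambda> \<parallel>\<eta>\<parallel>\<close> turns the inner integral into one over dilates of the
  ball; after Fubini and rescaling, the weight at \<open>\<xi>\<close> is
  \<open>\<integral>_{\<parallel>\<xi>\<parallel>}^\<infinity> n \<parallel>\<xi>\<parallel>^n \<lambda>^(-n-1) d\<lambda> = 1\<close>.\<close>

lemma nn_integral_polar:
  fixes h :: "'a::euclidean_space \<Rightarrow> ennreal"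
  assumes [measurable]: "h \<in> borel_measurable borel"
  shows "(\<integral>\<^sup>+\<xi>. h \<xi> \<partial>lborel) =
    DIM('a) * (\<integral>\<^sup>+\<eta>. indicator (ball 0 1) \<eta> *
      (\<integral>\<^sup>+r. indicator {0<..} r * ennreal (r ^ (DIM('a) - 1)) * h (r *\<^sub>R sgn \<eta>) \<partial>lborel) \<partial>lborel)"
proof -
  define n where "n = DIM('a)"
  have n: "n > 0" by (simp add: n_def)
  then have n1: "Suc (n - 1) = n" by simp
  have [measurable]: "(\<lambda>x::'a. sgn x) \<in> borel_measurable borel" unfolding sgn_div_norm by measurable
  have [measurable]: "ball (0::'a) 1 \<in> sets borel" by simp
  have ae: "AE \<eta> in lborel. \<eta> \<noteq> (0::'a)"
    by (rule AE_lborel_singleton)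
  have sub: "(\<integral>\<^sup>+r. indicator {0<..} r * ennreal (r ^ (n - 1)) * h (r *\<^sub>R sgn \<eta>) \<partial>lborel) =
     (\<integral>\<^sup>+l. indicator {0<..} l * ennreal (l ^ (n - 1)) * ennreal (norm \<eta> ^ n) * h (l *\<^sub>R \<eta>) \<partial>lborel)"
    if "\<eta> \<noteq> 0" for \<eta> :: 'a
  proof -
    have "(\<integral>\<^sup>+r. indicator {0<..} r * ennreal (r ^ (n - 1)) * h (r *\<^sub>R sgn \<eta>) \<partial>lborel) =
      \<bar>norm \<eta>\<bar> * (\<integral>\<^sup>+l. indicator {0<..} (0 + norm \<eta> * l) * ennreal ((0 + norm \<eta> * l) ^ (n - 1)) *
         h ((0 + norm \<eta> * l) *\<^sub>R sgn \<eta>) \<partial>lborel)"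
      using that by (intro nn_integral_real_affine) auto
    also have "\<dots> = (\<integral>\<^sup>+l. \<bar>norm \<eta>\<bar> * (indicator {0<..} (0 + norm \<eta> * l) * ennreal ((0 + norm \<eta> * l) ^ (n - 1)) *
         h ((0 + norm \<eta> * l) *\<^sub>R sgn \<eta>)) \<partial>lborel)"
      by (intro nn_integral_cmult[symmetric]) measurable
    also have "\<dots> = (\<integral>\<^sup>+l. indicator {0<..} l * ennreal (l ^ (n - 1)) * ennreal (norm \<eta> ^ n) * h (l *\<^sub>R \<eta>) \<partial>lborel)"
    proof (intro nn_integral_cong)
      fix l :: real
      have a: "(norm \<eta> * l) *\<^sub>R sgn \<eta> = l *\<^sub>R \<eta>" using that by (simp add: sgn_div_norm)
      have b: "ennreal (norm \<eta>) * ennreal ((norm \<eta> * l) ^ (n - 1)) = ennreal (l ^ (n - 1)) * ennreal (norm \<eta> ^ n)" if "l > 0"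
        using that n1 by (simp add: ennreal_mult[symmetric] power_mult_distrib mult_ac flip: power_Suc)
      show "\<bar>norm \<eta>\<bar> * (indicator {0<..} (0 + norm \<eta> * l) * ennreal ((0 + norm \<eta> * l) ^ (n - 1)) *
         h ((0 + norm \<eta> * l) *\<^sub>R sgn \<eta>)) = indicator {0<..} l * ennreal (l ^ (n - 1)) * ennreal (norm \<eta> ^ n) * h (l *\<^sub>R \<eta>)"
        using that a b by (auto simp: indicator_def zero_less_mult_iff mult.assoc[symmetric])
    qed
    finally show ?thesis .
  qed
  have scale: "(\<integral>\<^sup>+\<eta>. indicator (ball 0 1) \<eta> * (ennreal (norm \<eta> ^ n) * h (l *\<^sub>R \<eta>)) \<partial>lborel) =
     ennreal (1 / l ^ n) * (\<integral>\<^sup>+\<xi>. indicator {0<..} (l - norm \<xi>) * ennreal (norm \<xi> ^ n / l ^ n) * h \<xi> \<partial>lborel)"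
    if "l > 0" for l :: real
  proof -
    have "(\<integral>\<^sup>+\<xi>. indicator {0<..} (l - norm \<xi>) * ennreal (norm \<xi> ^ n / l ^ n) * h \<xi> \<partial>lborel) =
       ennreal (l ^ n) * (\<integral>\<^sup>+\<eta>. indicator {0<..} (l - norm (l *\<^sub>R (\<eta>::'a))) * ennreal (norm (l *\<^sub>R \<eta>) ^ n / l ^ n) * h (l *\<^sub>R \<eta>) \<partial>lborel)"
      using that nn_integral_lborel_scaleR[of "\<lambda>\<xi>. indicator {0<..} (l - norm \<xi>) * ennreal (norm \<xi> ^ n / l ^ n) * h \<xi>" l]
      by (simp add: n_def ennreal_power)
    also have "(\<integral>\<^sup>+\<eta>. indicator {0<..} (l - norm (l *\<^sub>R (\<eta>::'a))) * ennreal (norm (l *\<^sub>R \<eta>) ^ n / l ^ n) * h (l *\<^sub>R \<eta>) \<partial>lborel)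
      = (\<integral>\<^sup>+\<eta>. indicator (ball 0 1) \<eta> * (ennreal (norm \<eta> ^ n) * h (l *\<^sub>R \<eta>)) \<partial>lborel)"
      using that by (intro nn_integral_cong) (auto simp: indicator_def power_mult_distrib)
    finally show ?thesis
      using that by (simp add: mult.assoc[symmetric] ennreal_mult[symmetric])
  qed
  have weight: "(\<integral>\<^sup>+l. indicator {0<..} l * ennreal (l ^ (n - 1)) * ennreal (1 / l ^ n) *
      (indicator {0<..} (l - x) * ennreal (x ^ n / l ^ n)) \<partial>lborel) * n = 1" if x: "x > 0" for x :: real
  proof -
    let ?w = "\<lambda>l. indicator {0<..} l * ennreal (l ^ (n - 1)) * ennreal (1 / l ^ n) * (indicator {0<..} (l - x) * ennreal (x ^ n / l ^ n))"
    have "(\<integral>\<^sup>+l. ennreal (real n / l ^ (n + 1)) * indicator {x..} l \<partial>lborel) = ennreal (0 - (- (1 / x ^ n)))"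
    proof (rule nn_integral_FTC_atLeast)
      show "(\<lambda>l. real n / l ^ (n + 1)) \<in> borel_measurable borel" by measurable
      show "((\<lambda>l. - (1 / l ^ n)) has_real_derivative real n / l ^ (n + 1)) (at l)" if "x \<le> l" for l
        using x that n1
        by (auto intro!: derivative_eq_intros simp: field_simps simp flip: power_Suc power_add)
      show "0 \<le> real n / l ^ (n + 1)" if "x \<le> l" for l using x that by simp
      have "((\<lambda>l::real. - (1 / l ^ n)) \<longlongrightarrow> - 0) at_top"
        using n by (intro tendsto_minus tendsto_divide_0[OF tendsto_const] filterlim_at_top_imp_at_infinity filterlim_pow_at_top filterlim_ident)
      then show "((\<lambda>l::real. - (1 / l ^ n)) \<longlongrightarrow> 0) at_top" by simp
    qed
    also have "(\<integral>\<^sup>+l. ennreal (real n / l ^ (n + 1)) * indicator {x..} l \<partial>lborel) =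
      (\<integral>\<^sup>+l. ?w l * (n * ennreal (1 / x ^ n)) \<partial>lborel)"
    proof (intro nn_integral_cong_AE)
      have "AE l in lborel. l \<noteq> x" by (rule AE_lborel_singleton)
      then show "AE l in lborel. ennreal (real n / l ^ (n + 1)) * indicator {x..} l =
         ?w l * (n * ennreal (1 / x ^ n))"
      proof eventually_elim
        fix l assume "l \<noteq> x"
        have "real n / l ^ (n + 1) = l ^ (n - 1) * (1 / l ^ n) * (x ^ n / l ^ n) * (n * (1 / x ^ n))" if "l > 0"
        proof -
          have "l ^ n = l * l ^ (n - 1)" using n1 by (metis power_Suc)
          then show ?thesis using that x by (simp add: field_simps)
        qed
        then show "ennreal (real n / l ^ (n + 1)) * indicator {x..} l =
         ?w l * (n * ennreal (1 / x ^ n))"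
          using x \<open>l \<noteq> x\<close>
          by (auto simp: indicator_def ennreal_mult[symmetric] ennreal_of_nat_eq_real_of_nat simp del: power_Suc)
      qed
    qed
    also have "\<dots> = (\<integral>\<^sup>+l. ?w l \<partial>lborel) * (n * ennreal (1 / x ^ n))"
      by (intro nn_integral_multc) measurable
    finally have "(\<integral>\<^sup>+l. ?w l \<partial>lborel) * n * ennreal (1 / x ^ n) * ennreal (x ^ n) = ennreal (1 / x ^ n) * ennreal (x ^ n)"
      by (simp add: mult.assoc)
    moreover have "ennreal (1 / x ^ n) * ennreal (x ^ n) = 1" using x by (simp add: ennreal_mult[symmetric])
    ultimately show ?thesis by (simp add: mult.assoc)
  qed
  let ?W = "\<lambda>l \<xi>. indicator {0<..} l * ennreal (l ^ (n - 1)) * ennreal (1 / l ^ n) * (indicator {0<..} (l - norm \<xi>) * ennreal (norm \<xi> ^ n / l ^ n) * h \<xi>)"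
  have "DIM('a) * (\<integral>\<^sup>+\<eta>. indicator (ball 0 1) \<eta> *
      (\<integral>\<^sup>+r. indicator {0<..} r * ennreal (r ^ (DIM('a) - 1)) * h (r *\<^sub>R sgn \<eta>) \<partial>lborel) \<partial>lborel)
    = n * (\<integral>\<^sup>+\<eta>. (\<integral>\<^sup>+l. indicator (ball 0 1) \<eta> * (indicator {0<..} l * ennreal (l ^ (n - 1)) * ennreal (norm \<eta> ^ n) * h (l *\<^sub>R \<eta>)) \<partial>lborel) \<partial>lborel)"
    unfolding n_def[symmetric] using ae sub
    by (intro arg_cong2[where f="(*)"] refl nn_integral_cong_AE) (auto elim!: eventually_mono simp: nn_integral_cmult)
  also have "\<dots> = n * (\<integral>\<^sup>+l. (\<integral>\<^sup>+\<eta>. indicator (ball 0 1) \<eta> * (indicator {0<..} l * ennreal (l ^ (n - 1)) * ennreal (norm \<eta> ^ n) * h (l *\<^sub>R \<eta>)) \<partial>lborel) \<partial>lborel)"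
    by (intro arg_cong2[where f="(*)"] refl lborel_pair.Fubini') measurable
  also have "\<dots> = n * (\<integral>\<^sup>+l. indicator {0<..} l * ennreal (l ^ (n - 1)) * (\<integral>\<^sup>+\<eta>. indicator (ball 0 1) \<eta> * (ennreal (norm \<eta> ^ n) * h (l *\<^sub>R \<eta>)) \<partial>lborel) \<partial>lborel)"
    by (intro arg_cong2[where f="(*)"] refl nn_integral_cong, subst nn_integral_cmult[symmetric]) (auto intro!: nn_integral_cong simp: mult_ac)
  also have "\<dots> = n * (\<integral>\<^sup>+l. (\<integral>\<^sup>+\<xi>. ?W l \<xi> \<partial>lborel) \<partial>lborel)"
  proof (intro arg_cong2[where f="(*)"] refl nn_integral_cong)
    fix l :: real
    show "indicator {0<..} l * ennreal (l ^ (n - 1)) * (\<integral>\<^sup>+\<eta>. indicator (ball 0 1) \<eta> * (ennreal (norm \<eta> ^ n) * h (l *\<^sub>R \<eta>)) \<partial>lborel)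
      = (\<integral>\<^sup>+\<xi>. ?W l \<xi> \<partial>lborel)"
    proof (cases "l > 0")
      case True
      show ?thesis unfolding scale[OF True] mult.assoc by (simp add: nn_integral_cmult)
    qed simp
  qed
  also have "\<dots> = n * (\<integral>\<^sup>+\<xi>. (\<integral>\<^sup>+l. ?W l \<xi> \<partial>lborel) \<partial>lborel)"
    by (intro arg_cong2[where f="(*)"] refl lborel_pair.Fubini'[symmetric]) (simp add: split_beta', measurable)
  also have "\<dots> = (\<integral>\<^sup>+\<xi>. n * (\<integral>\<^sup>+l. ?W l \<xi> \<partial>lborel) \<partial>lborel)"
    by (intro nn_integral_cmult[symmetric]) measurable
  also have "\<dots> = (\<integral>\<^sup>+\<xi>. h \<xi> \<partial>lborel)"
  proof (intro nn_integral_cong_AE)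
    show "AE \<xi> in lborel. n * (\<integral>\<^sup>+l. ?W l \<xi> \<partial>lborel) = h \<xi>"
      using ae
    proof eventually_elim
      fix \<xi> :: 'a assume "\<xi> \<noteq> 0"
      have "(\<integral>\<^sup>+l. ?W l \<xi> \<partial>lborel)
        = (\<integral>\<^sup>+l. indicator {0<..} l * ennreal (l ^ (n - 1)) * ennreal (1 / l ^ n) * (indicator {0<..} (l - norm \<xi>) * ennreal (norm \<xi> ^ n / l ^ n)) \<partial>lborel) * h \<xi>"
        by (subst nn_integral_multc[symmetric]) (auto simp: mult.assoc intro!: nn_integral_cong)
      then show "n * (\<integral>\<^sup>+l. ?W l \<xi> \<partial>lborel) = h \<xi>"
        using weight[of "norm \<xi>"] \<open>\<xi> \<noteq> 0\<close> by (subst mult.commute) (simp only: mult.assoc[of _ "h \<xi>"] mult.commute[of "h \<xi>"] mult.assoc[symmetric] zero_less_norm_iff simp_thms mult_1_left)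
    qed
  qed
  finally show ?thesis by simp
qed

subsection \<open>Comparison with a truncated cone\<close>

text \<open>The parameters are the slope and the width of the sloping part, so the plateau has
  height \<open>L * d\<close>; with \<open>d = M / L\<close> this is the upper bound
  \<open>M\<close> of the density.\<close>

definition cone_profile :: "real \<Rightarrow> real \<Rightarrow> real \<Rightarrow> real \<Rightarrow> real" where
  "cone_profile L s d r = max 0 (min (L * d) (L * (s + d - r)))"

text \<open>Plateau and slope are integrated separately by antiderivatives. In the sum the
  contributions \<open>d * s ^ (m + 1)\<close> cancel, which leaves a pure difference of
  powers.\<close>

lemma cone_moment:
  fixes L s d :: real and m :: nat
  assumes "L \<ge> 0" "s \<ge> 0" "d \<ge> 0"
  shows "has_bochner_integral lborel (\<lambda>r. indicator {0<..} r * r ^ m * cone_profile L s d r)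
    (L * ((s + d) ^ (m + 2) - s ^ (m + 2)) / ((real m + 1) * (real m + 2)))"
proof -
  have 1: "has_bochner_integral lborel (\<lambda>r. (L * d * r ^ m) * indicator {0..s} r)
     (L * d * s ^ (m + 1) / (real m + 1) - L * d * 0 ^ (m + 1) / (real m + 1))"
  proof (intro has_bochner_integral_FTC_Icc_real)
    fix r :: real
    have "((\<lambda>r. L * d * r ^ (m + 1) / (real m + 1)) has_real_derivative
      L * d * (real (m + 1) * r ^ (m + 1 - 1)) / (real m + 1)) (at r)"
      by (intro DERIV_cdivide DERIV_cmult) (use DERIV_pow[of "m + 1" r] in simp)
    moreover have "L * d * (real (m + 1) * r ^ (m + 1 - 1)) / (real m + 1) = L * d * r ^ m"
      by (auto simp: divide_simps)
    ultimately show "((\<lambda>r. L * d * r ^ (m + 1) / (real m + 1)) has_real_derivative L * d * r ^ m) (at r)"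
      by metis
  qed (use assms in \<open>auto intro!: continuous_intros\<close>)
  let ?G = "\<lambda>r. L * ((s + d) * r ^ (m + 1) / (real m + 1) - r ^ (m + 2) / (real m + 2))"
  have 2: "has_bochner_integral lborel (\<lambda>r. (L * (s + d - r) * r ^ m) * indicator {s..s+d} r) (?G (s + d) - ?G s)"
  proof (intro has_bochner_integral_FTC_Icc_real)
    fix r :: real
    have "((\<lambda>r. L * ((s + d) * r ^ (m + 1) / (real m + 1) - r ^ (m + 2) / (real m + 2))) has_real_derivative
      L * ((s + d) * (real (m + 1) * r ^ (m + 1 - 1)) / (real m + 1) - (real (m + 2) * r ^ (m + 2 - 1)) / (real m + 2))) (at r)"
      by (intro DERIV_cmult DERIV_diff DERIV_cdivide) (use DERIV_pow[of "m + 1" r] DERIV_pow[of "m + 2" r] in simp_all)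
    moreover have "L * ((s + d) * (real (m + 1) * r ^ (m + 1 - 1)) / (real m + 1) - (real (m + 2) * r ^ (m + 2 - 1)) / (real m + 2))
      = L * (s + d - r) * r ^ m"
    proof -
      have "(s + d) * (real (m + 1) * r ^ (m + 1 - 1)) / (real m + 1) = (s + d) * r ^ m"
        "(real (m + 2) * r ^ (m + 2 - 1)) / (real m + 2) = r * r ^ m"
        by (auto simp: divide_simps)
      then show ?thesis by (simp add: algebra_simps)
    qed
    ultimately show "((\<lambda>r. L * ((s + d) * r ^ (m + 1) / (real m + 1) - r ^ (m + 2) / (real m + 2))) has_real_derivative
      L * (s + d - r) * r ^ m) (at r)" by metis
  qed (use assms in \<open>auto intro!: continuous_intros\<close>)
  have "(s + d) * (s + d) ^ (m + 1) = (s + d) ^ (m + 2)" "s * s ^ (m + 1) = s ^ (m + 2)" by simp_all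
  then have eq: "(L * d * s ^ (m + 1) / (real m + 1) - L * d * 0 ^ (m + 1) / (real m + 1)) + (?G (s + d) - ?G s)
    = L * ((s + d) ^ (m + 2) - s ^ (m + 2)) / ((real m + 1) * (real m + 2))"
    by (simp add: divide_simps add_pos_nonneg del: power_Suc) (simp add: algebra_simps)
  have ae: "AE r in lborel. r \<noteq> 0" "AE r in lborel. r \<noteq> s" by (rule AE_lborel_singleton)+
  have "AE r in lborel. indicator {0<..} r * r ^ m * cone_profile L s d r =
      (L * d * r ^ m) * indicator {0..s} r + (L * (s + d - r) * r ^ m) * indicator {s..s+d} r"
    using ae
  proof eventually_elim
    fix r assume r: "r \<noteq> 0" "r \<noteq> s"
    consider "r < 0" | "0 < r" "r < s" | "s < r" "r \<le> s + d" | "r > s + d" using r by linarith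
    then show "indicator {0<..} r * r ^ m * cone_profile L s d r =
      (L * d * r ^ m) * indicator {0..s} r + (L * (s + d - r) * r ^ m) * indicator {s..s+d} r"
    proof cases
      case 2
      then have "L * d \<le> L * (s + d - r)" "0 \<le> L * d" using assms by (auto intro!: mult_left_mono)
      then show ?thesis using 2 by (simp add: cone_profile_def)
    next
      case 3
      then have "L * (s + d - r) \<le> L * d" "0 \<le> L * (s + d - r)" using assms by (auto intro!: mult_left_mono)
      then show ?thesis using 3 assms by (simp add: cone_profile_def)
    next
      case 4
      then have "L * (s + d - r) \<le> 0" using assms by (auto intro!: mult_nonneg_nonpos)
      moreover have "0 \<le> L * d" using assms by simp
      ultimately show ?thesis using 4 assms by (simp add: cone_profile_def)
    qed (use assms in auto)
  qed
  moreover have "(\<lambda>r. indicator {0<..} r * r ^ m * cone_profile L s d r) \<in> borel_measurable lborel"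
    unfolding cone_profile_def by measurable
  ultimately show ?thesis
    using has_bochner_integral_add[OF 1 2] unfolding eq
    by (subst has_bochner_integral_cong_AE) (auto simp only: has_bochner_integral_iff borel_measurable_integrable)
qed

text \<open>Outside \<open>[s, s + d]\<close> the bounds on \<open>f\<close> decide the comparison,
  and inside it the cone falls as steeply as an \<open>L\<close>-Lipschitz function can. One point
  of equality therefore separates the two regimes: after it \<open>f\<close> cannot drop below the
  cone, and before it \<open>f\<close> cannot lie above.\<close>

lemma cone_crossing:
  fixes f :: "real \<Rightarrow> real"
  assumes L: "L \<ge> 0" and s: "s \<ge> 0" and d: "d \<ge> 0"
    and f: "\<And>r. 0 \<le> f r" "\<And>r. f r \<le> L * d"
    and lip: "\<And>r r'. \<bar>f r - f r'\<bar> \<le> L * \<bar>r - r'\<bar>"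
  obtains r0 where "0 \<le> r0" "\<And>r. r \<le> r0 \<Longrightarrow> f r \<le> cone_profile L s d r" "\<And>r. r0 \<le> r \<Longrightarrow> cone_profile L s d r \<le> f r"
proof -
  have cone1: "cone_profile L s d r = L * d" if "r \<le> s" for r
  proof -
    have "L * d \<le> L * (s + d - r)" "0 \<le> L * d" using that L d by (auto intro!: mult_left_mono)
    then show ?thesis by (simp add: cone_profile_def)
  qed
  have cone2: "cone_profile L s d r = L * (s + d - r)" if "s \<le> r" "r \<le> s + d" for r
  proof -
    have "L * (s + d - r) \<le> L * d" "0 \<le> L * (s + d - r)" using that L d by (auto intro!: mult_left_mono)
    then show ?thesis by (simp add: cone_profile_def)
  qed
  have cone3: "cone_profile L s d r = 0" if "r \<ge> s + d" for r
  proof -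
    have "L * (s + d - r) \<le> 0" using that L by (auto intro!: mult_nonneg_nonpos)
    then show ?thesis by (simp add: cone_profile_def)
  qed
  have cont: "continuous_on {s..s+d} f"
  proof -
    have "L-lipschitz_on UNIV f" using lip L by (auto simp: lipschitz_on_def dist_real_def)
    then show ?thesis using lipschitz_on_continuous_on continuous_on_subset by blast
  qed
  \<comment> \<open>At \<open>s\<close> the cone has the maximal value \<open>L * d\<close>, at
    \<open>s + d\<close> it is \<open>0\<close>; the difference to \<open>f\<close> changes sign in
    between.\<close>
  have "\<exists>r0. s \<le> r0 \<and> r0 \<le> s + d \<and> f r0 - cone_profile L s d r0 = 0"
    using f d cone1[of s] cone3[of "s + d"] unfolding cone_profile_def
    by (intro IVT' continuous_intros cont) auto
  then obtain r0 where r0: "s \<le> r0" "r0 \<le> s + d" "f r0 = L * (s + d - r0)"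
    using cone2 by auto
  show ?thesis
  proof
    show "0 \<le> r0" using r0 s by simp
    show "f r \<le> cone_profile L s d r" if "r \<le> r0" for r
    proof (cases "r \<le> s")
      case False
      then show ?thesis using cone2[of r] r0 that lip[of r r0] by (simp add: algebra_simps)
    qed (use f cone1 in auto)
    show "cone_profile L s d r \<le> f r" if "r0 \<le> r" for r
    proof (cases "r \<le> s + d")
      case True
      then show ?thesis using cone2[of r] r0 that lip[of r r0] by (simp add: algebra_simps)
    qed (use f cone3 in auto)
  qed
qed

text \<open>With \<open>r0\<close> the crossing point, \<open>r ^ p - r0 ^ p\<close> and
  \<open>f r - cone_profile L s d r\<close> have the same sign for every \<open>r > 0\<close>, so
  their product integrates to something nonnegative against \<open>r ^ m\<close>. The part with the
  constant \<open>r0 ^ p\<close> drops out because the masses agree.\<close>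

lemma cone_moment_le:
  fixes f :: "real \<Rightarrow> real" and m p :: nat
  assumes L: "L \<ge> 0" and s: "s \<ge> 0" and d: "d \<ge> 0"
    and f: "\<And>r. 0 \<le> f r" "\<And>r. f r \<le> L * d"
    and lip: "\<And>r r'. \<bar>f r - f r'\<bar> \<le> L * \<bar>r - r'\<bar>"
    and int: "integrable lborel (\<lambda>r. indicator {0<..} r * r ^ m * f r)"
    and intp: "integrable lborel (\<lambda>r. indicator {0<..} r * r ^ (m + p) * f r)"
    and mass: "(LBINT r. indicator {0<..} r * r ^ m * f r) =
      L * ((s + d) ^ (m + 2) - s ^ (m + 2)) / ((real m + 1) * (real m + 2))"
  shows "L * ((s + d) ^ (m + p + 2) - s ^ (m + p + 2)) / ((real (m + p) + 1) * (real (m + p) + 2))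
    \<le> (LBINT r. indicator {0<..} r * r ^ (m + p) * f r)"
proof -
  obtain r0 where r0: "0 \<le> r0" "\<And>r. r \<le> r0 \<Longrightarrow> f r \<le> cone_profile L s d r" "\<And>r. r0 \<le> r \<Longrightarrow> cone_profile L s d r \<le> f r"
    using cone_crossing[OF L s d f lip] by blast
  note c1 = has_bochner_integral_integrable[OF int, THEN has_bochner_integral_diff, OF cone_moment[OF L s d, of m]]
  note c2 = has_bochner_integral_integrable[OF intp, THEN has_bochner_integral_diff, OF cone_moment[OF L s d, of "m + p"]]
  have "0 \<le> (LBINT r. (indicator {0<..} r * r ^ (m + p) * f r - indicator {0<..} r * r ^ (m + p) * cone_profile L s d r)
      - r0 ^ p * (indicator {0<..} r * r ^ m * f r - indicator {0<..} r * r ^ m * cone_profile L s d r))"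
  proof (intro integral_nonneg_AE AE_I2)
    fix r :: real
    have "0 \<le> r ^ m * ((r ^ p - r0 ^ p) * (f r - cone_profile L s d r))" if "r > 0"
    proof -
      have "0 \<le> (r ^ p - r0 ^ p) * (f r - cone_profile L s d r)"
      proof (cases "r \<le> r0")
        case True
        then show ?thesis using r0(2)[OF True] power_mono[OF True, of p] that by (auto intro: mult_nonpos_nonpos)
      next
        case False
        then show ?thesis using r0(3)[of r] power_mono[of r0 r p] r0(1) by (auto intro: mult_nonneg_nonneg)
      qed
      then show ?thesis using that by simp
    qed
    then show "0 \<le> (indicator {0<..} r * r ^ (m + p) * f r - indicator {0<..} r * r ^ (m + p) * cone_profile L s d r)
      - r0 ^ p * (indicator {0<..} r * r ^ m * f r - indicator {0<..} r * r ^ m * cone_profile L s d r)"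
      by (auto simp: indicator_def algebra_simps power_add)
  qed
  also have "\<dots> = ((LBINT r. indicator {0<..} r * r ^ (m + p) * f r) -
      L * ((s + d) ^ (m + p + 2) - s ^ (m + p + 2)) / ((real (m + p) + 1) * (real (m + p) + 2))) - r0 ^ p * 0"
    using has_bochner_integral_diff[OF c2 has_bochner_integral_mult_right[OF c1, of "r0 ^ p"]]
    unfolding mass by (simp add: has_bochner_integral_iff)
  finally show ?thesis by simp
qed

text \<open>The mean over directions is written as an average over the solid unit ball of a function
  of \<open>sgn \<eta>\<close>, so Lebesgue measure replaces surface measure. The formula makes
  sense for negative \<open>r\<close> too, so bounds and Lipschitz estimates can be stated on the
  whole real line.\<close>

definition spherical_mean :: "('a::euclidean_space \<Rightarrow> real) \<Rightarrow> real \<Rightarrow> real" where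
  "spherical_mean F r = (LBINT \<eta>. indicator (ball 0 1) \<eta> * F (r *\<^sub>R sgn \<eta>)) / measure lborel (ball (0::'a) 1)"

lemma measure_ball_pos: "measure lborel (ball (0::'a::euclidean_space) 1) > 0"
  using content_ball_pos[of 1 "0::'a"] by simp

lemma borel_measurable_sgn [measurable]: "(sgn :: 'a::euclidean_space \<Rightarrow> 'a) \<in> borel_measurable borel"
  unfolding sgn_div_norm by measurable

lemma integrable_ball_sgn:
  fixes F :: "'a::euclidean_space \<Rightarrow> real"
  assumes [measurable]: "F \<in> borel_measurable borel" and F: "\<And>x. \<bar>F x\<bar> \<le> M"
  shows "integrable lborel (\<lambda>\<eta>::'a. indicator (ball 0 1) \<eta> * F (r *\<^sub>R sgn \<eta>))"
proof (rule Bochner_Integration.integrable_bound)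
  have [measurable]: "ball (0::'a) 1 \<in> sets borel" by simp
  have "emeasure lborel (ball (0::'a) 1) < \<infinity>" by (rule emeasure_bounded_finite) simp
  then show "integrable lborel (\<lambda>\<eta>::'a. indicator (ball 0 1) \<eta> * M)"
    by (intro integrable_mult_left integrable_real_indicator) auto
  show "(\<lambda>\<eta>::'a. indicator (ball 0 1) \<eta> * F (r *\<^sub>R sgn \<eta>)) \<in> borel_measurable lborel"
    by measurable
  show "AE x in lborel. norm (indicator (ball 0 1) x * F (r *\<^sub>R sgn x)) \<le> norm (indicator (ball (0::'a) 1) x * M)"
    using F order_trans[OF F abs_ge_self] by (auto simp: indicator_def)
qed

text \<open>In polar coordinates the weight \<open>g\<close> depends on the radius alone, so after
  exchanging the integrals the integration over directions acts only on \<open>F\<close>. Since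
  \<open>n * \<omega>\<close> is the area of the unit sphere, this is the usual reduction to one
  dimension.\<close>

lemma nn_integral_radial_mult:
  fixes F :: "'a::euclidean_space \<Rightarrow> real" and g :: "real \<Rightarrow> real"
  assumes [measurable]: "F \<in> borel_measurable borel" "g \<in> borel_measurable borel"
    and F: "\<And>x. 0 \<le> F x" "\<And>x. F x \<le> M" and g: "\<And>r. 0 \<le> r \<Longrightarrow> 0 \<le> g r"
  shows "(\<integral>\<^sup>+\<xi>. g (norm \<xi>) * F \<xi> \<partial>lborel) = (\<integral>\<^sup>+r. DIM('a) * measure lborel (ball (0::'a) 1) *
      (indicator {0<..} r * r ^ (DIM('a) - 1) * g r * spherical_mean F r) \<partial>lborel)"
proof -
  let ?n = "DIM('a)" and ?w = "measure lborel (ball (0::'a) 1)"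
  have [measurable]: "ball (0::'a) 1 \<in> sets borel" by simp
  have ae: "AE \<eta> in lborel. \<eta> \<noteq> (0::'a)" by (rule AE_lborel_singleton)
  have sm: "(\<integral>\<^sup>+\<eta>. indicator (ball 0 1) \<eta> * ennreal (F (r *\<^sub>R sgn \<eta>)) \<partial>lborel) = ennreal (?w * spherical_mean F r)" for r
  proof -
    have "(\<integral>\<^sup>+\<eta>. indicator (ball 0 1) \<eta> * ennreal (F (r *\<^sub>R sgn \<eta>)) \<partial>lborel)
       = (\<integral>\<^sup>+\<eta>. ennreal (indicator (ball 0 1) \<eta> * F (r *\<^sub>R sgn \<eta>)) \<partial>lborel)"
      by (intro nn_integral_cong) (auto simp: indicator_def)
    also have "\<dots> = ennreal (LBINT \<eta>. indicator (ball 0 1) \<eta> * F (r *\<^sub>R sgn \<eta>))"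
      using F by (intro nn_integral_eq_integral integrable_ball_sgn[of _ M]) auto
    finally show ?thesis using measure_ball_pos[where 'a='a] by (simp add: spherical_mean_def)
  qed
  have sm0: "spherical_mean F r \<ge> 0" for r
    unfolding spherical_mean_def using F by (auto intro!: divide_nonneg_nonneg integral_nonneg_AE)
  have "(\<integral>\<^sup>+\<xi>. g (norm \<xi>) * F \<xi> \<partial>lborel) = ?n * (\<integral>\<^sup>+\<eta>. indicator (ball 0 1) \<eta> *
      (\<integral>\<^sup>+r. indicator {0<..} r * ennreal (r ^ (?n - 1)) * ennreal (g (norm (r *\<^sub>R sgn \<eta>)) * F (r *\<^sub>R sgn \<eta>)) \<partial>lborel) \<partial>lborel)"
    by (rule nn_integral_polar) measurable
  also have "\<dots> = ?n * (\<integral>\<^sup>+\<eta>. (\<integral>\<^sup>+r. indicator {0<..} r * ennreal (r ^ (?n - 1) * g r) * (indicator (ball 0 1) \<eta> * ennreal (F (r *\<^sub>R sgn \<eta>))) \<partial>lborel) \<partial>lborel)"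
    using ae
  proof (intro arg_cong2[where f="(*)"] refl nn_integral_cong_AE, eventually_elim)
    fix \<eta> :: 'a assume "\<eta> \<noteq> 0"
    have "indicator (ball 0 1) \<eta> * (\<integral>\<^sup>+r. indicator {0<..} r * ennreal (r ^ (?n - 1)) * ennreal (g (norm (r *\<^sub>R sgn \<eta>)) * F (r *\<^sub>R sgn \<eta>)) \<partial>lborel)
      = (\<integral>\<^sup>+r. indicator (ball 0 1) \<eta> * (indicator {0<..} r * ennreal (r ^ (?n - 1)) * ennreal (g (norm (r *\<^sub>R sgn \<eta>)) * F (r *\<^sub>R sgn \<eta>))) \<partial>lborel)"
      by (intro nn_integral_cmult[symmetric]) measurable
    also have "\<dots> = (\<integral>\<^sup>+r. indicator {0<..} r * ennreal (r ^ (?n - 1) * g r) * (indicator (ball 0 1) \<eta> * ennreal (F (r *\<^sub>R sgn \<eta>))) \<partial>lborel)"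
      using \<open>\<eta> \<noteq> 0\<close> F g
      by (intro nn_integral_cong) (auto simp: indicator_def norm_sgn ennreal_mult[symmetric] mult_ac)
    finally show "indicator (ball 0 1) \<eta> * (\<integral>\<^sup>+r. indicator {0<..} r * ennreal (r ^ (?n - 1)) * ennreal (g (norm (r *\<^sub>R sgn \<eta>)) * F (r *\<^sub>R sgn \<eta>)) \<partial>lborel)
      = (\<integral>\<^sup>+r. indicator {0<..} r * ennreal (r ^ (?n - 1) * g r) * (indicator (ball 0 1) \<eta> * ennreal (F (r *\<^sub>R sgn \<eta>))) \<partial>lborel)" .
  qed
  also have "\<dots> = ?n * (\<integral>\<^sup>+r. (\<integral>\<^sup>+\<eta>. indicator {0<..} r * ennreal (r ^ (?n - 1) * g r) * (indicator (ball 0 1) \<eta> * ennreal (F (r *\<^sub>R sgn \<eta>))) \<partial>lborel) \<partial>lborel)"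
    by (intro arg_cong2[where f="(*)"] refl lborel_pair.Fubini') measurable
  also have "\<dots> = ?n * (\<integral>\<^sup>+r. indicator {0<..} r * ennreal (r ^ (?n - 1) * g r) * ennreal (?w * spherical_mean F r) \<partial>lborel)"
    unfolding sm[symmetric]
    by (intro arg_cong2[where f="(*)"] refl nn_integral_cong nn_integral_cmult) measurable
  also have "\<dots> = (\<integral>\<^sup>+r. ?n * (indicator {0<..} r * ennreal (r ^ (?n - 1) * g r) * ennreal (?w * spherical_mean F r)) \<partial>lborel)"
    unfolding sm[symmetric] by (intro nn_integral_cmult[symmetric]) measurable
  also have "\<dots> = (\<integral>\<^sup>+r. ?n * ?w * (indicator {0<..} r * r ^ (?n - 1) * g r * spherical_mean F r) \<partial>lborel)"
    using sm0 g by (intro nn_integral_cong)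
     (auto simp: indicator_def ennreal_mult[symmetric] ennreal_of_nat_eq_real_of_nat mult_ac)
  finally show ?thesis .
qed

lemma spherical_mean_bounds:
  fixes F :: "'a::euclidean_space \<Rightarrow> real"
  assumes [measurable]: "F \<in> borel_measurable borel" and F: "\<And>x. 0 \<le> F x" "\<And>x. F x \<le> M"
  shows "0 \<le> spherical_mean F r" "spherical_mean F r \<le> M"
proof -
  show "0 \<le> spherical_mean F r"
    unfolding spherical_mean_def using F by (auto intro!: divide_nonneg_nonneg integral_nonneg_AE)
  have "(LBINT \<eta>. indicator (ball 0 1) \<eta> * F (r *\<^sub>R sgn \<eta>)) \<le> (LBINT \<eta>. indicator (ball (0::'a) 1) \<eta> * M)"
    using F order_trans[OF F] integrable_ball_sgn[of "\<lambda>_::'a. M" "\<bar>M\<bar>"]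
    by (intro integral_mono integrable_ball_sgn[of _ M]) (auto simp: indicator_def)
  then show "spherical_mean F r \<le> M"
    using measure_ball_pos[where 'a='a] by (simp add: spherical_mean_def divide_le_eq mult.commute)
qed

lemma spherical_mean_lipschitz:
  fixes F :: "'a::euclidean_space \<Rightarrow> real"
  assumes [measurable]: "F \<in> borel_measurable borel" and F: "\<And>x. \<bar>F x\<bar> \<le> M"
    and lip: "\<And>x y. \<bar>F x - F y\<bar> \<le> L * norm (x - y)"
  shows "\<bar>spherical_mean F r - spherical_mean F r'\<bar> \<le> L * \<bar>r - r'\<bar>"
proof -
  let ?w = "measure lborel (ball (0::'a) 1)"
  have le: "\<bar>F (r *\<^sub>R sgn \<eta>) - F (r' *\<^sub>R sgn \<eta>)\<bar> \<le> L * \<bar>r - r'\<bar>" for \<eta>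
  proof -
    \<comment> \<open>At \<open>\<eta> = 0\<close> both values of \<open>F\<close> coincide and
      \<open>0 \<le> L * \<bar>r - r'\<bar>\<close> is needed; it follows from the Lipschitz bound
      at two points whose distance is \<open>\<bar>r - r'\<bar>\<close>.\<close>
    have "0 \<le> L * norm ((r - r') *\<^sub>R (SOME b. b \<in> Basis :: 'a))"
      using lip[of "(r - r') *\<^sub>R (SOME b. b \<in> Basis)" 0] by (simp add: order_trans[OF abs_ge_zero])
    then have "0 \<le> L * \<bar>r - r'\<bar>" by (simp add: SOME_Basis)
    then show ?thesis
      using lip[of "r *\<^sub>R sgn \<eta>" "r' *\<^sub>R sgn \<eta>"]
      by (cases "\<eta> = 0") (auto simp: scaleR_diff_left[symmetric] norm_sgn)
  qed
  have "spherical_mean F r - spherical_mean F r' =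
     (LBINT \<eta>. indicator (ball 0 1) \<eta> * (F (r *\<^sub>R sgn \<eta>) - F (r' *\<^sub>R sgn \<eta>))) / ?w"
    unfolding spherical_mean_def
    unfolding diff_divide_distrib[symmetric] right_diff_distrib
    by (subst Bochner_Integration.integral_diff) (intro integrable_ball_sgn[OF assms(1) F] refl)+
  also have "\<bar>\<dots>\<bar> \<le> (LBINT \<eta>. indicator (ball (0::'a) 1) \<eta> * (L * \<bar>r - r'\<bar>)) / ?w"
    unfolding abs_divide abs_of_pos[OF measure_ball_pos]
  proof (intro divide_right_mono integral_abs_bound[THEN order_trans] integral_mono integrable_abs)
    show "integrable lborel (\<lambda>\<eta>::'a. indicator (ball 0 1) \<eta> * (F (r *\<^sub>R sgn \<eta>) - F (r' *\<^sub>R sgn \<eta>)))"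
      unfolding right_diff_distrib using integrable_ball_sgn[OF assms(1) F] by simp
    show "integrable lborel (\<lambda>\<eta>::'a. indicator (ball 0 1) \<eta> * (L * \<bar>r - r'\<bar>))"
      using integrable_ball_sgn[of "\<lambda>_::'a. L * \<bar>r - r'\<bar>" "\<bar>L * \<bar>r - r'\<bar>\<bar>"] by simp
  qed (use le in \<open>auto simp: indicator_def\<close>)
  also have "\<dots> = L * \<bar>r - r'\<bar>"
    using measure_ball_pos[where 'a='a] by simp
  finally show ?thesis .
qed

text \<open>The spherical mean \<open>f\<close> inherits the bounds and the Lipschitz constant of
  \<open>F\<close>, and its moments with weight \<open>n * \<omega> * r ^ (n - 1)\<close> are those
  of \<open>F\<close>. The equation for \<open>k\<close> says that the cone, as a radial function,
  has mass \<open>k\<close>; the comparison is then one-dimensional with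
  \<open>m = n - 1\<close>.\<close>

lemma radial_moment_bound:
  fixes F :: "'a::euclidean_space \<Rightarrow> real" and L d s k :: real and p :: nat
  defines "n \<equiv> DIM('a)" and "\<omega> \<equiv> measure lborel (ball (0::'a) 1)"
  assumes F: "\<And>x. 0 \<le> F x" "\<And>x. F x \<le> L * d"
    and lip: "\<And>x y. \<bar>F x - F y\<bar> \<le> L * norm (x - y)"
    and L: "L \<ge> 0" and s: "s \<ge> 0" and d: "d \<ge> 0"
    and k: "k * (real n + 1) = \<omega> * L * ((s + d) ^ (n + 1) - s ^ (n + 1))"
    and mass: "(\<integral>\<^sup>+\<xi>. F \<xi> \<partial>lborel) = ennreal k" and k0: "k \<ge> 0"
  shows "ennreal (real n * \<omega> * L * ((s + d) ^ (n + p + 1) - s ^ (n + p + 1)) / (real (n + p) * (real (n + p) + 1)))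
    \<le> (\<integral>\<^sup>+\<xi>. norm \<xi> ^ p * F \<xi> \<partial>lborel)"
proof -
  define f where "f = spherical_mean F"
  have n: "n > 0" by (simp add: n_def)
  have w: "\<omega> > 0" unfolding \<omega>_def by (rule measure_ball_pos)
  have Fabs: "\<bar>F x\<bar> \<le> L * d" for x using F[of x] by simp
  have "L-lipschitz_on UNIV F" using lip L by (auto simp: lipschitz_on_def dist_norm)
  then have Fm [measurable]: "F \<in> borel_measurable borel"
    by (intro borel_measurable_continuous_onI lipschitz_on_continuous_on)
  have flip: "\<bar>f r - f r'\<bar> \<le> L * \<bar>r - r'\<bar>" for r r'
    unfolding f_def by (rule spherical_mean_lipschitz[OF Fm Fabs lip])
  then have "L-lipschitz_on UNIV f" using L by (auto simp: lipschitz_on_def dist_norm)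
  then have fm [measurable]: "f \<in> borel_measurable borel"
    by (intro borel_measurable_continuous_onI lipschitz_on_continuous_on)
  have f: "0 \<le> f r" "f r \<le> L * d" for r
    using spherical_mean_bounds[OF Fm F] by (auto simp: f_def)
  have radial: "(\<integral>\<^sup>+\<xi>. norm \<xi> ^ q * F \<xi> \<partial>lborel) =
     (\<integral>\<^sup>+r. n * \<omega> * (indicator {0<..} r * r ^ (n - 1 + q) * f r) \<partial>lborel)" for q
    using nn_integral_radial_mult[OF Fm _ F, of "\<lambda>r. r ^ q"]
    unfolding n_def \<omega>_def f_def power_add mult.assoc by simp
  have has: "integrable lborel (\<lambda>r. indicator {0<..} r * r ^ (n - 1 + q) * f r) \<and>
    n * \<omega> * (LBINT r. indicator {0<..} r * r ^ (n - 1 + q) * f r) = K"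
    if "(\<integral>\<^sup>+\<xi>. norm \<xi> ^ q * F \<xi> \<partial>lborel) = ennreal K" "K \<ge> 0" for q K
  proof -
    have "has_bochner_integral lborel (\<lambda>r. n * \<omega> * (indicator {0<..} r * r ^ (n - 1 + q) * f r)) K"
      using that w n f unfolding radial
      by (intro has_bochner_integral_nn_integral) (auto simp: indicator_def)
    from has_bochner_integral_mult_right[OF this, of "1 / (n * \<omega>)"] this show ?thesis
      using w n by (simp add: has_bochner_integral_iff)
  qed
  have m: "integrable lborel (\<lambda>r. indicator {0<..} r * r ^ (n - 1) * f r)"
    "n * \<omega> * (LBINT r. indicator {0<..} r * r ^ (n - 1) * f r) = k"
    using has[of 0 k] mass k0 by auto
  have mass': "(LBINT r. indicator {0<..} r * r ^ (n - 1) * f r) =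
      L * ((s + d) ^ (n - 1 + 2) - s ^ (n - 1 + 2)) / ((real (n - 1) + 1) * (real (n - 1) + 2))"
  proof -
    have "n * \<omega> * (LBINT r. indicator {0<..} r * r ^ (n - 1) * f r) * (real n + 1) =
       \<omega> * L * ((s + d) ^ (n + 1) - s ^ (n + 1))" using m(2) k by simp
    then have "\<omega> * ((LBINT r. indicator {0<..} r * r ^ (n - 1) * f r) * (n * (real n + 1))) =
        \<omega> * (L * ((s + d) ^ (n + 1) - s ^ (n + 1)))"
      by (simp only: mult_ac)
    then have "(LBINT r. indicator {0<..} r * r ^ (n - 1) * f r) * (n * (real n + 1)) =
        L * ((s + d) ^ (n + 1) - s ^ (n + 1))"
      using w by simp
    then have "(LBINT r. indicator {0<..} r * r ^ (n - 1) * f r) =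
        L * ((s + d) ^ (n + 1) - s ^ (n + 1)) / (n * (real n + 1))"
      using n by (intro nonzero_eq_divide_eq[THEN iffD2]) auto
    moreover have "n - 1 + 2 = n + 1" "real (n - 1) + 1 = real n" "real (n - 1) + 2 = real n + 1"
      using n by auto
    ultimately show ?thesis by simp
  qed
  show ?thesis
  \<comment> \<open>The one-dimensional comparison requires an integrable moment; if the moment is
    infinite, there is nothing to prove.\<close>
  proof (cases "(\<integral>\<^sup>+\<xi>. norm \<xi> ^ p * F \<xi> \<partial>lborel)")
    case (real K)
    then have P: "integrable lborel (\<lambda>r. indicator {0<..} r * r ^ (n - 1 + p) * f r)"
      "n * \<omega> * (LBINT r. indicator {0<..} r * r ^ (n - 1 + p) * f r) = K"
      using has[of p K] by auto
    have "L * ((s + d) ^ (n - 1 + p + 2) - s ^ (n - 1 + p + 2)) / ((real (n - 1 + p) + 1) * (real (n - 1 + p) + 2))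
      \<le> (LBINT r. indicator {0<..} r * r ^ (n - 1 + p) * f r)"
      by (rule cone_moment_le[OF L s d f flip m(1) P(1) mass'])
    then have "n * \<omega> * (L * ((s + d) ^ (n - 1 + p + 2) - s ^ (n - 1 + p + 2)) / ((real (n - 1 + p) + 1) * (real (n - 1 + p) + 2))) \<le> K"
      unfolding P(2)[symmetric] using n w by (intro mult_left_mono) auto
    moreover have "n - 1 + p + 2 = n + p + 1" "real (n - 1 + p) + 1 = real (n + p)" "real (n - 1 + p) + 2 = real (n + p) + 1"
      using n by auto
    ultimately show ?thesis unfolding real(2)
      by (intro ennreal_leI) (simp add: mult.assoc add_ac)
  qed simp
qed

subsection \<open>Lower bound for the moment of inertia\<close>

lemma nn_integral_lborel_translate:
  fixes f :: "'a::euclidean_space \<Rightarrow> ennreal"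
  assumes [measurable]: "f \<in> borel_measurable borel"
  shows "(\<integral>\<^sup>+x. f (x - c) \<partial>lborel) = (\<integral>\<^sup>+x. f x \<partial>lborel)"
proof -
  have "(\<integral>\<^sup>+x. f x \<partial>lborel) = (\<integral>\<^sup>+x. f x \<partial>distr lborel borel ((+) (-c)))"
    by (simp add: lborel_distr_plus)
  also have "\<dots> = (\<integral>\<^sup>+x. f (x - c) \<partial>lborel)"
    by (subst nn_integral_distr) (auto intro!: nn_integral_cong)
  finally show ?thesis by simp
qed

text \<open>Polar coordinates for the constant function \<open>1\<close>, whose spherical mean is
  \<open>1\<close>; after a translation the ball becomes the condition \<open>r < R\<close> on the
  radius.\<close>

lemma second_moment_ball:
  fixes c :: "'a::euclidean_space" and R :: real
  defines "n \<equiv> DIM('a)" and "\<omega> \<equiv> measure lborel (ball (0::'a) 1)"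
  assumes R: "R \<ge> 0"
  shows "has_bochner_integral lborel (\<lambda>x. indicator (ball c R) x * (norm (x - c))\<^sup>2)
    (real n * \<omega> * R ^ (n + 2) / (real n + 2))"
proof (rule has_bochner_integral_nn_integral)
  have [measurable]: "ball c R \<in> sets borel" "ball (0::'a) R \<in> sets borel" "{..<R} \<in> sets borel" by simp_all
  have n: "n > 0" by (simp add: n_def)
  have w: "\<omega> > 0" unfolding \<omega>_def by (rule measure_ball_pos)
  have sm: "spherical_mean (\<lambda>_::'a. 1) r = 1" for r
    using measure_ball_pos[where 'a='a] by (simp add: spherical_mean_def)
  have "(\<integral>\<^sup>+x. ennreal (indicator (ball c R) x * (norm (x - c))\<^sup>2) \<partial>lborel) =
     (\<integral>\<^sup>+x. ennreal (indicator {..<R} (norm (x - c)) * (norm (x - c))\<^sup>2) \<partial>lborel)"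
    by (intro nn_integral_cong) (auto simp: indicator_def dist_norm norm_minus_commute)
  also have "\<dots> = (\<integral>\<^sup>+x. ennreal (indicator {..<R} (norm x) * (norm x)\<^sup>2) \<partial>(lborel :: 'a measure))"
    by (rule nn_integral_lborel_translate) measurable
  also have "\<dots> = (\<integral>\<^sup>+r. n * \<omega> * (indicator {0<..} r * r ^ (n - 1) * (indicator {..<R} r * r\<^sup>2)) \<partial>lborel)"
    using nn_integral_radial_mult[of "\<lambda>_::'a. 1" "\<lambda>r. indicator {..<R} r * r\<^sup>2" 1]
    by (simp add: n_def \<omega>_def sm)
  also have "\<dots> = (\<integral>\<^sup>+r. ennreal ((n * \<omega> * r ^ (n + 1)) * indicator {0..R} r) \<partial>lborel)"
  proof (intro nn_integral_cong_AE)
    have "AE r in lborel. r \<noteq> 0" "AE r in lborel. r \<noteq> R" by (rule AE_lborel_singleton)+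
    then show "AE r in lborel. ennreal (n * \<omega> * (indicator {0<..} r * r ^ (n - 1) * (indicator {..<R} r * r\<^sup>2))) =
      ennreal ((n * \<omega> * r ^ (n + 1)) * indicator {0..R} r)"
    proof eventually_elim
      fix r assume "r \<noteq> 0" "r \<noteq> R"
      moreover have "r ^ (n - 1) * r\<^sup>2 = r ^ (n + 1)" using n by (simp flip: power_add)
      ultimately show "ennreal (n * \<omega> * (indicator {0<..} r * r ^ (n - 1) * (indicator {..<R} r * r\<^sup>2))) =
      ennreal ((n * \<omega> * r ^ (n + 1)) * indicator {0..R} r)"
        by (auto simp: indicator_def simp del: power_Suc)
    qed
  qed
  also have "\<dots> = ennreal (n * \<omega> * (R ^ (n + 2) / (real n + 2)))"
  proof -
    have "has_bochner_integral lborel (\<lambda>r. (n * \<omega> * r ^ (n + 1)) * indicator {0..R} r)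
       (n * \<omega> * (R ^ (n + 2) / (real n + 2)) - n * \<omega> * (0 ^ (n + 2) / (real n + 2)))"
    proof (intro has_bochner_integral_FTC_Icc_real R)
      fix r :: real
      have "((\<lambda>r. n * \<omega> * (r ^ (n + 2) / (real n + 2))) has_real_derivative
        n * \<omega> * ((real (n + 2) * r ^ (n + 2 - 1)) / (real n + 2))) (at r)"
        by (intro DERIV_cmult DERIV_cdivide) (use DERIV_pow[of "n + 2" r] in simp)
      moreover have "(real (n + 2) * r ^ (n + 2 - 1)) / (real n + 2) = r ^ (n + 1)" by (auto simp: divide_simps)
      ultimately show "((\<lambda>r. n * \<omega> * (r ^ (n + 2) / (real n + 2))) has_real_derivative n * \<omega> * r ^ (n + 1)) (at r)"
        by metis
    qed (auto intro!: continuous_intros)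
    then have "has_bochner_integral lborel (\<lambda>r. (n * \<omega> * r ^ (n + 1)) * indicator {0..R} r)
       (n * \<omega> * (R ^ (n + 2) / (real n + 2)))" by simp
    moreover from this have "(\<integral>\<^sup>+r. ennreal ((n * \<omega> * r ^ (n + 1)) * indicator {0..R} r) \<partial>lborel) =
        ennreal (LBINT r. (n * \<omega> * r ^ (n + 1)) * indicator {0..R} r)"
      using w by (intro nn_integral_eq_integral) (auto simp: has_bochner_integral_iff indicator_def)
    ultimately show ?thesis by (simp add: has_bochner_integral_iff)
  qed
  finally show "(\<integral>\<^sup>+x. ennreal (indicator (ball c R) x * (norm (x - c))\<^sup>2) \<partial>lborel) = ennreal (real n * \<omega> * R ^ (n + 2) / (real n + 2))"
    by simp
  show "(\<lambda>x. indicator (ball c R) x * (norm (x - c))\<^sup>2) \<in> borel_measurable lborel"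
    by measurable
qed (use R in \<open>auto simp: \<omega>_def simp del: indicator_simps\<close>)

text \<open>For any centre \<open>c\<close> the product of
  \<open>indicator \<Omega> x - indicator (ball c R) x\<close> and
  \<open>(norm (x - c))\<^sup>2 - R\<^sup>2\<close> is nonnegative, and the \<open>R\<^sup>2\<close>
  terms cancel on integration because both sets have the same volume. The bound is the same for all
  \<open>c\<close>, hence it holds for the infimum.\<close>

lemma moment_of_inertia_ge:
  fixes \<Omega> :: "'a::euclidean_space set" and R :: real
  defines "n \<equiv> DIM('a)" and "\<omega> \<equiv> measure lborel (ball (0::'a) 1)"
  assumes \<Omega>: "open \<Omega>" "bounded \<Omega>" and R: "R \<ge> 0" and vol: "volume \<Omega> = \<omega> * R ^ n"
  shows "real n * \<omega> * R ^ (n + 2) / (real n + 2) \<le> moment_of_inertia \<Omega>"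
  unfolding moment_of_inertia_def
proof (rule cINF_greatest)
  fix c :: 'a
  have om: "\<Omega> \<in> sets lborel" using \<Omega> by simp
  have fin: "emeasure lborel \<Omega> < \<infinity>" "emeasure lborel (ball c R) < \<infinity>"
    using \<Omega> emeasure_bounded_finite[of \<Omega>] emeasure_bounded_finite[of "ball c R"] by auto
  have [measurable]: "\<Omega> \<in> sets borel" "ball c R \<in> sets borel" using \<Omega> by simp_all
  have m: "measure lborel \<Omega> = \<omega> * R ^ n" "measure lborel (ball c R) = \<omega> * R ^ n"
    using vol om R content_ball[of R c] content_ball[of 1 "0::'a"]
    by (auto simp: volume_def \<omega>_def n_def measure_completion)
  obtain K where K: "\<And>x. x \<in> \<Omega> \<Longrightarrow> norm (x - c) \<le> K"
    using \<Omega>(2) bounded_any_center[of \<Omega> c] by (auto simp: dist_norm norm_minus_commute)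
  have i1: "integrable lborel (\<lambda>x. indicator \<Omega> x * (norm (x - c))\<^sup>2)"
  proof (rule Bochner_Integration.integrable_bound)
    show "integrable lborel (\<lambda>x. indicator \<Omega> x * K\<^sup>2)"
      using fin by (intro integrable_mult_left integrable_real_indicator) auto
    show "AE x in lborel. norm (indicator \<Omega> x * (norm (x - c))\<^sup>2) \<le> norm (indicator \<Omega> x * K\<^sup>2)"
      using K by (auto simp: indicator_def intro!: power_mono)
  qed measurable
  have i2: "has_bochner_integral lborel (\<lambda>x. indicator A x * R\<^sup>2) (measure lborel A * R\<^sup>2)"
    if "A \<in> sets borel" "emeasure lborel A < \<infinity>" for A :: "'a set"
    using that by (intro has_bochner_integral_mult_left has_bochner_integral_real_indicator) auto
  note i2 = i2[of \<Omega>, unfolded m(1)] i2[of "ball c R", unfolded m(2)]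
  have eq: "(LINT x|lebesgue_on \<Omega>. (norm (x - c))\<^sup>2) = (LBINT x. indicator \<Omega> x * (norm (x - c))\<^sup>2)"
    using \<Omega> by (simp add: integral_restrict_space integral_completion)
  have "0 \<le> (LBINT x. (indicator \<Omega> x * (norm (x - c))\<^sup>2 - indicator \<Omega> x * R\<^sup>2)
      - (indicator (ball c R) x * (norm (x - c))\<^sup>2 - indicator (ball c R) x * R\<^sup>2))"
  proof (intro integral_nonneg_AE AE_I2)
    fix x
    have "(norm (x - c))\<^sup>2 \<le> R\<^sup>2" if "norm (x - c) < R" using that by (intro power_mono) auto
    moreover have "R\<^sup>2 \<le> (norm (x - c))\<^sup>2" if "\<not> norm (x - c) < R" using that R by (intro power_mono) auto
    ultimately show "0 \<le> (indicator \<Omega> x * (norm (x - c))\<^sup>2 - indicator \<Omega> x * R\<^sup>2)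
      - (indicator (ball c R) x * (norm (x - c))\<^sup>2 - indicator (ball c R) x * R\<^sup>2)"
      by (auto simp: indicator_def dist_norm norm_minus_commute)
  qed
  also have "\<dots> = ((LBINT x. indicator \<Omega> x * (norm (x - c))\<^sup>2) - \<omega> * R ^ n * R\<^sup>2)
      - (real n * \<omega> * R ^ (n + 2) / (real n + 2) - \<omega> * R ^ n * R\<^sup>2)"
    using has_bochner_integral_diff[OF
       has_bochner_integral_diff[OF has_bochner_integral_integrable[OF i1] i2(1)[OF _ fin(1)]]
       has_bochner_integral_diff[OF second_moment_ball[OF R, of c] i2(2)[OF _ fin(2)]]]
    by (simp add: has_bochner_integral_iff n_def \<omega>_def)
  finally show "real n * \<omega> * R ^ (n + 2) / (real n + 2) \<le> (LINT x|lebesgue_on \<Omega>. (norm (x - c))\<^sup>2)"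
    unfolding eq by simp
qed simp

subsection \<open>Smooth functions and bump functions\<close>

lemma partial_deriv_eq: "(f has_derivative f') (at x) \<Longrightarrow> partial_deriv b f x = f' b"
  unfolding partial_deriv_def by (simp add: frechet_derivative_at[symmetric])

lemma partial_deriv_mult:
  assumes "f differentiable (at x)" "g differentiable (at x)"
  shows "partial_deriv b (\<lambda>x. f x * g x :: real) x = f x * partial_deriv b g x + partial_deriv b f x * g x"
proof -
  have "(f has_derivative frechet_derivative f (at x)) (at x)" "(g has_derivative frechet_derivative g (at x)) (at x)"
    using assms by (auto simp: frechet_derivative_works[symmetric])
  from has_derivative_mult[OF this] show ?thesis
    by (subst partial_deriv_eq) (auto simp: partial_deriv_def)
qed

lemma C_k_SucD: "C_k (Suc k) f \<Longrightarrow> C_k k f"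
proof (induction k arbitrary: f)
  case 0
  then show ?case by (auto intro!: continuous_at_imp_continuous_on differentiable_imp_continuous_within)
qed auto

lemma C_k_continuous: "C_k k f \<Longrightarrow> continuous_on UNIV f"
  by (induction k) (auto dest: C_k_SucD simp del: C_k.simps(2))

lemma C_k_const: "C_k k (\<lambda>x::'a::euclidean_space. c)"
proof (induction k arbitrary: c)
  case (Suc k)
  have "partial_deriv b (\<lambda>x::'a. c) = (\<lambda>x. 0)" for b by (intro ext partial_deriv_eq has_derivative_const)
  then show ?case using Suc[of 0] by simp
qed simp

lemma C_k_add: "C_k k f \<Longrightarrow> C_k k g \<Longrightarrow> C_k k (\<lambda>x. f x + g x)"
proof (induction k arbitrary: f g)
  case (Suc k)
  have "partial_deriv b (\<lambda>x. f x + g x) = (\<lambda>x. partial_deriv b f x + partial_deriv b g x)" for b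
  proof
    fix x
    have "(f has_derivative frechet_derivative f (at x)) (at x)" "(g has_derivative frechet_derivative g (at x)) (at x)"
      using Suc.prems by (auto simp: frechet_derivative_works[symmetric])
    from has_derivative_add[OF this] show "partial_deriv b (\<lambda>x. f x + g x) x = partial_deriv b f x + partial_deriv b g x"
      by (subst partial_deriv_eq) (auto simp: partial_deriv_def)
  qed
  then show ?case using Suc by auto
qed (auto intro: continuous_on_add)

lemma C_k_mult: "C_k k f \<Longrightarrow> C_k k g \<Longrightarrow> C_k k (\<lambda>x. f x * g x)"
proof (induction k arbitrary: f g)
  case (Suc k)
  have "partial_deriv b (\<lambda>x. f x * g x) = (\<lambda>x. f x * partial_deriv b g x + partial_deriv b f x * g x)" for b
    using Suc.prems by (intro ext partial_deriv_mult) auto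
  moreover have "C_k k f" "C_k k g" using Suc.prems by (auto dest!: C_k_SucD simp del: C_k.simps(2))
  ultimately show ?case using Suc by (auto intro!: C_k_add)
qed (auto intro: continuous_on_mult)

lemma C_k_prod: "finite A \<Longrightarrow> (\<And>i. i \<in> A \<Longrightarrow> C_k k (f i)) \<Longrightarrow> C_k k (\<lambda>x. \<Prod>i\<in>A. f i x)"
  by (induction A rule: finite_induct) (auto intro: C_k_const C_k_mult)

text \<open>The powers \<open>1 / t ^ j\<close> make the family closed under differentiation, which
  drives the proof of smoothness. The parameter \<open>c\<close> will tend to \<open>0\<close>, when
  \<open>exp (- c / t)\<close> tends to \<open>1\<close> for every \<open>t > 0\<close>.\<close>

definition flat_exp :: "real \<Rightarrow> nat \<Rightarrow> real \<Rightarrow> real" where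
  "flat_exp c j t = (if t > 0 then exp (- c / t) / t ^ j else 0)"

text \<open>From the right, in the variable \<open>c / t\<close>, which tends to infinity, this is
  the domination of a power by the exponential.\<close>

lemma flat_exp_tendsto_0: "c > 0 \<Longrightarrow> (flat_exp c j \<longlongrightarrow> 0) (at 0)"
proof -
  assume c: "c > 0"
  have lim: "filterlim (\<lambda>t::real. c / t) at_top (at_right 0)"
    unfolding divide_inverse
    by (rule filterlim_tendsto_pos_mult_at_top[OF tendsto_const c filterlim_inverse_at_top_right])
  have "((\<lambda>t. (c / t) ^ j / exp (c / t) / c ^ j) \<longlongrightarrow> 0 / c ^ j) (at_right 0)"
    by (intro tendsto_divide tendsto_const filterlim_compose[OF tendsto_power_div_exp_0 lim]) (use c in auto)
  then have "(flat_exp c j \<longlongrightarrow> 0) (at_right 0)"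
    by (rule Lim_transform_eventually[THEN tendsto_eq_rhs])
      (use c in \<open>auto simp: eventually_at_filter flat_exp_def field_simps exp_minus intro!: always_eventually\<close>)
  moreover have "(flat_exp c j \<longlongrightarrow> 0) (at_left 0)"
    by (rule tendsto_eventually) (auto simp: flat_exp_def eventually_at_filter)
  ultimately show ?thesis by (simp add: filterlim_split_at)
qed

lemma flat_exp_deriv:
  assumes c: "c > 0"
  shows "(flat_exp c j has_real_derivative c * flat_exp c (j + 2) t - j * flat_exp c (j + 1) t) (at t)"
proof -
  consider "t > 0" | "t < 0" | "t = 0" by linarith
  then show ?thesis
  proof cases
    case 1
    have "((\<lambda>t. exp (- c / t) / t ^ j) has_real_derivative c * flat_exp c (j + 2) t - j * flat_exp c (j + 1) t) (at t)"
    proof -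
      have *: "((\<lambda>t. exp (- c / t) / t ^ j) has_real_derivative
         ((exp (- c / t) * (c / t\<^sup>2)) * t ^ j - exp (- c / t) * (j * t ^ (j - Suc 0))) / (t ^ j * t ^ j)) (at t)"
        using 1 by (auto intro!: derivative_eq_intros simp: power2_eq_square)
      have "((exp (- c / t) * (c / t\<^sup>2)) * t ^ j - exp (- c / t) * (j * t ^ (j - Suc 0))) / (t ^ j * t ^ j)
         = c * flat_exp c (j + 2) t - j * flat_exp c (j + 1) t"
        using 1 by (cases j) (auto simp: flat_exp_def field_simps power2_eq_square)
      with * show ?thesis by simp
    qed
    then show ?thesis
      by (rule has_field_derivative_transform_within_open[of _ _ _ "{0<..}"]) (use 1 in \<open>auto simp: flat_exp_def\<close>)
  next
    case 2
    have "((\<lambda>t. 0) has_real_derivative 0) (at t)" by simp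
    then have "(flat_exp c j has_real_derivative 0) (at t)"
      by (rule has_field_derivative_transform_within_open[of _ _ _ "{..<0}"]) (use 2 in \<open>auto simp: flat_exp_def\<close>)
    then show ?thesis using 2 by (simp add: flat_exp_def)
  next
    case 3
    \<comment> \<open>The difference quotient at \<open>0\<close> is
      \<open>flat_exp c (j + 1)\<close> itself, so the limit just proved gives derivative
      \<open>0\<close>.\<close>
    have "((\<lambda>h. (flat_exp c j (0 + h) - flat_exp c j 0) / h) \<longlongrightarrow> 0) (at 0)"
    proof (rule Lim_transform_eventually[OF flat_exp_tendsto_0[OF c, of "j + 1"]])
      show "\<forall>\<^sub>F t in at 0. flat_exp c (j + 1) t = (flat_exp c j (0 + t) - flat_exp c j 0) / t"
        by (auto simp: eventually_at_filter flat_exp_def)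
    qed
    then show ?thesis using 3 by (simp add: DERIV_def flat_exp_def)
  qed
qed

text \<open>A partial derivative is a linear combination of the members \<open>j + 1\<close> and
  \<open>j + 2\<close> of the family; hence the induction on \<open>k\<close> keeps \<open>j\<close>
  arbitrary.\<close>

lemma C_k_flat_exp:
  fixes v :: "'a::euclidean_space"
  assumes c: "c > 0"
  shows "C_k k (\<lambda>x. flat_exp c j (x \<bullet> v + w))"
proof (induction k arbitrary: j)
  have d: "((\<lambda>x. flat_exp c j (x \<bullet> v + w)) has_derivative
     (\<lambda>h. (c * flat_exp c (j + 2) (x \<bullet> v + w) - j * flat_exp c (j + 1) (x \<bullet> v + w)) * (h \<bullet> v))) (at x)" for x j
  proof -
    have "((\<lambda>x. x \<bullet> v + w) has_derivative (\<lambda>h. h \<bullet> v)) (at x)" by (auto intro!: derivative_eq_intros)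
    from DERIV_compose_FDERIV[OF flat_exp_deriv[OF c] this] show ?thesis by (simp add: mult.commute)
  qed
  {
    case 0
    show ?case using d by (auto intro!: continuous_at_imp_continuous_on has_derivative_continuous)
  next
    case (Suc k)
    have "partial_deriv b (\<lambda>x. flat_exp c j (x \<bullet> v + w)) =
       (\<lambda>x. (c * (b \<bullet> v)) * flat_exp c (j + 2) (x \<bullet> v + w) + (- j * (b \<bullet> v)) * flat_exp c (j + 1) (x \<bullet> v + w))" for b
      by (intro ext, subst partial_deriv_eq[OF d]) (simp add: algebra_simps)
    moreover have "C_k k (\<lambda>x. (c * (b \<bullet> v)) * flat_exp c (j + 2) (x \<bullet> v + w) + (- j * (b \<bullet> v)) * flat_exp c (j + 1) (x \<bullet> v + w))" for b
      by (intro C_k_add C_k_mult C_k_const Suc)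
    ultimately show ?case by (auto simp only: C_k.simps intro: differentiableI[OF d])
  }
qed

text \<open>Smooth, between \<open>0\<close> and \<open>1\<close>, and positive exactly on the open
  box. As \<open>c\<close> tends to \<open>0\<close> it converges pointwise to the indicator of the
  box, which is how test functions come to detect integrals over boxes.\<close>

definition box_bump :: "real \<Rightarrow> 'a::euclidean_space \<Rightarrow> 'a \<Rightarrow> 'a \<Rightarrow> real" where
  "box_bump c l u x = (\<Prod>i\<in>Basis. flat_exp c 0 (x \<bullet> i - l \<bullet> i) * flat_exp c 0 (u \<bullet> i - x \<bullet> i))"

lemma C_k_box_bump: "c > 0 \<Longrightarrow> C_k k (box_bump c l u)"
proof -
  assume c: "c > 0"
  have 1: "C_k k (\<lambda>x. flat_exp c 0 (x \<bullet> i - l \<bullet> i))" for i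
    using C_k_flat_exp[OF c, of k 0 i "- (l \<bullet> i)"] by simp
  have 2: "C_k k (\<lambda>x. flat_exp c 0 (u \<bullet> i - x \<bullet> i))" for i
    using C_k_flat_exp[OF c, of k 0 "- i" "u \<bullet> i"] by (simp add: add.commute)
  show ?thesis unfolding box_bump_def[abs_def] by (intro C_k_prod C_k_mult 1 2) auto
qed

lemma box_bump_bounds: "c > 0 \<Longrightarrow> 0 \<le> box_bump c l u x" "c > 0 \<Longrightarrow> box_bump c l u x \<le> 1"
proof -
  have "0 \<le> flat_exp c 0 t \<and> flat_exp c 0 t \<le> 1" if "c > 0" for t using that by (auto simp: flat_exp_def)
  then show "c > 0 \<Longrightarrow> 0 \<le> box_bump c l u x" "c > 0 \<Longrightarrow> box_bump c l u x \<le> 1"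
    unfolding box_bump_def by (auto intro!: prod_nonneg prod_le_1 mult_nonneg_nonneg mult_le_one)
qed

lemma box_bump_eq_0: "x \<notin> box l u \<Longrightarrow> box_bump c l u x = 0"
  unfolding box_bump_def by (auto simp: box_def flat_exp_def prod_zero_iff)

lemma box_bump_tendsto: "(\<lambda>m. box_bump (1 / Suc m) l u x) \<longlonglongrightarrow> indicator (box l u) x"
proof (cases "x \<in> box l u")
  case True
  have *: "(\<lambda>m. flat_exp (1 / Suc m) 0 t) \<longlonglongrightarrow> 1" if "t > 0" for t
  proof -
    have "(\<lambda>m. exp (- (1 / Suc m) / t)) \<longlonglongrightarrow> exp (- 0 / t)"
      by (intro tendsto_intros LIMSEQ_Suc[OF lim_1_over_n[where 'a=real, simplified]]) (use that in auto)
    then show ?thesis using that by (simp add: flat_exp_def)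
  qed
  have "(\<lambda>m. box_bump (1 / Suc m) l u x) \<longlonglongrightarrow> (\<Prod>i\<in>(Basis::'a set). 1 * 1)"
    unfolding box_bump_def using True by (intro tendsto_prod tendsto_mult *) (auto simp: box_def)
  then show ?thesis using True by simp
qed (simp add: box_bump_eq_0)

lemma box_bump_test_function:
  assumes "c > 0" "cbox l u \<subseteq> \<Omega>"
  shows "box_bump c l u \<in> test_functions \<Omega>"
proof -
  have "{x. box_bump c l u x \<noteq> 0} \<subseteq> cbox l u"
    using box_bump_eq_0[of _ l u c] box_subset_cbox by blast
  then have "closure {x. box_bump c l u x \<noteq> 0} \<subseteq> cbox l u" by (intro closure_minimal) auto
  then have "closure {x. box_bump c l u x \<noteq> 0} \<subseteq> \<Omega>" "compact (closure {x. box_bump c l u x \<noteq> 0})"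
    using assms(2) bounded_subset[OF bounded_cbox] compact_closure
    by (auto simp: compact_eq_bounded_closed)
  then show ?thesis using C_k_box_bump[OF assms(1), of _ l u] by (simp add: test_functions_def)
qed

subsection \<open>Integration by parts\<close>

lemma lborel_integral_translate:
  fixes f :: "'a::euclidean_space \<Rightarrow> real"
  assumes [measurable]: "f \<in> borel_measurable borel"
  shows "integrable lborel (\<lambda>x. f (x + c)) \<longleftrightarrow> integrable lborel f"
    and "(LBINT x. f (x + c)) = (LBINT x. f x)"
proof -
  have "integrable lborel f \<longleftrightarrow> integrable (distr lborel borel ((+) c)) f"
    "(LBINT x. f x) = (LINT x|distr lborel borel ((+) c). f x)"
    by (simp_all add: lborel_distr_plus)
  then show "integrable lborel (\<lambda>x. f (x + c)) \<longleftrightarrow> integrable lborel f"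
    "(LBINT x. f (x + c)) = (LBINT x. f x)"
    by (simp_all add: integrable_distr_eq integral_distr add.commute)
qed

lemma integrable_continuous_compact_support:
  fixes f :: "'a::euclidean_space \<Rightarrow> real"
  assumes "continuous_on UNIV f" "compact K" "\<And>x. x \<notin> K \<Longrightarrow> f x = 0"
  shows "integrable lborel f"
proof -
  have "integrable lborel (\<lambda>x. indicator K x *\<^sub>R f x)"
    using assms(2) continuous_on_subset[OF assms(1)] by (intro borel_integrable_compact) auto
  also have "(\<lambda>x. indicator K x *\<^sub>R f x) = f" using assms(3) by (intro ext) (auto simp: indicator_def)
  finally show ?thesis .
qed

lemma bounded_continuous_compact_support:
  fixes f :: "'a::euclidean_space \<Rightarrow> real"
  assumes "continuous_on UNIV f" "compact K" "\<And>x. x \<notin> K \<Longrightarrow> f x = 0"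
  obtains B where "B \<ge> 0" "\<And>x. \<bar>f x\<bar> \<le> B"
proof -
  have "bounded (f ` K)"
    by (intro compact_imp_bounded compact_continuous_image continuous_on_subset[OF assms(1)] assms(2)) simp
  then obtain B where "\<And>x. x \<in> K \<Longrightarrow> \<bar>f x\<bar> \<le> B" by (auto simp: bounded_iff)
  then have "\<bar>f x\<bar> \<le> max 0 B" for x using assms(3)[of x] by (cases "x \<in> K") (auto simp: le_max_iff_disj)
  then show ?thesis using that[of "max 0 B"] by simp
qed

lemma partial_deriv_eq_0_outside:
  fixes f :: "'a::euclidean_space \<Rightarrow> real"
  assumes "closed K" "\<And>x. x \<notin> K \<Longrightarrow> f x = 0" "x \<notin> K"
  shows "partial_deriv b f x = 0"
proof -
  have "((\<lambda>x. 0) has_derivative (\<lambda>h. 0)) (at x)" by simp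
  then have "(f has_derivative (\<lambda>h. 0)) (at x)"
    by (rule has_derivative_transform_within_open[of _ _ _ _ "- K"]) (use assms in auto)
  then show ?thesis by (rule partial_deriv_eq)
qed

lemma DERIV_along_line:
  fixes f :: "'a::euclidean_space \<Rightarrow> real"
  assumes "f differentiable at (x + t *\<^sub>R b)"
  shows "((\<lambda>t. f (x + t *\<^sub>R b)) has_real_derivative partial_deriv b f (x + t *\<^sub>R b)) (at t)"
proof -
  obtain f' where f': "(f has_derivative f') (at (x + t *\<^sub>R b))" using assms by (auto simp: differentiable_def)
  have "((\<lambda>t. x + t *\<^sub>R b) has_derivative (\<lambda>h. h *\<^sub>R b)) (at t)"
    by (auto intro!: derivative_eq_intros)
  from has_derivative_compose[OF this f'] have "((\<lambda>t. f (x + t *\<^sub>R b)) has_derivative (\<lambda>h. f' (h *\<^sub>R b))) (at t)" .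
  moreover have "(\<lambda>h. f' (h *\<^sub>R b)) = (*) (partial_deriv b f (x + t *\<^sub>R b))"
    using partial_deriv_eq[OF f', of b] linear_scale[OF has_derivative_linear[OF f']] by (auto simp: mult.commute)
  ultimately show ?thesis by (simp add: has_field_derivative_def)
qed

text \<open>Differentiate the translation invariance of the integral along \<open>b\<close>.\<close>

lemma integral_partial_deriv_eq_0:
  fixes f :: "'a::euclidean_space \<Rightarrow> real"
  assumes diff: "\<And>x. f differentiable (at x)" and cont: "continuous_on UNIV (partial_deriv b f)"
    and K: "compact K" "\<And>x. x \<notin> K \<Longrightarrow> f x = 0"
  shows "(LBINT x. partial_deriv b f x) = 0"
proof -
  have fcont: "continuous_on UNIV f"
    using diff by (intro continuous_at_imp_continuous_on) (auto intro: differentiable_imp_continuous_within)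
  then have [measurable]: "f \<in> borel_measurable borel" by (rule borel_measurable_continuous_onI)
  have [measurable]: "partial_deriv b f \<in> borel_measurable borel" using cont by (rule borel_measurable_continuous_onI)
  have K0: "x \<notin> K \<Longrightarrow> partial_deriv b f x = 0" for x
    using partial_deriv_eq_0_outside[of K f x b] compact_imp_closed[OF K(1)] K(2) by blast
  obtain B where B: "B \<ge> 0" "\<And>x. \<bar>partial_deriv b f x\<bar> \<le> B"
    using bounded_continuous_compact_support[OF cont K(1) K0] by blast
  obtain R where R: "\<And>x. x \<in> K \<Longrightarrow> norm x \<le> R" using compact_imp_bounded[OF K(1)] by (auto simp: bounded_iff)
  define s where "s m x = (f (x + (1 / Suc m) *\<^sub>R b) - f x) / (1 / Suc m)" for m x
  have fint: "integrable lborel f" by (rule integrable_continuous_compact_support[OF fcont K])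
  have s0: "(LBINT x. s m x) = 0" for m
    unfolding s_def using fint by (simp add: lborel_integral_translate)
  have lim: "(\<lambda>m. s m x) \<longlonglongrightarrow> partial_deriv b f x" for x
  proof -
    have "((\<lambda>h. (f (x + (0 + h) *\<^sub>R b) - f (x + 0 *\<^sub>R b)) / h) \<longlongrightarrow> partial_deriv b f (x + 0 *\<^sub>R b)) (at 0)"
      using DERIV_along_line[where f=f and x=x and t=0 and b=b] diff by (simp add: DERIV_def)
    moreover have "filterlim (\<lambda>m. 1 / real (Suc m)) (at 0) sequentially"
      unfolding filterlim_at using LIMSEQ_inverse_real_of_nat by (auto simp: inverse_eq_divide)
    ultimately show ?thesis unfolding s_def by (auto dest: filterlim_compose)
  qed
  \<comment> \<open>An integrable majorant uniform in \<open>m\<close>: by the mean value theorem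
    each quotient is a value of the bounded partial derivative, and since
    \<open>1 / Suc m \<le> 1\<close>, the shift moves the support by at most
    \<open>norm b\<close>.\<close>
  have bound: "\<bar>s m x\<bar> \<le> indicator (cball 0 (R + norm b)) x * B" for m x
  proof (cases "x \<in> cball 0 (R + norm b)")
    case True
    define h where "h = 1 / real (Suc m)"
    have h: "h > 0" by (simp add: h_def)
    obtain t where t: "f (x + h *\<^sub>R b) - f (x + 0 *\<^sub>R b) = (h - 0) * partial_deriv b f (x + t *\<^sub>R b)"
      using MVT2[OF h, of "\<lambda>t. f (x + t *\<^sub>R b)" "\<lambda>t. partial_deriv b f (x + t *\<^sub>R b)"] DERIV_along_line[OF diff] by blast
    then have "s m x = partial_deriv b f (x + t *\<^sub>R b)" unfolding s_def h_def[symmetric] using h by simp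
    then show ?thesis using True B by simp
  next
    case False
    have "norm ((1 / Suc m) *\<^sub>R b) \<le> norm b" using norm_ge_zero[of b] by (simp add: divide_simps ring_distribs)
    then have "norm (x + (1 / Suc m) *\<^sub>R b) \<ge> norm x - norm b"
      using norm_diff_ineq[of x "(1 / Suc m) *\<^sub>R b"] by linarith
    then have "x \<notin> K" "x + (1 / Suc m) *\<^sub>R b \<notin> K" using False R[of x] R[of "x + (1 / Suc m) *\<^sub>R b"] norm_ge_zero[of b] by auto
    then show ?thesis using False K(2) by (simp add: s_def)
  qed
  have fin: "emeasure lborel (cball (0::'a) (R + norm b)) < \<infinity>" by (rule emeasure_bounded_finite) simp
  have "(\<lambda>m. LBINT x. s m x) \<longlonglongrightarrow> (LBINT x. partial_deriv b f x)"
  proof (rule integral_dominated_convergence)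
    show "integrable lborel (\<lambda>x::'a. indicator (cball 0 (R + norm b)) x * B)"
      using fin by (intro integrable_mult_left integrable_real_indicator) auto
    show "AE x in lborel. (\<lambda>m. s m x) \<longlonglongrightarrow> partial_deriv b f x" using lim by simp
    show "AE x in lborel. norm (s m x) \<le> indicator (cball 0 (R + norm b)) x * B" for m using bound by simp
    show "s m \<in> borel_measurable lborel" for m unfolding s_def[abs_def] by measurable
  qed simp
  then show ?thesis using s0 LIMSEQ_unique[OF tendsto_const] by force
qed

lemma test_functionsD:
  assumes "\<phi> \<in> test_functions \<Omega>"
  shows "C_k k \<phi>" "compact (closure {x. \<phi> x \<noteq> 0})" "closure {x. \<phi> x \<noteq> 0} \<subseteq> \<Omega>"
    "\<phi> differentiable (at x)" "continuous_on UNIV \<phi>" "\<phi> \<in> borel_measurable borel"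
    "x \<notin> closure {x. \<phi> x \<noteq> 0} \<Longrightarrow> \<phi> x = 0" "x \<notin> \<Omega> \<Longrightarrow> \<phi> x = 0"
proof -
  have *: "\<forall>k. C_k k \<phi>" "compact (closure {x. \<phi> x \<noteq> 0})" "closure {x. \<phi> x \<noteq> 0} \<subseteq> \<Omega>"
    using assms by (auto simp: test_functions_def)
  then show "C_k k \<phi>" "compact (closure {x. \<phi> x \<noteq> 0})" "closure {x. \<phi> x \<noteq> 0} \<subseteq> \<Omega>" by auto
  show "\<phi> differentiable (at x)" using *(1)[rule_format, of 1] by simp
  show "continuous_on UNIV \<phi>" using *(1)[rule_format, of 0] by simp
  then show "\<phi> \<in> borel_measurable borel" by (rule borel_measurable_continuous_onI)
  show 1: "x \<notin> closure {x. \<phi> x \<noteq> 0} \<Longrightarrow> \<phi> x = 0" for x using closure_subset[of "{x. \<phi> x \<noteq> 0}"] by auto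
  show "x \<notin> \<Omega> \<Longrightarrow> \<phi> x = 0" using 1[of x] *(3) by blast
qed

lemma test_functionsI:
  assumes "\<And>k. C_k k \<phi>" "compact K" "K \<subseteq> \<Omega>" "\<And>x. x \<notin> K \<Longrightarrow> \<phi> x = 0"
  shows "\<phi> \<in> test_functions \<Omega>"
proof -
  have "closure {x. \<phi> x \<noteq> 0} \<subseteq> K"
    using assms(2,4) by (intro closure_minimal compact_imp_closed) auto
  moreover from this have "compact (closure {x. \<phi> x \<noteq> 0})"
    using assms(2) by (metis closed_closure compact_Int_closed inf.absorb2)
  ultimately show ?thesis using assms by (auto simp: test_functions_def)
qed

lemma test_functions_add:
  assumes "\<phi> \<in> test_functions \<Omega>" "\<psi> \<in> test_functions \<Omega>"
  shows "(\<lambda>x. \<phi> x + \<psi> x) \<in> test_functions \<Omega>"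
proof (rule test_functionsI[where K="closure {x. \<phi> x \<noteq> 0} \<union> closure {x. \<psi> x \<noteq> 0}"])
  show "compact (closure {x. \<phi> x \<noteq> 0} \<union> closure {x. \<psi> x \<noteq> 0})"
    using assms[THEN test_functionsD(2)] by (rule compact_Un)
  show "C_k k (\<lambda>x. \<phi> x + \<psi> x)" for k by (intro C_k_add assms[THEN test_functionsD(1)])
  show "\<phi> x + \<psi> x = 0" if "x \<notin> closure {x. \<phi> x \<noteq> 0} \<union> closure {x. \<psi> x \<noteq> 0}" for x
    using that assms[THEN test_functionsD(7), of x] by simp
qed (use assms[THEN test_functionsD(3)] in simp)

lemma test_functions_cmult:
  assumes "\<phi> \<in> test_functions \<Omega>"
  shows "(\<lambda>x. c * \<phi> x) \<in> test_functions \<Omega>"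
proof (rule test_functionsI[OF _ test_functionsD(2,3)[OF assms]])
  show "C_k k (\<lambda>x. c * \<phi> x)" for k by (intro C_k_mult C_k_const test_functionsD(1)[OF assms])
  show "c * \<phi> x = 0" if "x \<notin> closure {x. \<phi> x \<noteq> 0}" for x
    using test_functionsD(7)[OF assms that] by simp
qed

lemma test_functions_partial_deriv:
  assumes "\<phi> \<in> test_functions \<Omega>" "b \<in> Basis"
  shows "partial_deriv b \<phi> \<in> test_functions \<Omega>"
proof (rule test_functionsI[OF _ test_functionsD(2,3)[OF assms(1)]])
  show "C_k k (partial_deriv b \<phi>)" for k using test_functionsD(1)[OF assms(1), of "Suc k"] assms(2) by simp
  show "partial_deriv b \<phi> x = 0" if "x \<notin> closure {x. \<phi> x \<noteq> 0}" for x
    using partial_deriv_eq_0_outside[OF _ test_functionsD(7)[OF assms(1)] that] by simp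
qed

lemma integrable_test_function_mult:
  fixes \<phi> :: "'a::euclidean_space \<Rightarrow> real"
  assumes "\<phi> \<in> test_functions \<Omega>" "continuous_on UNIV g"
  shows "integrable lborel (\<lambda>x. \<phi> x * g x)"
proof (rule integrable_continuous_compact_support[OF _ test_functionsD(2)[OF assms(1)]])
  show "continuous_on UNIV (\<lambda>x. \<phi> x * g x)"
    by (intro continuous_on_mult test_functionsD(5)[OF assms(1)] assms(2))
  show "\<phi> x * g x = 0" if "x \<notin> closure {x. \<phi> x \<noteq> 0}" for x
    using test_functionsD(7)[OF assms(1) that] by simp
qed

text \<open>The product \<open>\<phi> x * g x\<close> inherits compact support from
  \<open>\<phi>\<close>, so the integral of its partial derivative vanishes. This allows
  \<open>g\<close> to be another test function as well as a plane wave
  \<open>cos (\<xi> \<bullet> x)\<close> or \<open>sin (\<xi> \<bullet> x)\<close>.\<close>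

lemma integration_by_parts_test_function:
  fixes \<phi> g :: "'a::euclidean_space \<Rightarrow> real"
  assumes \<phi>: "\<phi> \<in> test_functions \<Omega>" and b: "b \<in> Basis"
    and g: "\<And>x. g differentiable (at x)" "continuous_on UNIV (partial_deriv b g)"
  shows "(LBINT x. partial_deriv b \<phi> x * g x) = - (LBINT x. \<phi> x * partial_deriv b g x)"
proof -
  note \<phi>' = test_functionsD[OF \<phi>] and d\<phi> = test_functions_partial_deriv[OF \<phi> b]
  have gc: "continuous_on UNIV g"
    using g(1) by (intro continuous_at_imp_continuous_on) (auto intro: differentiable_imp_continuous_within)
  have pd: "partial_deriv b (\<lambda>x. \<phi> x * g x) = (\<lambda>x. \<phi> x * partial_deriv b g x + partial_deriv b \<phi> x * g x)"
    using \<phi>'(4) g(1) by (intro ext partial_deriv_mult) auto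
  have "(LBINT x. partial_deriv b (\<lambda>x. \<phi> x * g x) x) = 0"
  proof (rule integral_partial_deriv_eq_0[OF _ _ \<phi>'(2)])
    show "(\<lambda>x. \<phi> x * g x) differentiable at x" for x using \<phi>'(4) g(1) by (intro differentiable_mult) auto
    show "continuous_on UNIV (partial_deriv b (\<lambda>x. \<phi> x * g x))"
      unfolding pd using test_functionsD(5)[OF d\<phi>] \<phi>'(5) g(2) gc by (intro continuous_intros)
    show "\<phi> x * g x = 0" if "x \<notin> closure {x. \<phi> x \<noteq> 0}" for x using \<phi>'(7)[OF that] by simp
  qed
  then show ?thesis unfolding pd
    using integrable_test_function_mult[OF \<phi> g(2)] integrable_test_function_mult[OF d\<phi> gc] by simp
qed

subsection \<open>Square integrable functions\<close>

text \<open>Positive and negative part of \<open>f\<close>, as densities, define measures that are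
  finite and equal on open boxes. Boxes are stable under intersection and generate the Borel sets,
  so the measures and hence the densities coincide.\<close>

lemma AE_eq_0_of_box_integrals:
  fixes f :: "'a::euclidean_space \<Rightarrow> real"
  assumes f: "integrable lborel f"
    and 0: "\<And>l u. (LBINT x. indicator (box l u) x * f x) = 0"
  shows "AE x in lborel. f x = 0"
proof -
  have [measurable]: "f \<in> borel_measurable borel" using f by auto
  define D1 D2 where "D1 = density lborel (\<lambda>x. ennreal (f x))" and "D2 = density lborel (\<lambda>x. ennreal (- f x))"
  have em: "emeasure D1 (box l u) = emeasure D2 (box l u) \<and> emeasure D1 (box l u) \<noteq> \<infinity>" for l u
  proof -
    have [measurable]: "box l u \<in> sets borel" by simp
    have i: "integrable lborel (\<lambda>x. indicator (box l u) x * f x)"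
      using integrable_mult_indicator[OF _ f, of "box l u"] by simp
    have e: "emeasure D1 (box l u) = (\<integral>\<^sup>+x. ennreal (indicator (box l u) x * f x) \<partial>lborel)"
      "emeasure D2 (box l u) = (\<integral>\<^sup>+x. ennreal (- (indicator (box l u) x * f x)) \<partial>lborel)"
      unfolding D1_def D2_def by (auto simp: emeasure_density indicator_def intro!: nn_integral_cong)
    have fin: "(\<integral>\<^sup>+x. ennreal (indicator (box l u) x * f x) \<partial>lborel) \<noteq> \<infinity>"
      "(\<integral>\<^sup>+x. ennreal (- (indicator (box l u) x * f x)) \<partial>lborel) \<noteq> \<infinity>"
      using i unfolding real_integrable_def by auto
    have "enn2real (\<integral>\<^sup>+x. ennreal (indicator (box l u) x * f x) \<partial>lborel)
      = enn2real (\<integral>\<^sup>+x. ennreal (- (indicator (box l u) x * f x)) \<partial>lborel)"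
      using real_lebesgue_integral_def[OF i] 0[of l u] by linarith
    then have "ennreal (enn2real (\<integral>\<^sup>+x. ennreal (indicator (box l u) x * f x) \<partial>lborel))
      = ennreal (enn2real (\<integral>\<^sup>+x. ennreal (- (indicator (box l u) x * f x)) \<partial>lborel))" by simp
    then show ?thesis using fin unfolding e by (subst (asm) (1 2) ennreal_enn2real) (auto simp: top.not_eq_extremum)
  qed
  have "D1 = D2"
  proof (rule measure_eqI_generator_eq)
    let ?E = "range (\<lambda>(a, b). box a b::'a set)"
    show "Int_stable ?E" by (auto simp: Int_stable_def box_Int_box)
    show "?E \<subseteq> Pow UNIV" "sets D1 = sigma_sets UNIV ?E" "sets D2 = sigma_sets UNIV ?E"
      by (simp_all add: borel_eq_box D1_def D2_def)
    let ?A = "\<lambda>n::nat. box (- (real n *\<^sub>R One)) (real n *\<^sub>R One) :: 'a set"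
    show "range ?A \<subseteq> ?E" "(\<Union>i. ?A i) = UNIV" unfolding UN_box_eq_UNIV by auto
    show "emeasure D1 (?A i) \<noteq> \<infinity>" for i using em[of "- (real i *\<^sub>R One)" "real i *\<^sub>R One"] by metis
    show "emeasure D1 X = emeasure D2 X" if "X \<in> ?E" for X using that em by auto
  qed
  then have "AE x in lborel. ennreal (f x) = ennreal (- f x)"
    unfolding D1_def D2_def by (subst (asm) sigma_finite_measure.density_unique_iff[OF sigma_finite_lborel]) auto
  then show ?thesis
  proof eventually_elim
    fix x assume "ennreal (f x) = ennreal (- f x)"
    \<comment> \<open>\<open>ennreal\<close> sends negative reals to \<open>0\<close>, so for
      \<open>f x \<noteq> 0\<close> exactly one of the two sides would vanish.\<close>
    then show "f x = 0" by (cases "f x" "0::real" rule: linorder_cases) (auto simp: ennreal_neg ennreal_eq_0_iff)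
  qed
qed

locale bounded_open =
  fixes \<Omega> :: "'a::euclidean_space set"
  assumes open_\<Omega>: "open \<Omega>" and bounded_\<Omega>: "bounded \<Omega>"
begin

abbreviation M :: "'a measure" where "M \<equiv> lebesgue_on \<Omega>"

lemma sets_\<Omega> [measurable, simp]: "\<Omega> \<in> sets borel" "\<Omega> \<in> sets lebesgue"
  using open_\<Omega> by auto

lemma finite_measure_\<Omega>: "finite_measure M"
proof
  have "emeasure lborel \<Omega> < \<infinity>" using bounded_\<Omega> by (rule emeasure_bounded_finite)
  then show "emeasure M (space M) \<noteq> \<infinity>"
    by (simp add: emeasure_restrict_space)
qed

lemma space_M [simp]: "space M = \<Omega>"
  by (simp add: space_restrict_space)

lemma borel_measurable_M: "f \<in> borel_measurable borel \<Longrightarrow> f \<in> borel_measurable M"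
  by (rule measurable_restrict_space1, rule measurable_completion) simp

lemma AE_M_iff: "(AE x in M. P x) \<longleftrightarrow> (AE x in lebesgue. x \<in> \<Omega> \<longrightarrow> P x)"
  by (rule AE_restrict_space_iff) simp

lemma integral_M: "(LINT x|M. f x) = (LINT x|lebesgue. indicator \<Omega> x * (f x :: real))"
  by (subst integral_restrict_space) auto

lemma integrable_M: "integrable M f \<longleftrightarrow> integrable lebesgue (\<lambda>x. indicator \<Omega> x * (f x :: real))"
  by (subst integrable_restrict_space) auto

text \<open>The Sobolev spaces live on \<open>lebesgue_on \<Omega>\<close>, Fourier analysis on
  \<open>lborel\<close>. Test functions vanish outside \<open>\<Omega>\<close> and are Borel, so
  their integrals can be moved between the two.\<close>

lemma integral_M_borel:
  fixes f :: "'a \<Rightarrow> real"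
  assumes [measurable]: "f \<in> borel_measurable borel" and "\<And>x. x \<notin> \<Omega> \<Longrightarrow> f x = 0"
  shows "(LINT x|M. f x) = (LBINT x. f x)"
proof -
  have "(\<lambda>x. indicator \<Omega> x * f x) = f" using assms(2) by (intro ext) (auto simp: indicator_def)
  then show ?thesis unfolding integral_M by (simp add: integral_completion)
qed

lemma L2_D: "u \<in> L2 \<Omega> \<Longrightarrow> u \<in> borel_measurable M"
  "u \<in> L2 \<Omega> \<Longrightarrow> integrable M (\<lambda>x. (u x)\<^sup>2)"
  by (auto simp: L2_def)

lemma L2_mult_integrable:
  assumes "u \<in> L2 \<Omega>" "v \<in> L2 \<Omega>"
  shows "integrable M (\<lambda>x. u x * v x)"
proof (rule Bochner_Integration.integrable_bound)
  note [measurable] = assms[THEN L2_D(1)]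
  show "integrable M (\<lambda>x. (u x)\<^sup>2 + (v x)\<^sup>2)" using assms[THEN L2_D(2)] by simp
  show "(\<lambda>x. u x * v x) \<in> borel_measurable M" by measurable
  have "\<bar>u x * v x\<bar> \<le> (u x)\<^sup>2 + (v x)\<^sup>2" for x
  proof -
    have "2 * \<bar>u x\<bar> * \<bar>v x\<bar> \<le> (u x)\<^sup>2 + (v x)\<^sup>2" using sum_squares_bound[of "\<bar>u x\<bar>" "\<bar>v x\<bar>"] by simp
    moreover have "0 \<le> \<bar>u x\<bar> * \<bar>v x\<bar>" by simp
    ultimately show ?thesis unfolding abs_mult by linarith
  qed
  then show "AE x in M. norm (u x * v x) \<le> norm ((u x)\<^sup>2 + (v x)\<^sup>2)"
    by (auto intro!: AE_I2 order_trans[OF _ abs_ge_self])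
qed

lemma L2_lin:
  assumes "u \<in> L2 \<Omega>" "v \<in> L2 \<Omega>"
  shows "(\<lambda>x. \<alpha> * u x + \<beta> * v x) \<in> L2 \<Omega>"
proof -
  note [measurable] = assms[THEN L2_D(1)]
  have "integrable M (\<lambda>x. \<alpha>\<^sup>2 * (u x * u x) + \<beta>\<^sup>2 * (v x * v x) + 2 * \<alpha> * \<beta> * (u x * v x))"
    using L2_mult_integrable assms by (intro Bochner_Integration.integrable_add Bochner_Integration.integrable_mult_right) auto
  also have "(\<lambda>x. \<alpha>\<^sup>2 * (u x * u x) + \<beta>\<^sup>2 * (v x * v x) + 2 * \<alpha> * \<beta> * (u x * v x)) = (\<lambda>x. (\<alpha> * u x + \<beta> * v x)\<^sup>2)"
    by (intro ext) (simp add: power2_eq_square algebra_simps)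
  finally show ?thesis unfolding L2_def by auto
qed

lemma L2_bounded:
  assumes [measurable]: "g \<in> borel_measurable M" and B: "\<And>x. x \<in> \<Omega> \<Longrightarrow> \<bar>g x\<bar> \<le> B"
  shows "g \<in> L2 \<Omega>"
proof -
  interpret finite_measure "M" by (rule finite_measure_\<Omega>)
  have "(g x)\<^sup>2 \<le> B\<^sup>2" if "x \<in> \<Omega>" for x using B[OF that] power_mono[of "\<bar>g x\<bar>" B 2] by simp
  then have "integrable M (\<lambda>x. (g x)\<^sup>2)"
    by (intro integrable_const_bound[where B="B\<^sup>2"]) auto
  then show ?thesis by (simp add: L2_def)
qed

lemma L2_continuous:
  assumes "continuous_on UNIV g"
  shows "g \<in> L2 \<Omega>"
proof -
  have "compact (closure \<Omega>)" using bounded_\<Omega> by (simp add: compact_closure)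
  then have "bounded (g ` closure \<Omega>)"
    by (intro compact_imp_bounded compact_continuous_image continuous_on_subset[OF assms]) auto
  then obtain B where "\<And>x. x \<in> closure \<Omega> \<Longrightarrow> \<bar>g x\<bar> \<le> B" by (auto simp: bounded_iff)
  then have "\<bar>g x\<bar> \<le> B" if "x \<in> \<Omega>" for x using that closure_subset by blast
  then show ?thesis
    by (intro L2_bounded[of _ B] borel_measurable_M borel_measurable_continuous_onI assms)
qed

lemma L2_test_function: "\<phi> \<in> test_functions \<Omega> \<Longrightarrow> \<phi> \<in> L2 \<Omega>"
  by (intro L2_continuous test_functionsD(5))

lemma L2_integrable: "u \<in> L2 \<Omega> \<Longrightarrow> integrable M u"
  using L2_mult_integrable[of u "\<lambda>_. 1"] L2_continuous[of "\<lambda>_. 1"] by simp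

text \<open>The indicator of a box is a bounded pointwise limit of bump functions.\<close>

lemma test_functions_separate:
  assumes h: "h \<in> L2 \<Omega>" and 0: "\<And>\<phi>. \<phi> \<in> test_functions \<Omega> \<Longrightarrow> (LINT x|M. h x * \<phi> x) = 0"
  shows "AE x in M. h x = 0"
proof -
  note [measurable] = L2_D(1)[OF h]
  have hi: "integrable lebesgue (\<lambda>x. indicator \<Omega> x * h x)" using L2_integrable[OF h] by (simp add: integrable_M)
  have box0: "(LINT x|lebesgue. indicator (box l u) x * (indicator \<Omega> x * h x)) = 0" if "cbox l u \<subseteq> \<Omega>" for l u
  proof -
    have "(\<lambda>m. LINT x|M. h x * box_bump (1 / Suc m) l u x) \<longlonglongrightarrow>
        (LINT x|M. h x * indicator (box l u) x)"
    proof (rule integral_dominated_convergence)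
      show "integrable M (\<lambda>x. \<bar>h x\<bar>)" using L2_integrable[OF h] by simp
      show "AE x in M. norm (h x * box_bump (1 / Suc m) l u x) \<le> \<bar>h x\<bar>" for m
        using box_bump_bounds[of "1 / Suc m" l u] by (intro AE_I2) (auto simp: abs_mult intro!: mult_left_le)
      show "AE x in M. (\<lambda>m. h x * box_bump (1 / Suc m) l u x) \<longlonglongrightarrow> h x * indicator (box l u) x"
        by (intro AE_I2 tendsto_mult tendsto_const box_bump_tendsto)
      have "box_bump (1 / Suc m) l u \<in> borel_measurable M" for m
        by (intro borel_measurable_M borel_measurable_continuous_onI C_k_continuous[OF C_k_box_bump]) simp
      then show "(\<lambda>x. h x * box_bump (1 / Suc m) l u x) \<in> borel_measurable M" for m by measurable
      have "indicat_real (box l u) \<in> borel_measurable M" by (intro borel_measurable_M) simp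
      then show "(\<lambda>x. h x * indicator (box l u) x) \<in> borel_measurable M" by measurable
    qed
    moreover have "(LINT x|M. h x * box_bump (1 / Suc m) l u x) = 0" for m
      by (intro 0 box_bump_test_function that) simp
    ultimately have "(LINT x|M. h x * indicator (box l u) x) = 0"
      using LIMSEQ_unique[OF tendsto_const] by force
    then show ?thesis unfolding integral_M by (simp add: mult_ac)
  qed
  \<comment> \<open>\<open>h\<close> is only Lebesgue measurable, while the criterion with box
    integrals is about \<open>lborel\<close>; a Borel representative of the extension of
    \<open>h\<close> by \<open>0\<close> bridges the gap.\<close>
  obtain g where g [measurable]: "g \<in> borel_measurable lborel" and gh: "AE x in lborel. indicator \<Omega> x * h x = g x"
    using completion_ex_borel_measurable_real[OF borel_measurable_integrable[OF hi]] by blast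
  have gh': "AE x in lebesgue. g x = indicator \<Omega> x * h x" using gh by (intro AE_completion) auto
  have "integrable lebesgue g \<longleftrightarrow> integrable lebesgue (\<lambda>x. indicator \<Omega> x * h x)"
    by (intro integrable_cong_AE measurable_completion g borel_measurable_integrable[OF hi] gh')
  then have gi: "integrable lborel g" using hi by (simp add: integrable_completion)
  have cb: "AE x in lborel. x \<in> cbox p q \<longrightarrow> g x = 0" if "cbox p q \<subseteq> \<Omega>" for p q
  proof -
    have "AE x in lborel. indicator (box p q) x * g x = 0"
    proof (rule AE_eq_0_of_box_integrals)
      show "integrable lborel (\<lambda>x. indicator (box p q) x * g x)"
        using integrable_mult_indicator[OF _ gi, of "box p q"] by simp
      fix l u :: 'a
      \<comment> \<open>Cutting off to \<open>box p q\<close> makes every box admissible: its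
        intersection with \<open>box p q\<close> is again a box, whose closed version lies in
        \<open>\<Omega>\<close>.\<close>
      obtain l' u' where lu: "box l u \<inter> box p q = box l' u'" "cbox l u \<inter> cbox p q = cbox l' u'"
        using box_Int_box[of l u p q] Int_interval[of l u p q] by blast
      have "(LBINT x. indicator (box l u) x * (indicator (box p q) x * g x)) = (LBINT x. indicator (box l' u') x * g x)"
        unfolding lu(1)[symmetric] by (intro Bochner_Integration.integral_cong) (auto simp: indicator_def)
      also have "\<dots> = (LINT x|lebesgue. indicator (box l' u') x * g x)"
        by (simp add: integral_completion)
      also have "\<dots> = (LINT x|lebesgue. indicator (box l' u') x * (indicator \<Omega> x * h x))"
      proof (rule integral_cong_AE)
        have [measurable]: "indicat_real (box l' u') \<in> borel_measurable lebesgue" "g \<in> borel_measurable lebesgue"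
          by (intro measurable_completion; simp)+
        show "(\<lambda>x. indicator (box l' u') x * g x) \<in> borel_measurable lebesgue" by measurable
        have [measurable]: "(\<lambda>x. indicator \<Omega> x * h x) \<in> borel_measurable lebesgue" using hi by auto
        show "(\<lambda>x. indicator (box l' u') x * (indicator \<Omega> x * h x)) \<in> borel_measurable lebesgue" by measurable
        show "AE x in lebesgue. indicator (box l' u') x * g x = indicator (box l' u') x * (indicator \<Omega> x * h x)"
          using gh' by eventually_elim simp
      qed
      also have "\<dots> = 0" using lu(2) that by (intro box0) blast
      finally show "(LBINT x. indicator (box l u) x * (indicator (box p q) x * g x)) = 0" .
    qed
    moreover have "AE x in lborel. x \<notin> cbox p q - box p q"
      using negligible_frontier_interval[of p q]
      by (intro AE_not_in) (auto simp: negligible_iff_null_sets null_sets_completion_iff)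
    ultimately show ?thesis by eventually_elim (auto simp: indicator_def split: if_splits)
  qed
  \<comment> \<open>Only countably many closed boxes are needed to exhaust the open set, so the
    exceptional null sets can be united.\<close>
  obtain \<D> where \<D>: "countable \<D>" "\<D> \<subseteq> Pow \<Omega>" "\<And>X. X \<in> \<D> \<Longrightarrow> \<exists>a b. X = cbox a b" "\<Union>\<D> = \<Omega>"
    using open_countable_Union_open_cbox[OF open_\<Omega>] by blast
  have "AE x in lborel. \<forall>X\<in>\<D>. x \<in> X \<longrightarrow> g x = 0"
  proof (subst AE_ball_countable[OF \<D>(1)], intro ballI)
    fix X assume "X \<in> \<D>"
    then obtain a b where "X = cbox a b" "cbox a b \<subseteq> \<Omega>" using \<D>(2,3) by blast
    then show "AE x in lborel. x \<in> X \<longrightarrow> g x = 0" using cb by simp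
  qed
  with gh have "AE x in lborel. x \<in> \<Omega> \<longrightarrow> h x = 0"
    by eventually_elim (use \<D>(4) in \<open>auto simp: indicator_def split: if_splits\<close>)
  then have "AE x in lebesgue. x \<in> \<Omega> \<longrightarrow> h x = 0" by (intro AE_completion) auto
  then show ?thesis by (simp add: AE_M_iff)
qed

end

subsection \<open>Weak derivatives\<close>

context bounded_open
begin

lemma integral_add_mult:
  assumes "f \<in> L2 \<Omega>" "g \<in> L2 \<Omega>" "h \<in> L2 \<Omega>"
  shows "(LINT x|M. (\<alpha> * f x + \<beta> * g x) * h x) =
    \<alpha> * (LINT x|M. f x * h x) + \<beta> * (LINT x|M. g x * h x)"
proof -
  have "(\<lambda>x. (\<alpha> * f x + \<beta> * g x) * h x) = (\<lambda>x. \<alpha> * (f x * h x) + \<beta> * (g x * h x))"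
    by (intro ext) (simp add: algebra_simps)
  then show ?thesis using L2_mult_integrable[OF assms(1,3)] L2_mult_integrable[OF assms(2,3)] by simp
qed

lemma integral_mult_cong_AE:
  assumes "f \<in> L2 \<Omega>" "g \<in> L2 \<Omega>" "h \<in> L2 \<Omega>" "k \<in> L2 \<Omega>"
    and "AE x in M. f x = g x" "AE x in M. h x = k x"
  shows "(LINT x|M. f x * h x) = (LINT x|M. g x * k x)"
proof (rule integral_cong_AE)
  note [measurable] = assms(1-4)[THEN L2_D(1)]
  show "(\<lambda>x. f x * h x) \<in> borel_measurable M" "(\<lambda>x. g x * k x) \<in> borel_measurable M"
    by measurable
  show "AE x in M. f x * h x = g x * k x" using assms(5,6) by eventually_elim simp
qed

lemma has_weak_deriv_L2: "has_weak_deriv \<Omega> b u g \<Longrightarrow> u \<in> L2 \<Omega>" "has_weak_deriv \<Omega> b u g \<Longrightarrow> g \<in> L2 \<Omega>"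
  by (auto simp: has_weak_deriv_def)

lemma has_weak_deriv_lin:
  assumes "has_weak_deriv \<Omega> b u g" "has_weak_deriv \<Omega> b v h" "b \<in> Basis"
  shows "has_weak_deriv \<Omega> b (\<lambda>x. \<alpha> * u x + \<beta> * v x) (\<lambda>x. \<alpha> * g x + \<beta> * h x)"
  unfolding has_weak_deriv_def
proof (intro conjI L2_lin ballI)
  note l2 = assms(1,2)[THEN has_weak_deriv_L2(1)] assms(1,2)[THEN has_weak_deriv_L2(2)]
  show "u \<in> L2 \<Omega>" "v \<in> L2 \<Omega>" "g \<in> L2 \<Omega>" "h \<in> L2 \<Omega>" by fact+
  fix \<phi> assume \<phi>: "\<phi> \<in> test_functions \<Omega>"
  note t = L2_test_function[OF \<phi>] L2_test_function[OF test_functions_partial_deriv[OF \<phi> assms(3)]]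
  have e: "(LINT x|M. u x * partial_deriv b \<phi> x) = - (LINT x|M. g x * \<phi> x)"
    "(LINT x|M. v x * partial_deriv b \<phi> x) = - (LINT x|M. h x * \<phi> x)"
    using assms(1,2) \<phi> by (auto simp: has_weak_deriv_def)
  show "(LINT x|M. (\<alpha> * u x + \<beta> * v x) * partial_deriv b \<phi> x) =
        - (LINT x|M. (\<alpha> * g x + \<beta> * h x) * \<phi> x)"
    unfolding integral_add_mult[OF l2(1,2) t(2)] integral_add_mult[OF l2(3,4) t(1)] e by simp
qed

text \<open>The difference \<open>g - h\<close> is orthogonal to every test function, because both
  functions are tested through the same integral of \<open>u\<close> or \<open>v\<close>.\<close>

lemma has_weak_deriv_AE_unique:
  assumes u: "has_weak_deriv \<Omega> b u g" and v: "has_weak_deriv \<Omega> b v h" and b: "b \<in> Basis"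
    and uv: "AE x in M. u x = v x"
  shows "AE x in M. g x = h x"
proof -
  note l2 = has_weak_deriv_L2[OF u] has_weak_deriv_L2[OF v]
  have "AE x in M. 1 * g x + (-1) * h x = 0"
  proof (rule test_functions_separate[OF L2_lin[OF l2(2,4)]])
    fix \<phi> assume \<phi>: "\<phi> \<in> test_functions \<Omega>"
    note t = L2_test_function[OF \<phi>] L2_test_function[OF test_functions_partial_deriv[OF \<phi> b]]
    have "(LINT x|M. u x * partial_deriv b \<phi> x) = (LINT x|M. v x * partial_deriv b \<phi> x)"
      by (rule integral_mult_cong_AE[OF l2(1,3) t(2) t(2) uv]) simp
    then show "(LINT x|M. (1 * g x + (-1) * h x) * \<phi> x) = 0"
      unfolding integral_add_mult[OF l2(2,4) t(1)] using u v \<phi> by (simp add: has_weak_deriv_def)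
  qed
  then show ?thesis by eventually_elim simp
qed

lemma has_weak_deriv_cong_AE:
  assumes u: "has_weak_deriv \<Omega> b u g" and b: "b \<in> Basis" and v: "v \<in> L2 \<Omega>"
    and uv: "AE x in M. u x = v x"
  shows "has_weak_deriv \<Omega> b v g"
  unfolding has_weak_deriv_def
proof (intro conjI ballI v has_weak_deriv_L2(2)[OF u])
  fix \<phi> assume \<phi>: "\<phi> \<in> test_functions \<Omega>"
  note t = L2_test_function[OF test_functions_partial_deriv[OF \<phi> b]]
  have "(LINT x|M. u x * partial_deriv b \<phi> x) = (LINT x|M. v x * partial_deriv b \<phi> x)"
    by (rule integral_mult_cong_AE[OF has_weak_deriv_L2(1)[OF u] v t t uv]) simp
  then show "(LINT x|M. v x * partial_deriv b \<phi> x) = - (LINT x|M. g x * \<phi> x)"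
    using u \<phi> by (simp add: has_weak_deriv_def)
qed

lemma has_weak_deriv_test_function:
  assumes \<phi>: "\<phi> \<in> test_functions \<Omega>" and b: "b \<in> Basis"
  shows "has_weak_deriv \<Omega> b \<phi> (partial_deriv b \<phi>)"
  unfolding has_weak_deriv_def
proof (intro conjI ballI L2_test_function test_functions_partial_deriv \<phi> b)
  fix \<psi> assume \<psi>: "\<psi> \<in> test_functions \<Omega>"
  note d\<phi> = test_functions_partial_deriv[OF \<phi> b] and d\<psi> = test_functions_partial_deriv[OF \<psi> b]
  note [measurable] = test_functionsD(6)[OF \<phi>] test_functionsD(6)[OF d\<phi>] test_functionsD(6)[OF d\<psi>] test_functionsD(6)[OF \<psi>]
  have "(LBINT x. \<phi> x * partial_deriv b \<psi> x) = - (LBINT x. partial_deriv b \<phi> x * \<psi> x)"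
    using integration_by_parts_test_function[OF \<phi> b test_functionsD(4)[OF \<psi>] test_functionsD(5)[OF d\<psi>]] by simp
  moreover have "(LINT x|M. \<phi> x * partial_deriv b \<psi> x) = (LBINT x. \<phi> x * partial_deriv b \<psi> x)"
    by (rule integral_M_borel) (use test_functionsD(8)[OF \<phi>] in \<open>auto\<close>)
  moreover have "(LINT x|M. partial_deriv b \<phi> x * \<psi> x) = (LBINT x. partial_deriv b \<phi> x * \<psi> x)"
    by (rule integral_M_borel) (use test_functionsD(8)[OF \<psi>] in \<open>auto\<close>)
  ultimately show "(LINT x|M. \<phi> x * partial_deriv b \<psi> x) = - (LINT x|M. partial_deriv b \<phi> x * \<psi> x)"
    by simp
qed

lemma weak_deriv_works: "has_weak_deriv \<Omega> b u g \<Longrightarrow> has_weak_deriv \<Omega> b u (weak_deriv \<Omega> b u)"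
  unfolding weak_deriv_def by (rule someI[of "has_weak_deriv \<Omega> b u"])

lemma weak_deriv_AE_eq:
  "has_weak_deriv \<Omega> b u g \<Longrightarrow> b \<in> Basis \<Longrightarrow> AE x in M. weak_deriv \<Omega> b u x = g x"
  by (rule has_weak_deriv_AE_unique[OF weak_deriv_works]) auto

lemma H2_weak_deriv:
  assumes "u \<in> H2 \<Omega>" "b \<in> Basis"
  shows "has_weak_deriv \<Omega> b u (weak_deriv \<Omega> b u)"
  using assms weak_deriv_works by (auto simp: H2_def H1_def)

lemma H2_weak_deriv2:
  assumes "u \<in> H2 \<Omega>" "b \<in> Basis" "c \<in> Basis"
  shows "has_weak_deriv \<Omega> c (weak_deriv \<Omega> b u) (weak_deriv \<Omega> c (weak_deriv \<Omega> b u))"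
proof -
  have "weak_deriv \<Omega> b u \<in> H1 \<Omega>" using assms by (auto simp: H2_def)
  then show ?thesis using assms(3) weak_deriv_works by (auto simp: H1_def)
qed

lemma H2_L2: "u \<in> H2 \<Omega> \<Longrightarrow> u \<in> L2 \<Omega>"
  "u \<in> H2 \<Omega> \<Longrightarrow> b \<in> Basis \<Longrightarrow> weak_deriv \<Omega> b u \<in> L2 \<Omega>"
  "u \<in> H2 \<Omega> \<Longrightarrow> b \<in> Basis \<Longrightarrow> c \<in> Basis \<Longrightarrow> weak_deriv \<Omega> c (weak_deriv \<Omega> b u) \<in> L2 \<Omega>"
  using H2_weak_deriv has_weak_deriv_L2 H2_weak_deriv2 by (auto simp: H2_def H1_def) blast+

text \<open>\<open>weak_deriv\<close> is an arbitrary choice and agrees with a known derivative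
  \<open>g b\<close> only almost everywhere. The hypothesis on second derivatives concerns
  \<open>g b\<close>; it is transported to the chosen representative before it can say anything
  about iterated \<open>weak_deriv\<close>. All later membership proofs and computations of
  derivatives go through this.\<close>

lemma H2I:
  assumes "\<And>b. b \<in> Basis \<Longrightarrow> has_weak_deriv \<Omega> b u (g b)"
    and "\<And>b c. b \<in> Basis \<Longrightarrow> c \<in> Basis \<Longrightarrow> has_weak_deriv \<Omega> c (g b) (h b c)"
  shows "u \<in> H2 \<Omega>"
    and "\<And>b. b \<in> Basis \<Longrightarrow> AE x in M. weak_deriv \<Omega> b u x = g b x"
    and "\<And>b c. b \<in> Basis \<Longrightarrow> c \<in> Basis \<Longrightarrow> AE x in M. weak_deriv \<Omega> c (weak_deriv \<Omega> b u) x = h b c x"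
proof -
  obtain b0 :: 'a where b0: "b0 \<in> Basis" using nonempty_Basis by blast
  have u: "u \<in> L2 \<Omega>" using has_weak_deriv_L2(1)[OF assms(1)[OF b0]] .
  have wd: "has_weak_deriv \<Omega> b u (weak_deriv \<Omega> b u)" if "b \<in> Basis" for b
    using weak_deriv_works[OF assms(1)[OF that]] .
  show ae: "AE x in M. weak_deriv \<Omega> b u x = g b x" if "b \<in> Basis" for b
    using weak_deriv_AE_eq[OF assms(1)] that by blast
  have wd2: "has_weak_deriv \<Omega> c (weak_deriv \<Omega> b u) (h b c)" if "b \<in> Basis" "c \<in> Basis" for b c
    by (rule has_weak_deriv_cong_AE[OF assms(2)[OF that] that(2) has_weak_deriv_L2(2)[OF wd[OF that(1)]]])
      (use ae[OF that(1)] in eventually_elim, simp)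
  show "AE x in M. weak_deriv \<Omega> c (weak_deriv \<Omega> b u) x = h b c x" if "b \<in> Basis" "c \<in> Basis" for b c
    using weak_deriv_AE_eq[OF wd2[OF that] that(2)] .
  show "u \<in> H2 \<Omega>"
    unfolding H2_def H1_def using u wd wd2 has_weak_deriv_L2(2) by blast
qed

lemma H2_lin:
  assumes u: "u \<in> H2 \<Omega>" and v: "v \<in> H2 \<Omega>"
  shows "(\<lambda>x. \<alpha> * u x + \<beta> * v x) \<in> H2 \<Omega>"
    and "b \<in> Basis \<Longrightarrow> AE x in M.
      weak_deriv \<Omega> b (\<lambda>x. \<alpha> * u x + \<beta> * v x) x = \<alpha> * weak_deriv \<Omega> b u x + \<beta> * weak_deriv \<Omega> b v x"
    and "b \<in> Basis \<Longrightarrow> c \<in> Basis \<Longrightarrow> AE x in M.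
      weak_deriv \<Omega> c (weak_deriv \<Omega> b (\<lambda>x. \<alpha> * u x + \<beta> * v x)) x
      = \<alpha> * weak_deriv \<Omega> c (weak_deriv \<Omega> b u) x + \<beta> * weak_deriv \<Omega> c (weak_deriv \<Omega> b v) x"
proof -
  note 1 = has_weak_deriv_lin[OF H2_weak_deriv[OF u] H2_weak_deriv[OF v], where \<alpha>=\<alpha> and \<beta>=\<beta>]
  note 2 = has_weak_deriv_lin[OF H2_weak_deriv2[OF u] H2_weak_deriv2[OF v], where \<alpha>=\<alpha> and \<beta>=\<beta>]
  note H = H2I[where g="\<lambda>b x. \<alpha> * weak_deriv \<Omega> b u x + \<beta> * weak_deriv \<Omega> b v x"
      and h="\<lambda>b c x. \<alpha> * weak_deriv \<Omega> c (weak_deriv \<Omega> b u) x + \<beta> * weak_deriv \<Omega> c (weak_deriv \<Omega> b v) x", OF 1 2]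
  show "(\<lambda>x. \<alpha> * u x + \<beta> * v x) \<in> H2 \<Omega>" by (rule H(1)) auto
  show "b \<in> Basis \<Longrightarrow> AE x in M.
      weak_deriv \<Omega> b (\<lambda>x. \<alpha> * u x + \<beta> * v x) x = \<alpha> * weak_deriv \<Omega> b u x + \<beta> * weak_deriv \<Omega> b v x"
    by (rule H(2)) auto
  show "b \<in> Basis \<Longrightarrow> c \<in> Basis \<Longrightarrow> AE x in M.
      weak_deriv \<Omega> c (weak_deriv \<Omega> b (\<lambda>x. \<alpha> * u x + \<beta> * v x)) x
      = \<alpha> * weak_deriv \<Omega> c (weak_deriv \<Omega> b u) x + \<beta> * weak_deriv \<Omega> c (weak_deriv \<Omega> b v) x"
    by (rule H(3)) auto
qed

lemma H2_test_function:
  assumes "\<phi> \<in> test_functions \<Omega>"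
  shows "\<phi> \<in> H2 \<Omega>"
    and "b \<in> Basis \<Longrightarrow> AE x in M. weak_deriv \<Omega> b \<phi> x = partial_deriv b \<phi> x"
    and "b \<in> Basis \<Longrightarrow> c \<in> Basis \<Longrightarrow>
      AE x in M. weak_deriv \<Omega> c (weak_deriv \<Omega> b \<phi>) x = partial_deriv c (partial_deriv b \<phi>) x"
proof -
  note 1 = has_weak_deriv_test_function[OF assms]
  note 2 = has_weak_deriv_test_function[OF test_functions_partial_deriv[OF assms]]
  note H = H2I[where g="\<lambda>b. partial_deriv b \<phi>" and h="\<lambda>b c. partial_deriv c (partial_deriv b \<phi>)", OF 1 2]
  show "\<phi> \<in> H2 \<Omega>" by (rule H(1)) auto
  show "b \<in> Basis \<Longrightarrow> AE x in M. weak_deriv \<Omega> b \<phi> x = partial_deriv b \<phi> x" by (rule H(2)) auto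
  show "b \<in> Basis \<Longrightarrow> c \<in> Basis \<Longrightarrow>
      AE x in M. weak_deriv \<Omega> c (weak_deriv \<Omega> b \<phi>) x = partial_deriv c (partial_deriv b \<phi>) x"
    by (rule H(3)) auto
qed

section \<open>Convergence in \<open>L2\<close> and in the \<open>H2\<close> norm\<close>

definition L2_to_0 :: "(nat \<Rightarrow> 'a \<Rightarrow> real) \<Rightarrow> bool" where
  "L2_to_0 f \<longleftrightarrow> (\<lambda>m. LINT x|M. (f m x)\<^sup>2) \<longlonglongrightarrow> 0"

text \<open>Follows from \<open>(p + q)\<^sup>2 \<le> 2 * p\<^sup>2 + 2 * q\<^sup>2\<close>. The
  relation for \<open>h\<close> is only required almost everywhere, since weak derivatives of a
  linear combination are known only up to null sets; with \<open>\<alpha> = 1\<close> and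
  \<open>\<beta> = 0\<close> it also serves to replace a sequence by an equivalent one.\<close>

lemma L2_to_0_lin:
  assumes f: "\<And>m. f m \<in> L2 \<Omega>" "L2_to_0 f" and g: "\<And>m. g m \<in> L2 \<Omega>" "L2_to_0 g"
    and h: "\<And>m. h m \<in> L2 \<Omega>" and ae: "\<And>m. AE x in M. h m x = \<alpha> * f m x + \<beta> * g m x"
  shows "L2_to_0 h"
  unfolding L2_to_0_def
proof (rule real_tendsto_sandwich[OF always_eventually always_eventually tendsto_const, rule_format])
  let ?U = "\<lambda>m. 2 * \<alpha>\<^sup>2 * (LINT x|M. (f m x)\<^sup>2) + 2 * \<beta>\<^sup>2 * (LINT x|M. (g m x)\<^sup>2)"
  have "?U \<longlonglongrightarrow> 2 * \<alpha>\<^sup>2 * 0 + 2 * \<beta>\<^sup>2 * 0"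
    using f(2) g(2) unfolding L2_to_0_def by (intro tendsto_intros)
  then show "?U \<longlonglongrightarrow> 0" by simp
  fix m
  show "0 \<le> (LINT x|M. (h m x)\<^sup>2)" by simp
  have "(LINT x|M. (h m x)\<^sup>2) \<le> (LINT x|M. 2 * \<alpha>\<^sup>2 * (f m x)\<^sup>2 + 2 * \<beta>\<^sup>2 * (g m x)\<^sup>2)"
  proof (rule integral_mono_AE)
    show "integrable M (\<lambda>x. (h m x)\<^sup>2)" "integrable M (\<lambda>x. 2 * \<alpha>\<^sup>2 * (f m x)\<^sup>2 + 2 * \<beta>\<^sup>2 * (g m x)\<^sup>2)"
      using L2_D(2)[OF f(1)] L2_D(2)[OF g(1)] L2_D(2)[OF h] by simp_all
    show "AE x in M. (h m x)\<^sup>2 \<le> 2 * \<alpha>\<^sup>2 * (f m x)\<^sup>2 + 2 * \<beta>\<^sup>2 * (g m x)\<^sup>2"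
      using ae[of m]
    proof eventually_elim
      fix x assume "h m x = \<alpha> * f m x + \<beta> * g m x"
      moreover have "(p + q)\<^sup>2 \<le> 2 * p\<^sup>2 + 2 * q\<^sup>2" for p q :: real
        using sum_squares_bound[of p q] by (simp add: power2_sum)
      ultimately show "(h m x)\<^sup>2 \<le> 2 * \<alpha>\<^sup>2 * (f m x)\<^sup>2 + 2 * \<beta>\<^sup>2 * (g m x)\<^sup>2"
        by (metis mult.assoc power_mult_distrib)
    qed
  qed
  also have "\<dots> = ?U m" using L2_D(2)[OF f(1)] L2_D(2)[OF g(1)] by simp
  finally show "(LINT x|M. (h m x)\<^sup>2) \<le> ?U m" .
qed

lemma H2_norm_to_0_iff:
  "(\<lambda>m. H2_norm \<Omega> (f m)) \<longlonglongrightarrow> 0 \<longleftrightarrow> L2_to_0 f \<and>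
     (\<forall>b\<in>Basis. L2_to_0 (\<lambda>m. weak_deriv \<Omega> b (f m))) \<and>
     (\<forall>b\<in>Basis. \<forall>c\<in>Basis. L2_to_0 (\<lambda>m. weak_deriv \<Omega> c (weak_deriv \<Omega> b (f m))))"
proof -
  define N0 where "N0 m = (LINT x|M. (f m x)\<^sup>2)" for m
  define N1 where "N1 b m = (LINT x|M. (weak_deriv \<Omega> b (f m) x)\<^sup>2)" for b m
  define N2 where "N2 b c m = (LINT x|M. (weak_deriv \<Omega> c (weak_deriv \<Omega> b (f m)) x)\<^sup>2)" for b c m
  have nn: "N0 m \<ge> 0" "N1 b m \<ge> 0" "N2 b c m \<ge> 0" for b c m
    by (simp_all add: N0_def N1_def N2_def)
  define S where "S m = N0 m + (\<Sum>b\<in>Basis. N1 b m) + (\<Sum>b\<in>Basis. \<Sum>c\<in>Basis. N2 b c m)" for m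
  have S0: "S m \<ge> 0" for m unfolding S_def by (intro add_nonneg_nonneg sum_nonneg nn)
  have "(\<lambda>m. H2_norm \<Omega> (f m)) \<longlonglongrightarrow> 0 \<longleftrightarrow> S \<longlonglongrightarrow> 0"
  proof
    assume "(\<lambda>m. H2_norm \<Omega> (f m)) \<longlonglongrightarrow> 0"
    then have "(\<lambda>m. (sqrt (S m))\<^sup>2) \<longlonglongrightarrow> 0\<^sup>2"
      unfolding H2_norm_def S_def N0_def N1_def N2_def by (intro tendsto_power)
    then show "S \<longlonglongrightarrow> 0" using S0 by simp
  next
    assume "S \<longlonglongrightarrow> 0"
    then have "(\<lambda>m. sqrt (S m)) \<longlonglongrightarrow> sqrt 0" by (intro tendsto_real_sqrt)
    then show "(\<lambda>m. H2_norm \<Omega> (f m)) \<longlonglongrightarrow> 0"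
      unfolding H2_norm_def S_def N0_def N1_def N2_def by simp
  qed
  also have "S \<longlonglongrightarrow> 0 \<longleftrightarrow> N0 \<longlonglongrightarrow> 0 \<and> (\<forall>b\<in>Basis. N1 b \<longlonglongrightarrow> 0) \<and> (\<forall>b\<in>Basis. \<forall>c\<in>Basis. N2 b c \<longlonglongrightarrow> 0)"
  proof (intro iffI conjI ballI)
    assume S: "S \<longlonglongrightarrow> 0"
    have sw: "X \<longlonglongrightarrow> 0" if "\<And>m. 0 \<le> X m" "\<And>m. X m \<le> S m" for X
      by (rule real_tendsto_sandwich[OF _ _ tendsto_const S]) (use that in auto)
    have s1: "0 \<le> (\<Sum>b\<in>Basis. N1 b m)" "0 \<le> (\<Sum>b\<in>Basis. \<Sum>c\<in>Basis. N2 b c m)" for m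
      by (intro sum_nonneg nn)+
    show "N0 \<longlonglongrightarrow> 0" by (rule sw) (use nn s1 in \<open>auto simp: S_def add_nonneg_nonneg\<close>)
    show "N1 b \<longlonglongrightarrow> 0" if b: "b \<in> Basis" for b
    proof (rule sw)
      fix m show "N1 b m \<le> S m"
        using nn(1)[of m] s1(2)[of m] member_le_sum[OF b, of "\<lambda>b. N1 b m"] nn(2) by (simp add: S_def)
    qed (rule nn)
    show "N2 b c \<longlonglongrightarrow> 0" if b: "b \<in> Basis" and c: "c \<in> Basis" for b c
    proof (rule sw)
      fix m
      have "N2 b c m \<le> (\<Sum>c\<in>Basis. N2 b c m)" using member_le_sum[OF c, of "\<lambda>c. N2 b c m"] nn(3) by simp
      also have "\<dots> \<le> (\<Sum>b\<in>Basis. \<Sum>c\<in>Basis. N2 b c m)"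
        using member_le_sum[OF b, of "\<lambda>b. \<Sum>c\<in>Basis. N2 b c m"] nn(3) by (simp add: sum_nonneg)
      finally show "N2 b c m \<le> S m" using nn(1)[of m] s1(1)[of m] by (simp add: S_def)
    qed (rule nn)
  next
    assume a: "N0 \<longlonglongrightarrow> 0 \<and> (\<forall>b\<in>Basis. N1 b \<longlonglongrightarrow> 0) \<and> (\<forall>b\<in>Basis. \<forall>c\<in>Basis. N2 b c \<longlonglongrightarrow> 0)"
    have "(\<lambda>m. N0 m + (\<Sum>b\<in>Basis. N1 b m) + (\<Sum>b\<in>Basis. \<Sum>c\<in>Basis. N2 b c m)) \<longlonglongrightarrow>
       0 + (\<Sum>b\<in>(Basis::'a set). 0) + (\<Sum>b\<in>(Basis::'a set). \<Sum>c\<in>(Basis::'a set). 0)"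
      using a by (intro tendsto_add tendsto_sum) auto
    then show "S \<longlonglongrightarrow> 0" by (simp add: S_def[abs_def])
  qed
  finally show ?thesis by (simp add: L2_to_0_def N0_def[abs_def] N1_def[abs_def] N2_def[abs_def])
qed

end

subsection \<open>Eigenfunctions\<close>

context bounded_open
begin

lemma H2_0_D:
  assumes "u \<in> H2_0 \<Omega>"
  shows "\<exists>\<phi>::nat \<Rightarrow> 'a \<Rightarrow> real. (\<forall>m. \<phi> m \<in> test_functions \<Omega>) \<and> L2_to_0 (\<lambda>m x. \<phi> m x - u x) \<and>
    (\<forall>b\<in>Basis. L2_to_0 (\<lambda>m. weak_deriv \<Omega> b (\<lambda>x. \<phi> m x - u x))) \<and>
    (\<forall>b\<in>Basis. \<forall>c\<in>Basis. L2_to_0 (\<lambda>m. weak_deriv \<Omega> c (weak_deriv \<Omega> b (\<lambda>x. \<phi> m x - u x))))"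
  using assms unfolding H2_0_def mem_Collect_eq H2_norm_to_0_iff by blast

lemma H2_0_H2: "u \<in> H2_0 \<Omega> \<Longrightarrow> u \<in> H2 \<Omega>"
  by (simp add: H2_0_def)

lemma H2_diff:
  assumes u: "u \<in> H2 \<Omega>" and v: "v \<in> H2 \<Omega>"
  shows "(\<lambda>x. u x - v x) \<in> H2 \<Omega>"
    and "b \<in> Basis \<Longrightarrow> AE x in M.
      weak_deriv \<Omega> b (\<lambda>x. u x - v x) x = weak_deriv \<Omega> b u x - weak_deriv \<Omega> b v x"
    and "b \<in> Basis \<Longrightarrow> c \<in> Basis \<Longrightarrow> AE x in M.
      weak_deriv \<Omega> c (weak_deriv \<Omega> b (\<lambda>x. u x - v x)) x
      = weak_deriv \<Omega> c (weak_deriv \<Omega> b u) x - weak_deriv \<Omega> c (weak_deriv \<Omega> b v) x"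
  using H2_lin[OF u v, where \<alpha>=1 and \<beta>="-1"] by simp_all

text \<open>The same combination of the approximating test functions approximates the combination of
  the limits, and the \<open>H2\<close> norm of the error is controlled component by component. This
  makes eigenspaces linear, as orthonormalisation requires.\<close>

lemma H2_0_lin:
  assumes u: "u \<in> H2_0 \<Omega>" and v: "v \<in> H2_0 \<Omega>"
  shows "(\<lambda>x. \<alpha> * u x + \<beta> * v x) \<in> H2_0 \<Omega>"
proof -
  have phi1: "u \<in> H2 \<Omega>" by (rule H2_0_H2) fact
  obtain \<phi> where \<phi>: "\<And>m::nat. \<phi> m \<in> test_functions \<Omega>"
    "L2_to_0 (\<lambda>m x. \<phi> m x - u x)"
    "\<And>b. b \<in> Basis \<Longrightarrow> L2_to_0 (\<lambda>m. weak_deriv \<Omega> b (\<lambda>x. \<phi> m x - u x))"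
    "\<And>b c. b \<in> Basis \<Longrightarrow> c \<in> Basis \<Longrightarrow> L2_to_0 (\<lambda>m. weak_deriv \<Omega> c (weak_deriv \<Omega> b (\<lambda>x. \<phi> m x - u x)))"
    using H2_0_D[OF u] by blast
  have psi1: "v \<in> H2 \<Omega>" by (rule H2_0_H2) fact
  obtain \<psi> where \<psi>: "\<And>m::nat. \<psi> m \<in> test_functions \<Omega>"
    "L2_to_0 (\<lambda>m x. \<psi> m x - v x)"
    "\<And>b. b \<in> Basis \<Longrightarrow> L2_to_0 (\<lambda>m. weak_deriv \<Omega> b (\<lambda>x. \<psi> m x - v x))"
    "\<And>b c. b \<in> Basis \<Longrightarrow> c \<in> Basis \<Longrightarrow> L2_to_0 (\<lambda>m. weak_deriv \<Omega> c (weak_deriv \<Omega> b (\<lambda>x. \<psi> m x - v x)))"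
    using H2_0_D[OF v] by blast
  have f: "(\<lambda>x. \<phi> m x - u x) \<in> H2 \<Omega>" for m by (intro H2_diff(1) H2_test_function \<phi> phi1)
  have g: "(\<lambda>x. \<psi> m x - v x) \<in> H2 \<Omega>" for m by (intro H2_diff(1) H2_test_function \<psi> psi1)
  note h = H2_lin[OF f g, where \<alpha>=\<alpha> and \<beta>=\<beta>]
  have eq: "(\<lambda>x. (\<alpha> * \<phi> m x + \<beta> * \<psi> m x) - (\<alpha> * u x + \<beta> * v x)) = (\<lambda>x. \<alpha> * (\<phi> m x - u x) + \<beta> * (\<psi> m x - v x))" for m
    by (intro ext) (simp add: algebra_simps)
  have "(\<lambda>m. H2_norm \<Omega> (\<lambda>x. (\<alpha> * \<phi> m x + \<beta> * \<psi> m x) - (\<alpha> * u x + \<beta> * v x))) \<longlonglongrightarrow> 0"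
    unfolding eq H2_norm_to_0_iff
  proof (intro conjI ballI)
    show "L2_to_0 (\<lambda>m x. \<alpha> * (\<phi> m x - u x) + \<beta> * (\<psi> m x - v x))"
      by (rule L2_to_0_lin[OF H2_L2(1)[OF f] \<phi>(2) H2_L2(1)[OF g] \<psi>(2) H2_L2(1)[OF h(1)], where \<alpha>=\<alpha> and \<beta>=\<beta>]) simp
    fix b :: 'a assume b: "b \<in> Basis"
    show "L2_to_0 (\<lambda>m. weak_deriv \<Omega> b (\<lambda>x. \<alpha> * (\<phi> m x - u x) + \<beta> * (\<psi> m x - v x)))"
      by (rule L2_to_0_lin[OF H2_L2(2)[OF f b] \<phi>(3)[OF b] H2_L2(2)[OF g b] \<psi>(3)[OF b] H2_L2(2)[OF h(1) b] h(2)[OF b]])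
    fix c :: 'a assume c: "c \<in> Basis"
    show "L2_to_0 (\<lambda>m. weak_deriv \<Omega> c (weak_deriv \<Omega> b (\<lambda>x. \<alpha> * (\<phi> m x - u x) + \<beta> * (\<psi> m x - v x))))"
      by (rule L2_to_0_lin[OF H2_L2(3)[OF f b c] \<phi>(4)[OF b c] H2_L2(3)[OF g b c] \<psi>(4)[OF b c] H2_L2(3)[OF h(1) b c] h(3)[OF b c]])
  qed
  moreover have "(\<lambda>x. \<alpha> * \<phi> m x + \<beta> * \<psi> m x) \<in> test_functions \<Omega>" for m
    by (intro test_functions_add test_functions_cmult \<phi> \<psi>)
  ultimately show ?thesis
    unfolding H2_0_def mem_Collect_eq
    by (intro conjI H2_lin(1) phi1 psi1 exI[of _ "\<lambda>m x. \<alpha> * \<phi> m x + \<beta> * \<psi> m x"]) auto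
qed

lemma L2_sum:
  assumes "finite A" "\<And>i. i \<in> A \<Longrightarrow> f i \<in> L2 \<Omega>"
  shows "(\<lambda>x. \<Sum>i\<in>A. c i * f i x) \<in> L2 \<Omega>"
  using assms
proof (induction A rule: finite_induct)
  case empty
  show ?case using L2_continuous[of "\<lambda>_. 0"] by simp
next
  case (insert i A)
  then show ?case using L2_lin[of "f i" "\<lambda>x. \<Sum>i\<in>A. c i * f i x" "c i" 1] by simp
qed

lemma integral_sum_mult:
  assumes "finite A" "\<And>i. i \<in> A \<Longrightarrow> f i \<in> L2 \<Omega>" "h \<in> L2 \<Omega>"
  shows "(LINT x|M. (\<Sum>i\<in>A. c i * f i x) * h x) = (\<Sum>i\<in>A. c i * (LINT x|M. f i x * h x))"
proof -
  have "(LINT x|M. (\<Sum>i\<in>A. c i * f i x) * h x) = (LINT x|M. (\<Sum>i\<in>A. c i * (f i x * h x)))"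
    by (simp add: sum_distrib_right mult.assoc)
  also have "\<dots> = (\<Sum>i\<in>A. (LINT x|M. c i * (f i x * h x)))"
    by (intro Bochner_Integration.integral_sum integrable_mult_right L2_mult_integrable assms) auto
  finally show ?thesis by simp
qed

text \<open>The bilinear form on the left of the weak eigenvalue equation; at \<open>(u, u)\<close>
  for a normalised eigenfunction \<open>u\<close> it equals the eigenvalue.\<close>

definition energy :: "real \<Rightarrow> ('a \<Rightarrow> real) \<Rightarrow> ('a \<Rightarrow> real) \<Rightarrow> real" where
  "energy a u v = (LINT x|M. weak_laplacian \<Omega> u x * weak_laplacian \<Omega> v x)
     + a * (LINT x|M. (\<Sum>b\<in>Basis. weak_deriv \<Omega> b u x * weak_deriv \<Omega> b v x))"

lemma energy_commute: "energy a u v = energy a v u"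
  by (simp add: energy_def mult.commute)

lemma L2_laplacian:
  assumes "u \<in> H2 \<Omega>" shows "weak_laplacian \<Omega> u \<in> L2 \<Omega>"
  using L2_sum[of "Basis" "\<lambda>b. weak_deriv \<Omega> b (weak_deriv \<Omega> b u)" "\<lambda>_. 1"] H2_L2(3)[OF assms]
  by (simp add: weak_laplacian_def[abs_def])

lemma weak_laplacian_lin:
  assumes "u \<in> H2 \<Omega>" "v \<in> H2 \<Omega>"
  shows "AE x in M. weak_laplacian \<Omega> (\<lambda>x. \<alpha> * u x + \<beta> * v x) x
    = \<alpha> * weak_laplacian \<Omega> u x + \<beta> * weak_laplacian \<Omega> v x"
proof -
  have "AE x in M. \<forall>b\<in>Basis. weak_deriv \<Omega> b (weak_deriv \<Omega> b (\<lambda>x. \<alpha> * u x + \<beta> * v x)) x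
      = \<alpha> * weak_deriv \<Omega> b (weak_deriv \<Omega> b u) x + \<beta> * weak_deriv \<Omega> b (weak_deriv \<Omega> b v) x"
    by (intro eventually_ball_finite ballI H2_lin(3)[OF assms]) auto
  then show ?thesis
    by eventually_elim (simp add: weak_laplacian_def sum.distrib sum_distrib_left)
qed

lemma energy_lin:
  assumes u: "u \<in> H2 \<Omega>" and v: "v \<in> H2 \<Omega>" and w: "w \<in> H2 \<Omega>"
  shows "energy a (\<lambda>x. \<alpha> * u x + \<beta> * v x) w = \<alpha> * energy a u w + \<beta> * energy a v w"
proof -
  note h = H2_lin(1)[OF u v, of \<alpha> \<beta>]
  have 1: "(LINT x|M. weak_laplacian \<Omega> (\<lambda>x. \<alpha> * u x + \<beta> * v x) x * weak_laplacian \<Omega> w x)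
    = \<alpha> * (LINT x|M. weak_laplacian \<Omega> u x * weak_laplacian \<Omega> w x)
    + \<beta> * (LINT x|M. weak_laplacian \<Omega> v x * weak_laplacian \<Omega> w x)"
    unfolding integral_add_mult[OF L2_laplacian[OF u] L2_laplacian[OF v] L2_laplacian[OF w], symmetric]
    by (rule integral_mult_cong_AE[OF L2_laplacian[OF h] L2_lin[OF L2_laplacian[OF u] L2_laplacian[OF v]]
        L2_laplacian[OF w] L2_laplacian[OF w] weak_laplacian_lin[OF u v]]) simp
  have grad: "(LINT x|M. (\<Sum>b\<in>Basis. weak_deriv \<Omega> b p x * weak_deriv \<Omega> b q x))
     = (\<Sum>b\<in>Basis. LINT x|M. weak_deriv \<Omega> b p x * weak_deriv \<Omega> b q x)"
    if "p \<in> H2 \<Omega>" "q \<in> H2 \<Omega>" for p q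
    by (intro Bochner_Integration.integral_sum L2_mult_integrable H2_L2 that)
  have 2: "(LINT x|M. weak_deriv \<Omega> b (\<lambda>x. \<alpha> * u x + \<beta> * v x) x * weak_deriv \<Omega> b w x)
    = \<alpha> * (LINT x|M. weak_deriv \<Omega> b u x * weak_deriv \<Omega> b w x)
    + \<beta> * (LINT x|M. weak_deriv \<Omega> b v x * weak_deriv \<Omega> b w x)" if b: "b \<in> Basis" for b
    unfolding integral_add_mult[OF H2_L2(2)[OF u b] H2_L2(2)[OF v b] H2_L2(2)[OF w b], symmetric]
    by (rule integral_mult_cong_AE[OF H2_L2(2)[OF h b] L2_lin[OF H2_L2(2)[OF u b] H2_L2(2)[OF v b]]
        H2_L2(2)[OF w b] H2_L2(2)[OF w b] H2_lin(2)[OF u v b]]) simp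
  have 3: "(\<Sum>b\<in>Basis. LINT x|M. weak_deriv \<Omega> b (\<lambda>x. \<alpha> * u x + \<beta> * v x) x * weak_deriv \<Omega> b w x)
    = \<alpha> * (\<Sum>b\<in>Basis. LINT x|M. weak_deriv \<Omega> b u x * weak_deriv \<Omega> b w x)
    + \<beta> * (\<Sum>b\<in>Basis. LINT x|M. weak_deriv \<Omega> b v x * weak_deriv \<Omega> b w x)"
    by (simp add: 2 sum.distrib sum_distrib_left)
  show ?thesis
    unfolding energy_def 1 grad[OF h w] grad[OF u w] grad[OF v w] 3
    by (simp add: algebra_simps)
qed

lemma eigenspace_iff: "u \<in> eigenspace a \<Omega> \<mu> \<longleftrightarrow> u \<in> H2_0 \<Omega> \<and>
    (\<forall>v\<in>H2_0 \<Omega>. energy a u v = \<mu> * (LINT x|M. u x * v x))"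
  by (simp add: eigenspace_def energy_def)

lemma eigenspace_L2: "u \<in> eigenspace a \<Omega> \<mu> \<Longrightarrow> u \<in> L2 \<Omega>"
  using H2_L2(1) H2_0_H2 by (auto simp: eigenspace_iff)

lemma eigenspace_lin:
  assumes u: "u \<in> eigenspace a \<Omega> \<mu>" and v: "v \<in> eigenspace a \<Omega> \<mu>"
  shows "(\<lambda>x. \<alpha> * u x + \<beta> * v x) \<in> eigenspace a \<Omega> \<mu>"
proof -
  have H: "u \<in> H2_0 \<Omega>" "v \<in> H2_0 \<Omega>" using u v by (auto simp: eigenspace_iff)
  show ?thesis unfolding eigenspace_iff
  proof (intro conjI ballI H2_0_lin H)
    fix w assume w: "w \<in> H2_0 \<Omega>"
    show "energy a (\<lambda>x. \<alpha> * u x + \<beta> * v x) w = \<mu> * (LINT x|M. (\<alpha> * u x + \<beta> * v x) * w x)"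
      unfolding energy_lin[OF H[THEN H2_0_H2] H2_0_H2[OF w]]
        integral_add_mult[OF eigenspace_L2[OF u] eigenspace_L2[OF v] H2_L2(1)[OF H2_0_H2[OF w]]]
      using u v w by (simp add: eigenspace_iff algebra_simps)
  qed
qed

text \<open>The energy is symmetric, so testing either equation with the other eigenfunction gives
  \<open>\<mu>\<close> and \<open>\<nu>\<close> times the same inner product.\<close>

lemma eigenspace_orthogonal:
  assumes u: "u \<in> eigenspace a \<Omega> \<mu>" and v: "v \<in> eigenspace a \<Omega> \<nu>" and "\<mu> \<noteq> \<nu>"
  shows "(LINT x|M. u x * v x) = 0"
proof -
  have "energy a u v = \<mu> * (LINT x|M. u x * v x)" "energy a v u = \<nu> * (LINT x|M. v x * u x)"
    using u v by (auto simp: eigenspace_iff)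
  moreover have "(LINT x|M. v x * u x) = (LINT x|M. u x * v x)" by (simp add: mult.commute)
  ultimately have "\<mu> * (LINT x|M. u x * v x) = \<nu> * (LINT x|M. u x * v x)"
    using energy_commute[of a u v] by metis
  then show ?thesis using assms(3) by (metis mult_right_cancel)
qed

text \<open>The third conclusion carries the induction: because the earlier \<open>e i\<close> are
  combinations of the earlier \<open>w l\<close>, the residual of \<open>w m\<close> after
  projection is a combination of all \<open>w l\<close> in which \<open>w m\<close> has coefficient
  \<open>1\<close>, and so cannot vanish almost everywhere.\<close>

lemma gram_schmidt:
  fixes w :: "nat \<Rightarrow> 'a \<Rightarrow> real" and m :: nat
  assumes lin: "\<And>u v \<alpha> \<beta>. u \<in> S \<Longrightarrow> v \<in> S \<Longrightarrow> (\<lambda>x. \<alpha> * u x + \<beta> * v x) \<in> S" and L2: "S \<subseteq> L2 \<Omega>"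
    and w: "\<And>i. i < m \<Longrightarrow> w i \<in> S"
    and ind: "\<And>c. AE x in M. (\<Sum>i<m. c i * w i x) = 0 \<Longrightarrow> \<forall>i<m. c i = 0"
  shows "\<exists>e. (\<forall>i<m. e i \<in> S) \<and>
    (\<forall>i<m. \<forall>j<m. (LINT x|M. e i x * e j x) = (if i = j then 1 else 0)) \<and>
    (\<forall>i<m. \<exists>c. e i = (\<lambda>x. \<Sum>l<m. c l * w l x))"
  using w ind
proof (induction m)
  case (Suc m)
  have ind': "\<forall>i<m. c i = 0" if "AE x in M. (\<Sum>i<m. c i * w i x) = 0" for c
  proof -
    have "AE x in M. (\<Sum>i<Suc m. (c(m := 0)) i * w i x) = 0"
      using that by eventually_elim simp
    from Suc.prems(2)[OF this] show ?thesis by (metis fun_upd_other less_Suc_eq nat_neq_iff)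
  qed
  obtain e where e: "\<And>i. i < m \<Longrightarrow> e i \<in> S"
    "\<And>i j. i < m \<Longrightarrow> j < m \<Longrightarrow> (LINT x|M. e i x * e j x) = (if i = j then 1 else 0)"
    "\<And>i. i < m \<Longrightarrow> \<exists>c. e i = (\<lambda>x. \<Sum>l<m. c l * w l x)"
    using Suc.IH[OF Suc.prems(1)[OF less_SucI] ind'] by blast
  have wm: "w m \<in> S" using Suc.prems(1) by simp
  define p where "p i = - (LINT x|M. w m x * e i x)" for i
  define r where "r = (\<lambda>x. 1 * w m x + 1 * (\<Sum>i<m. p i * e i x))"
  have sumS: "(\<lambda>x. \<Sum>i<k. p i * e i x) \<in> S" if "k \<le> m" for k
    using that
  proof (induction k)
    case 0
    then show ?case using lin[OF wm wm, of 0 0] by simp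
  next
    case (Suc k)
    then show ?case using lin[of "\<lambda>x. \<Sum>i<k. p i * e i x" "e k" 1 "p k"] e(1)[of k] by simp
  qed
  have rS: "r \<in> S" unfolding r_def by (rule lin[OF wm sumS]) simp
  have r_orth: "(LINT x|M. r x * e j x) = 0" if j: "j < m" for j
  proof -
    have "(LINT x|M. r x * e j x) = 1 * (LINT x|M. w m x * e j x) +
      1 * (LINT x|M. (\<Sum>i<m. p i * e i x) * e j x)"
      unfolding r_def using wm sumS e(1)[OF j] L2 by (intro integral_add_mult) auto
    also have "(LINT x|M. (\<Sum>i<m. p i * e i x) * e j x) = (\<Sum>i<m. p i * (LINT x|M. e i x * e j x))"
      using e(1) j L2 by (intro integral_sum_mult) auto
    also have "\<dots> = (\<Sum>i<m. p i * (if i = j then 1 else 0))" using e(2) j by (intro sum.cong) auto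
    also have "\<dots> = p j" using j by (simp add: sum.delta if_distrib cong: if_cong)
    finally show ?thesis by (simp add: p_def)
  qed
  obtain C where C: "\<And>i. i < m \<Longrightarrow> e i = (\<lambda>x. \<Sum>l<m. C i l * w l x)" using e(3) by metis
  \<comment> \<open>Coefficients of the residual \<open>r\<close> in terms of the
    \<open>w l\<close>; the entry \<open>1\<close> at \<open>m\<close> is what contradicts
    independence if \<open>r\<close> has norm \<open>0\<close>.\<close>
  define d where "d l = (if l = m then 1 else (\<Sum>i<m. p i * C i l))" for l
  have r_eq: "r x = (\<Sum>l<Suc m. d l * w l x)" for x
  proof -
    have "(\<Sum>i<m. p i * e i x) = (\<Sum>i<m. p i * (\<Sum>l<m. C i l * w l x))" using C by (intro sum.cong) auto
    also have "\<dots> = (\<Sum>l<m. (\<Sum>i<m. p i * C i l) * w l x)"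
      unfolding sum_distrib_left sum_distrib_right by (subst sum.swap) (simp add: mult.assoc)
    finally show ?thesis by (simp add: r_def d_def)
  qed
  define N where "N = (LINT x|M. r x * r x)"
  have "N \<noteq> 0"
  proof
    assume "N = 0"
    then have "AE x in M. r x * r x = 0"
      unfolding N_def using L2_mult_integrable[of r r] rS L2 by (subst (asm) integral_nonneg_eq_0_iff_AE) auto
    then have "AE x in M. (\<Sum>l<Suc m. d l * w l x) = 0" by eventually_elim (simp add: r_eq)
    from Suc.prems(2)[OF this] show False by (auto simp: d_def)
  qed
  moreover have "N \<ge> 0" unfolding N_def by simp
  ultimately have N: "N > 0" by simp
  define e' where "e' = e(m := (\<lambda>x. r x / sqrt N))"
  have e'm: "e' m = (\<lambda>x. (1 / sqrt N) * r x + 0 * r x)" by (simp add: e'_def)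
  show ?case
  proof (intro exI[of _ e'] conjI allI impI)
    fix i assume i: "i < Suc m"
    show "e' i \<in> S"
    proof (cases "i = m")
      case True then show ?thesis using lin[OF rS rS] by (simp only: e'm)
    qed (use e(1) i in \<open>simp add: e'_def\<close>)
    show "\<exists>c. e' i = (\<lambda>x. \<Sum>l<Suc m. c l * w l x)"
    proof (cases "i = m")
      case True
      then show ?thesis by (intro exI[of _ "\<lambda>l. d l / sqrt N"]) (simp add: e'_def r_eq sum_divide_distrib add_divide_distrib)
    next
      case False
      then show ?thesis using i C[of i] by (intro exI[of _ "(C i)(m := 0)"]) (simp add: e'_def)
    qed
    fix j assume j: "j < Suc m"
    have em: "(LINT x|M. e' m x * e' j x) = 0" if "j < m" for j
      using r_orth[OF that] that by (simp add: e'_def)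
    have em': "(LINT x|M. e' j x * e' m x) = 0" if "j < m" for j
      using em[OF that] by (simp add: mult.commute)
    have emm: "(LINT x|M. e' m x * e' m x) = 1"
      using N by (simp add: e'_def N_def)
    show "(LINT x|M. e' i x * e' j x) = (if i = j then 1 else 0)"
      using i j e(2)[of i j] em[of j] em'[of i] emm by (cases "i = m"; cases "j = m") (auto simp: e'_def)
  qed
qed simp

text \<open>Since the eigenvalues tend to infinity, each value is taken by finitely many indices, as
  many as its multiplicity. An orthonormal basis of each eigenspace is distributed over these
  indices; different eigenvalues give orthogonal functions anyway.\<close>

lemma orthonormal_eigenfunctions:
  assumes "eigenvalue_sequence a \<Omega> \<Gamma>"
  obtains e :: "nat \<Rightarrow> 'a \<Rightarrow> real" where "\<And>j. 1 \<le> j \<Longrightarrow> e j \<in> eigenspace a \<Omega> (\<Gamma> j)"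
    "\<And>i j. 1 \<le> i \<Longrightarrow> 1 \<le> j \<Longrightarrow> (LINT x|M. e i x * e j x) = (if i = j then 1 else 0)"
proof -
  define J where "J \<mu> = {j. 1 \<le> j \<and> \<Gamma> j = \<mu>}" for \<mu>
  have fin: "finite (J \<mu>)" for \<mu>
  proof -
    have "eventually (\<lambda>j. \<Gamma> j > \<mu>) sequentially"
      using assms by (simp add: eigenvalue_sequence_def filterlim_at_top_dense)
    then obtain N where "\<And>j. j \<ge> N \<Longrightarrow> \<Gamma> j > \<mu>" by (auto simp: eventually_sequentially)
    then have "J \<mu> \<subseteq> {..<N}" unfolding J_def by (auto simp: not_less[symmetric])
    then show ?thesis using finite_subset by blast
  qed
  have "\<exists>e. (\<forall>i<card (J \<mu>). e i \<in> eigenspace a \<Omega> \<mu>) \<and>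
    (\<forall>i<card (J \<mu>). \<forall>j<card (J \<mu>). (LINT x|M. e i x * e j x) = (if i = j then 1 else 0))" for \<mu>
  proof -
    have "has_multiplicity a \<Omega> \<mu> (card (J \<mu>))" using assms by (simp add: eigenvalue_sequence_def J_def)
    then obtain w where w: "\<And>i. i < card (J \<mu>) \<Longrightarrow> w i \<in> eigenspace a \<Omega> \<mu>"
      "\<And>c. AE x in M. (\<Sum>i<card (J \<mu>). c i * w i x) = 0 \<Longrightarrow> \<forall>i<card (J \<mu>). c i = 0"
      unfolding has_multiplicity_def by blast
    show ?thesis
      using gram_schmidt[where S="eigenspace a \<Omega> \<mu>" and w=w and m="card (J \<mu>)", OF eigenspace_lin _ w(1) w(2)]
        eigenspace_L2 by blast
  qed
  then obtain E where E: "\<And>\<mu> i. i < card (J \<mu>) \<Longrightarrow> E \<mu> i \<in> eigenspace a \<Omega> \<mu>"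
    "\<And>\<mu> i j. i < card (J \<mu>) \<Longrightarrow> j < card (J \<mu>) \<Longrightarrow> (LINT x|M. E \<mu> i x * E \<mu> j x) = (if i = j then 1 else 0)"
    by metis
  \<comment> \<open>The rank of \<open>j\<close>, counted from \<open>0\<close>, among the indices
    with the same eigenvalue; it selects a different basis vector for each of them.\<close>
  define q where "q j = card {i \<in> J (\<Gamma> j). i < j}" for j
  have q: "q j < card (J (\<Gamma> j))" if "1 \<le> j" for j
    unfolding q_def using that by (intro psubset_card_mono fin) (auto simp: J_def)
  have q_less: "q i < q j" if "1 \<le> i" "i < j" "\<Gamma> i = \<Gamma> j" for i j
    unfolding q_def using that finite_subset[OF _ fin]
    by (intro psubset_card_mono) (auto simp: J_def)
  have q_inj: "q i \<noteq> q j" if "1 \<le> i" "1 \<le> j" "i \<noteq> j" "\<Gamma> i = \<Gamma> j" for i j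
    using q_less[of i j] q_less[of j i] that by (cases i j rule: linorder_cases) auto
  show ?thesis
  proof
    show "E (\<Gamma> j) (q j) \<in> eigenspace a \<Omega> (\<Gamma> j)" if "1 \<le> j" for j by (rule E(1)[OF q[OF that]])
    fix i j :: nat assume ij: "1 \<le> i" "1 \<le> j"
    show "(LINT x|M. E (\<Gamma> i) (q i) x * E (\<Gamma> j) (q j) x) = (if i = j then 1 else 0)"
    proof (cases "\<Gamma> i = \<Gamma> j")
      case True
      then show ?thesis using E(2)[OF q[OF ij(1)], of "q j"] q[OF ij(2)] q_inj[OF ij _ True] by auto
    next
      case False
      then show ?thesis using eigenspace_orthogonal[OF E(1)[OF q[OF ij(1)]] E(1)[OF q[OF ij(2)]]] by auto
    qed
  qed
qed

end

subsection \<open>The Gaussian\<close>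

text \<open>This is the characteristic function of the standard normal distribution, freed from the
  normalising constant.\<close>

lemma std_normal_fourier:
  fixes t :: real
  shows "has_bochner_integral lborel (\<lambda>x. iexp (t * x) * complex_of_real (exp (- x\<^sup>2 / 2)))
    (complex_of_real (sqrt (2 * pi) * exp (- t\<^sup>2 / 2)))"
proof -
  interpret real_distribution std_normal_distribution by (rule real_dist_normal_dist)
  have int: "integrable std_normal_distribution (\<lambda>x. iexp (t * x))"
    by (rule integrable_iexp) auto
  have "(CLINT x|std_normal_distribution. iexp (t * x)) = complex_of_real (exp (- t\<^sup>2 / 2))"
    using fun_cong[OF char_std_normal_distribution, of t] by (simp add: char_def)
  with int have "has_bochner_integral lborel (\<lambda>x. std_normal_density x *\<^sub>R iexp (t * x)) (complex_of_real (exp (- t\<^sup>2 / 2)))"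
    using integrable_density[of "\<lambda>x. iexp (t * x)" lborel std_normal_density]
      integral_density[of "\<lambda>x. iexp (t * x)" lborel std_normal_density]
    by (auto simp: has_bochner_integral_iff)
  from has_bochner_integral_mult_right[OF this, of "complex_of_real (sqrt (2 * pi))"]
  have "has_bochner_integral lborel (\<lambda>x. complex_of_real (sqrt (2 * pi)) * (std_normal_density x *\<^sub>R iexp (t * x)))
     (complex_of_real (sqrt (2 * pi)) * complex_of_real (exp (- t\<^sup>2 / 2)))" by simp
  moreover have "complex_of_real (sqrt (2 * pi)) * (std_normal_density x *\<^sub>R iexp (t * x)) =
     iexp (t * x) * complex_of_real (exp (- x\<^sup>2 / 2))" for x
  proof -
    have "sqrt (2 * pi) * std_normal_density x = exp (- x\<^sup>2 / 2)" by (simp add: std_normal_density_def)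
    then have "complex_of_real (sqrt (2 * pi)) * complex_of_real (std_normal_density x) = complex_of_real (exp (- x\<^sup>2 / 2))"
      by (simp flip: of_real_mult)
    then show ?thesis unfolding scaleR_conv_of_real mult.assoc[symmetric] by (simp only: mult.commute)
  qed
  ultimately show ?thesis by simp
qed

lemma norm_sq_eq_sum_Basis: "(norm x)\<^sup>2 = (\<Sum>b\<in>Basis. (x \<bullet> b)\<^sup>2)" for x :: "'a::euclidean_space"
  by (simp add: power2_norm_eq_inner) (simp add: euclidean_inner[of x x] power2_eq_square)

text \<open>Over complex numbers the integrand is a product of one-dimensional functions of the
  coordinates, so the integral factorises on the product measure. The cosine alone does not
  factorise; it is recovered at the end as a real part.\<close>

lemma gaussian_fourier:
  fixes v :: "'a::euclidean_space"
  shows "has_bochner_integral lborel (\<lambda>\<xi>::'a. cos (\<xi> \<bullet> v) * exp (- (norm \<xi>)\<^sup>2 / 2))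
    (sqrt (2 * pi) ^ DIM('a) * exp (- (norm v)\<^sup>2 / 2))"
proof -
  interpret product_sigma_finite "\<lambda>_::'a. lborel :: real measure" ..
  let ?f = "\<lambda>b x. iexp ((v \<bullet> b) * x) * complex_of_real (exp (- x\<^sup>2 / 2))"
  let ?g = "\<lambda>\<xi>::'a. iexp (\<xi> \<bullet> v) * complex_of_real (exp (- (norm \<xi>)\<^sup>2 / 2))"
  let ?T = "\<lambda>f. \<Sum>b\<in>Basis. f b *\<^sub>R b :: 'a"
  let ?P = "Pi\<^sub>M (Basis::'a set) (\<lambda>_. lborel :: real measure)"
  have [measurable]: "?T \<in> measurable ?P borel" by measurable
  have T: "?T f \<bullet> b = f b" if "b \<in> Basis" for f b using that by simp
  have gT: "?g (?T f) = (\<Prod>b\<in>Basis. ?f b (f b))" for f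
  proof -
    have "?g (?T f) = exp (\<i> * complex_of_real (\<Sum>b\<in>Basis. f b * (v \<bullet> b))) * complex_of_real (exp (\<Sum>b\<in>Basis. - (f b)\<^sup>2 / 2))"
      unfolding norm_sq_eq_sum_Basis euclidean_inner[of _ v] by (simp add: T sum_negf sum_divide_distrib)
    also have "\<dots> = (\<Prod>b\<in>Basis. exp (\<i> * complex_of_real (f b * (v \<bullet> b)))) * (\<Prod>b\<in>Basis. complex_of_real (exp (- (f b)\<^sup>2 / 2)))"
      by (simp add: exp_sum sum_distrib_left of_real_sum of_real_prod)
    also have "\<dots> = (\<Prod>b\<in>Basis. ?f b (f b))"
      by (simp add: prod.distrib mult.commute)
    finally show ?thesis .
  qed
  have i: "integrable lborel (?f b)" and e: "integral\<^sup>L lborel (?f b) = complex_of_real (sqrt (2 * pi) * exp (- (v \<bullet> b)\<^sup>2 / 2))" for b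
    using std_normal_fourier[of "v \<bullet> b"] by (auto simp: has_bochner_integral_iff)
  have "integrable ?P (\<lambda>f. ?g (?T f))" unfolding gT by (rule product_integrable_prod[OF finite_Basis i])
  then have gi: "integrable lborel ?g"
    by (subst lborel_eq, subst integrable_distr_eq) auto
  have "integral\<^sup>L lborel ?g = (\<integral>f. ?g (?T f) \<partial>?P)"
    by (subst lborel_eq, subst integral_distr) auto
  also have "\<dots> = (\<Prod>b\<in>Basis. complex_of_real (sqrt (2 * pi) * exp (- (v \<bullet> b)\<^sup>2 / 2)))"
    unfolding gT product_integral_prod[OF finite_Basis i] e ..
  also have "\<dots> = complex_of_real (sqrt (2 * pi) ^ DIM('a) * exp (- (norm v)\<^sup>2 / 2))"
    unfolding norm_sq_eq_sum_Basis by (simp add: prod.distrib exp_sum[symmetric] sum_negf sum_divide_distrib flip: of_real_prod)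
  finally have ge: "integral\<^sup>L lborel ?g = complex_of_real (sqrt (2 * pi) ^ DIM('a) * exp (- (norm v)\<^sup>2 / 2))" .
  have re: "Re (?g \<xi>) = cos (\<xi> \<bullet> v) * exp (- (norm \<xi>)\<^sup>2 / 2)" for \<xi>
    by (simp add: Re_exp)
  have "integrable lborel (\<lambda>\<xi>. Re (?g \<xi>))" using gi by (rule integrable_Re)
  moreover have "(LBINT \<xi>. Re (?g \<xi>)) = sqrt (2 * pi) ^ DIM('a) * exp (- (norm v)\<^sup>2 / 2)"
    unfolding integral_Re[OF gi] ge by (rule Re_complex_of_real)
  ultimately show ?thesis unfolding re has_bochner_integral_iff by blast
qed

section \<open>Rescaling and exchange of integrals\<close>

lemma lborel_integral_scaleR:
  fixes f :: "'a::euclidean_space \<Rightarrow> real"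
  assumes [measurable]: "f \<in> borel_measurable borel" and c: "c > 0"
  shows "integrable lborel (\<lambda>x. f (c *\<^sub>R x)) \<longleftrightarrow> integrable lborel f"
    and "(LBINT x. f x) = c ^ DIM('a) * (LBINT x. f (c *\<^sub>R x))"
proof -
  have l: "(lborel :: 'a measure) = density (distr lborel borel (\<lambda>x. c *\<^sub>R x)) (\<lambda>_. c ^ DIM('a))"
    using lborel_affine[of c "0::'a"] c by simp
  have "integrable lborel f \<longleftrightarrow> integrable (density (distr lborel borel (\<lambda>x. c *\<^sub>R x)) (\<lambda>_. c ^ DIM('a))) f"
    using l by simp
  then show "integrable lborel (\<lambda>x. f (c *\<^sub>R x)) \<longleftrightarrow> integrable lborel f"
    using c by (simp add: integrable_density integrable_distr_eq)
  have "(LBINT x. f x) = (LINT x|density (distr lborel borel (\<lambda>x. c *\<^sub>R x)) (\<lambda>_. c ^ DIM('a)). f x)"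
    using l by simp
  then show "(LBINT x. f x) = c ^ DIM('a) * (LBINT x. f (c *\<^sub>R x))"
    using c by (simp add: integral_density integral_distr)
qed

text \<open>The kernel bound gives the integrable majorant
  \<open>B * \<bar>f x\<bar> * \<bar>g y\<bar>\<close> on the product space, so the order of
  integration can be exchanged.\<close>

lemma lborel_Fubini_bounded_kernel:
  fixes f g :: "'a::euclidean_space \<Rightarrow> real" and k :: "'a \<Rightarrow> 'a \<Rightarrow> real"
  assumes f: "integrable lborel f" and g: "integrable lborel g"
    and [measurable]: "case_prod k \<in> borel_measurable (borel \<Otimes>\<^sub>M borel)" and k: "\<And>x y. \<bar>k x y\<bar> \<le> B"
  shows "(LBINT x. f x * (LBINT y. g y * k x y)) = (LBINT y. g y * (LBINT x. f x * k x y))"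
proof -
  have [measurable]: "f \<in> borel_measurable borel" "g \<in> borel_measurable borel" using f g by auto
  have B: "B \<ge> 0" using k[of 0 0] by linarith
  have bd: "norm (g y * k x y) \<le> norm (B * g y)" for x y
    using k[of x y] B mult_right_mono[OF k[of x y], of "\<bar>g y\<bar>"] by (simp add: abs_mult mult.commute)
  have gi: "integrable lborel (\<lambda>y. g y * k x y)" for x
    by (rule Bochner_Integration.integrable_bound[OF integrable_mult_right[OF g, of B]]) (use bd in auto)
  have int: "integrable (lborel \<Otimes>\<^sub>M lborel) (\<lambda>(x, y). f x * (g y * k x y))"
  proof (rule lborel_pair.Fubini_integrable)
    show "(\<lambda>(x, y). f x * (g y * k x y)) \<in> borel_measurable (lborel \<Otimes>\<^sub>M lborel)" by measurable
    show "AE x in lborel. integrable lborel (\<lambda>y. case (x, y) of (x, y) \<Rightarrow> f x * (g y * k x y))"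
      using gi by simp
    show "integrable lborel (\<lambda>x. LBINT y. norm (case (x, y) of (x, y) \<Rightarrow> f x * (g y * k x y)))"
    proof (rule Bochner_Integration.integrable_bound)
      show "integrable lborel (\<lambda>x. \<bar>f x\<bar> * (LBINT y. \<bar>B * g y\<bar>))" using f by simp
      show "(\<lambda>x. LBINT y. norm (case (x, y) of (x, y) \<Rightarrow> f x * (g y * k x y))) \<in> borel_measurable lborel"
        by measurable
      have "(LBINT y. \<bar>f x * (g y * k x y)\<bar>) \<le> (LBINT y. \<bar>f x\<bar> * \<bar>B * g y\<bar>)" for x
        by (rule integral_mono) (use gi g bd in \<open>auto simp: abs_mult[of "f x"] mult_left_mono\<close>)
      then show "AE x in lborel. norm (LBINT y. norm (case (x, y) of (x, y) \<Rightarrow> f x * (g y * k x y)))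
        \<le> norm (\<bar>f x\<bar> * (LBINT y. \<bar>B * g y\<bar>))"
        by (auto simp: abs_mult)
    qed
  qed
  have "(LBINT y. LBINT x. f x * (g y * k x y)) = (LBINT x. LBINT y. f x * (g y * k x y))"
    using lborel_pair.Fubini_integral[of "\<lambda>x y. f x * (g y * k x y)"] int by simp
  moreover have "(LBINT y. LBINT x. f x * (g y * k x y)) = (LBINT y. g y * (LBINT x. f x * k x y))"
    by (simp only: mult.left_commute[of "f _"] integral_mult_right_zero)
  ultimately show ?thesis by simp
qed

subsection \<open>Parseval identity\<close>

text \<open>The squared modulus of the Fourier transform of \<open>f\<close>, written with real
  integrals. The measure is a parameter so that the same expression applies to functions on
  \<open>\<Omega>\<close> and to Borel functions on the whole space.\<close>

definition power_spectrum :: "'a::euclidean_space measure \<Rightarrow> ('a \<Rightarrow> real) \<Rightarrow> 'a \<Rightarrow> real" where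
  "power_spectrum M f \<xi> = (LINT x|M. f x * cos (\<xi> \<bullet> x))\<^sup>2 + (LINT x|M. f x * sin (\<xi> \<bullet> x))\<^sup>2"

lemma power_spectrum_nonneg [simp]: "power_spectrum M f \<xi> \<ge> 0"
  by (simp add: power_spectrum_def)

lemma borel_measurable_power_spectrum [measurable]:
  assumes [measurable]: "f \<in> borel_measurable borel"
  shows "power_spectrum lborel f \<in> borel_measurable borel"
  unfolding power_spectrum_def[abs_def] by measurable

text \<open>Insert the Gaussian factor \<open>exp (-\<delta>\<^sup>2\<parallel>\<xi>\<parallel>\<^sup>2/2)\<close> to make Fubini applicable.\<close>

lemma gaussian_power_spectrum:
  fixes f :: "'a::euclidean_space \<Rightarrow> real"
  assumes f: "integrable lborel f" and d: "\<delta> > 0"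
  shows "has_bochner_integral lborel (\<lambda>\<xi>. exp (- (norm (\<delta> *\<^sub>R \<xi>))\<^sup>2 / 2) * power_spectrum lborel f \<xi>)
    (sqrt (2 * pi) ^ DIM('a) * (LBINT x. f x * (LBINT z. f (\<delta> *\<^sub>R z + x) * exp (- (norm z)\<^sup>2 / 2))))"
proof -
  have [measurable]: "f \<in> borel_measurable borel" using f by auto
  define g where "g \<xi> = exp (- (norm (\<delta> *\<^sub>R \<xi>))\<^sup>2 / 2)" for \<xi> :: 'a
  have [measurable]: "g \<in> borel_measurable borel" unfolding g_def by measurable
  define m where "m = (LBINT x. \<bar>f x\<bar>)"
  have bdi: "integrable lborel (\<lambda>x. f x * k x)" "\<bar>LBINT x. f x * k x\<bar> \<le> m"
    if [measurable]: "k \<in> borel_measurable borel" and k: "\<And>x. \<bar>k x\<bar> \<le> 1" for k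
  proof -
    have le: "\<bar>f x * k x\<bar> \<le> \<bar>f x\<bar>" for x using k[of x] by (simp add: abs_mult mult_left_le)
    show 1: "integrable lborel (\<lambda>x. f x * k x)"
      by (rule Bochner_Integration.integrable_bound[OF f]) (use le in auto)
    have "\<bar>LBINT x. f x * k x\<bar> \<le> (LBINT x. \<bar>f x * k x\<bar>)" by (rule integral_abs_bound)
    also have "\<dots> \<le> m" unfolding m_def using 1 f le by (intro integral_mono) auto
    finally show "\<bar>LBINT x. f x * k x\<bar> \<le> m" .
  qed
  \<comment> \<open>By the addition theorem for the cosine, the power spectrum is the double
    integral of \<open>f x * f y * cos (\<xi> \<bullet> (x - y))\<close>; \<open>K\<close> is its
    inner integral. Against the Gaussian, integrating first over \<xi> leaves a Gaussian in
    \<open>x - y\<close>.\<close>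
  define K where "K \<xi> x = (LBINT y. f y * cos (\<xi> \<bullet> (x - y)))" for \<xi> x :: 'a
  have Kb: "\<bar>K \<xi> x\<bar> \<le> m" for \<xi> x unfolding K_def by (rule bdi(2)) auto
  have PS: "power_spectrum lborel f \<xi> = (LBINT x. f x * K \<xi> x)" for \<xi>
  proof -
    define C where "C = (LBINT x. f x * cos (\<xi> \<bullet> x))"
    define S where "S = (LBINT x. f x * sin (\<xi> \<bullet> x))"
    have i: "integrable lborel (\<lambda>x. f x * cos (\<xi> \<bullet> x))" "integrable lborel (\<lambda>x. f x * sin (\<xi> \<bullet> x))"
      by (intro bdi(1); simp)+
    have "K \<xi> x = (LBINT y. cos (\<xi> \<bullet> x) * (f y * cos (\<xi> \<bullet> y)) + sin (\<xi> \<bullet> x) * (f y * sin (\<xi> \<bullet> y)))" for x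
      unfolding K_def by (intro Bochner_Integration.integral_cong) (auto simp: inner_diff_right cos_diff algebra_simps)
    also have "\<dots> x = cos (\<xi> \<bullet> x) * C + sin (\<xi> \<bullet> x) * S" for x
      using i by (simp add: C_def S_def)
    finally have "(\<lambda>x. f x * K \<xi> x) = (\<lambda>x. C * (f x * cos (\<xi> \<bullet> x)) + S * (f x * sin (\<xi> \<bullet> x)))"
      by (intro ext) (simp add: algebra_simps)
    then have "(LBINT x. f x * K \<xi> x) = C * C + S * S"
      using i by (simp add: C_def S_def)
    then show ?thesis by (simp add: power_spectrum_def C_def S_def power2_eq_square)
  qed
  have gauss: "has_bochner_integral lborel (\<lambda>\<xi>. g \<xi> * cos (\<xi> \<bullet> v))
     (sqrt (2 * pi) ^ DIM('a) * exp (- (norm (v /\<^sub>R \<delta>))\<^sup>2 / 2) / \<delta> ^ DIM('a))" for v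
  proof -
    define h where "h \<eta> = cos (\<eta> \<bullet> (v /\<^sub>R \<delta>)) * exp (- (norm \<eta>)\<^sup>2 / 2)" for \<eta>
    have h: "integrable lborel h" "(LBINT \<eta>. h \<eta>) = sqrt (2 * pi) ^ DIM('a) * exp (- (norm (v /\<^sub>R \<delta>))\<^sup>2 / 2)"
      using gaussian_fourier[of "v /\<^sub>R \<delta>"] unfolding h_def has_bochner_integral_iff by blast+
    have hm: "h \<in> borel_measurable borel" using h(1) by auto
    have hs: "h (\<delta> *\<^sub>R \<xi>) = g \<xi> * cos (\<xi> \<bullet> v)" for \<xi>
      using d by (simp add: g_def h_def mult.commute mult.assoc[symmetric])
    show ?thesis
      using lborel_integral_scaleR[OF hm d] h d unfolding hs has_bochner_integral_iff
      by (intro conjI nonzero_eq_divide_eq[THEN iffD2]) (auto simp: mult.commute)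
  qed
  have gi: "integrable lborel g"
    using gauss[of 0] by (simp add: has_bochner_integral_iff)
  have inner: "(LBINT \<xi>. g \<xi> * K \<xi> x) =
      sqrt (2 * pi) ^ DIM('a) * (LBINT z. f (\<delta> *\<^sub>R z + x) * exp (- (norm z)\<^sup>2 / 2))" for x
  proof -
    have "(LBINT \<xi>. g \<xi> * K \<xi> x) = (LBINT y. f y * (LBINT \<xi>. g \<xi> * cos (\<xi> \<bullet> (x - y))))"
      unfolding K_def by (rule lborel_Fubini_bounded_kernel[OF gi f, of _ 1]) auto
    also have "\<dots> = (LBINT y. (sqrt (2 * pi) ^ DIM('a) / \<delta> ^ DIM('a)) * (f y * exp (- (norm ((x - y) /\<^sub>R \<delta>))\<^sup>2 / 2)))"
      using gauss by (intro Bochner_Integration.integral_cong) (auto simp: has_bochner_integral_iff)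
    also have "\<dots> = (sqrt (2 * pi) ^ DIM('a) / \<delta> ^ DIM('a)) * (LBINT y. f y * exp (- (norm ((x - y) /\<^sub>R \<delta>))\<^sup>2 / 2))"
      by simp
    \<comment> \<open>Substitution \<open>y = \<delta> *\<^sub>R z + x\<close>: the Jacobian cancels
      the factor \<open>1 / \<delta> ^ DIM('a)\<close>, and the remaining expression has a limit as
      \<delta> tends to \<open>0\<close>.\<close>
    also have "(LBINT y. f y * exp (- (norm ((x - y) /\<^sub>R \<delta>))\<^sup>2 / 2)) =
        (LBINT y. f (y + x) * exp (- (norm ((x - (y + x)) /\<^sub>R \<delta>))\<^sup>2 / 2))"
      by (rule lborel_integral_translate(2)[symmetric]) measurable
    also have "\<dots> = \<delta> ^ DIM('a) * (LBINT z. f (\<delta> *\<^sub>R z + x) * exp (- (norm ((x - (\<delta> *\<^sub>R z + x)) /\<^sub>R \<delta>))\<^sup>2 / 2))"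
      using d by (intro lborel_integral_scaleR(2)) auto
    also have "(\<lambda>z. f (\<delta> *\<^sub>R z + x) * exp (- (norm ((x - (\<delta> *\<^sub>R z + x)) /\<^sub>R \<delta>))\<^sup>2 / 2)) = (\<lambda>z. f (\<delta> *\<^sub>R z + x) * exp (- (norm z)\<^sup>2 / 2))"
      using d by (intro ext) simp
    finally show ?thesis using d by simp
  qed
  have "(LBINT \<xi>. g \<xi> * power_spectrum lborel f \<xi>) = (LBINT x. f x * (LBINT \<xi>. g \<xi> * K \<xi> x))"
    unfolding PS
  proof (rule lborel_Fubini_bounded_kernel[OF gi f _ Kb])
    show "(\<lambda>(\<xi>, x). K \<xi> x) \<in> borel_measurable (borel \<Otimes>\<^sub>M borel)" unfolding K_def by measurable
  qed
  also have "\<dots> = sqrt (2 * pi) ^ DIM('a) * (LBINT x. f x * (LBINT z. f (\<delta> *\<^sub>R z + x) * exp (- (norm z)\<^sup>2 / 2)))"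
    unfolding inner by (simp add: mult.left_commute[of "f _"])
  finally have e: "(LBINT \<xi>. g \<xi> * power_spectrum lborel f \<xi>) = \<dots>" .
  have "integrable lborel (\<lambda>\<xi>. g \<xi> * power_spectrum lborel f \<xi>)"
  proof (rule Bochner_Integration.integrable_bound)
    show "integrable lborel (\<lambda>\<xi>. (2 * m\<^sup>2) * g \<xi>)" using gi by simp
    have "power_spectrum lborel f \<xi> \<le> m\<^sup>2 + m\<^sup>2" for \<xi>
      unfolding power_spectrum_def
      by (intro add_mono power2_le_iff_abs_le[THEN iffD2] bdi(2)) (use bdi(2)[of "\<lambda>_. 0"] in auto)
    then have "g \<xi> * power_spectrum lborel f \<xi> \<le> g \<xi> * (2 * m\<^sup>2)" for \<xi>
      by (intro mult_left_mono) (auto simp: g_def)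
    then show "AE \<xi> in lborel. norm (g \<xi> * power_spectrum lborel f \<xi>) \<le> norm ((2 * m\<^sup>2) * g \<xi>)"
      by (auto simp: abs_mult g_def mult.commute)
  qed measurable
  with e show ?thesis by (simp add: has_bochner_integral_iff g_def)
qed

text \<open>Let the width of the Gaussian factor grow with \<open>\<delta> = 1 / (m + 1)\<close>. On
  the spectral side the integrands increase to the power spectrum; on the other side
  \<open>f\<close> averaged around \<open>x\<close> converges to \<open>f x\<close> by continuity,
  with the bounds of \<open>f\<close> as majorant. The two Gaussian integrals together contribute
  \<open>(2 * pi) ^ DIM('a)\<close>.\<close>

lemma parseval_continuous_compact_support:
  fixes f :: "'a::euclidean_space \<Rightarrow> real"
  assumes cont: "continuous_on UNIV f" and K: "compact K" "\<And>x. x \<notin> K \<Longrightarrow> f x = 0"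
  shows "(\<integral>\<^sup>+\<xi>. power_spectrum lborel f \<xi> \<partial>lborel) = ennreal ((2 * pi) ^ DIM('a) * (LBINT x. (f x)\<^sup>2))"
proof -
  have [measurable]: "f \<in> borel_measurable borel" using cont by (rule borel_measurable_continuous_onI)
  have fi: "integrable lborel f" by (rule integrable_continuous_compact_support[OF assms])
  obtain B where B: "B \<ge> 0" "\<And>x. \<bar>f x\<bar> \<le> B" using bounded_continuous_compact_support[OF assms] by blast
  let ?c = "sqrt (2 * pi) ^ DIM('a)"
  let ?e = "\<lambda>z::'a. exp (- (norm z)\<^sup>2 / 2)"
  have e: "has_bochner_integral lborel ?e ?c" using gaussian_fourier[of "0::'a"] by simp
  then have ei: "integrable lborel ?e" and eI: "(LBINT z. ?e z) = ?c" by (auto simp: has_bochner_integral_iff)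
  define d where "d m = 1 / real (Suc m)" for m
  have d0: "d m > 0" for m by (simp add: d_def)
  have dlim: "d \<longlonglongrightarrow> 0" unfolding d_def using LIMSEQ_inverse_real_of_nat by (simp add: inverse_eq_divide)
  let ?E = "\<lambda>m \<xi>. exp (- (norm (d m *\<^sub>R \<xi>))\<^sup>2 / 2) * power_spectrum lborel f \<xi>"
  define W where "W m x = (LBINT z. f (d m *\<^sub>R z + x) * ?e z)" for m x
  have ibd: "integrable lborel (\<lambda>z. f (d m *\<^sub>R z + x) * ?e z)" for m x
    by (rule Bochner_Integration.integrable_bound[OF integrable_mult_right[OF ei, of B]])
       (use B in \<open>auto simp: abs_mult intro!: mult_right_mono\<close>)
  have Wb: "\<bar>W m x\<bar> \<le> B * ?c" for m x
  proof -
    have "\<bar>W m x\<bar> \<le> (LBINT z. \<bar>f (d m *\<^sub>R z + x) * ?e z\<bar>)" unfolding W_def by (rule integral_abs_bound)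
    also have "\<dots> \<le> (LBINT z. B * ?e z)"
    proof (rule integral_mono)
      show "integrable lborel (\<lambda>z. \<bar>f (d m *\<^sub>R z + x) * ?e z\<bar>)" by (rule integrable_abs[OF ibd])
      show "integrable lborel (\<lambda>z. B * ?e z)" using ei by simp
    qed (use B in \<open>auto simp: abs_mult intro!: mult_right_mono\<close>)
    finally show ?thesis using eI by simp
  qed
  have Wlim: "(\<lambda>m. W m x) \<longlonglongrightarrow> f x * ?c" for x
  proof -
    have "(\<lambda>m. W m x) \<longlonglongrightarrow> (LBINT z. f x * ?e z)"
      unfolding W_def
    proof (rule integral_dominated_convergence)
      show "integrable lborel (\<lambda>z. B * ?e z)" using ei by simp
      show "AE z in lborel. norm (f (d m *\<^sub>R z + x) * ?e z) \<le> B * ?e z" for m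
        using B by (auto simp: abs_mult intro!: mult_right_mono)
      have "(\<lambda>m. f (d m *\<^sub>R z + x)) \<longlonglongrightarrow> f (0 *\<^sub>R z + x)" for z
        by (intro continuous_on_tendsto_compose[OF cont] tendsto_intros dlim) auto
      then show "AE z in lborel. (\<lambda>m. f (d m *\<^sub>R z + x) * ?e z) \<longlonglongrightarrow> f x * ?e z"
        by (auto intro!: tendsto_mult)
    qed measurable
    then show ?thesis using eI by simp
  qed
  have "(\<lambda>m. LBINT x. f x * W m x) \<longlonglongrightarrow> (LBINT x. f x * (f x * ?c))"
  proof (rule integral_dominated_convergence)
    show "integrable lborel (\<lambda>x. B * ?c * \<bar>f x\<bar>)" using fi by simp
    show "AE x in lborel. (\<lambda>m. f x * W m x) \<longlonglongrightarrow> f x * (f x * ?c)"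
      by (intro AE_I2 tendsto_mult tendsto_const Wlim)
    show "AE x in lborel. norm (f x * W m x) \<le> B * ?c * \<bar>f x\<bar>" for m
      using mult_left_mono[OF Wb abs_ge_zero] by (auto simp: abs_mult mult.commute)
    show "(\<lambda>x. f x * W m x) \<in> borel_measurable lborel" for m unfolding W_def by measurable
  qed measurable
  then have "(\<lambda>m. ennreal (?c * (LBINT x. f x * W m x))) \<longlonglongrightarrow> ennreal (?c * (LBINT x. f x * (f x * ?c)))"
    by (intro tendsto_ennrealI tendsto_mult tendsto_const)
  moreover have "?c * (LBINT x. f x * (f x * ?c)) = (2 * pi) ^ DIM('a) * (LBINT x. (f x)\<^sup>2)"
  proof -
    have "(LBINT x. f x * (f x * ?c)) = (LBINT x. ?c * (f x)\<^sup>2)"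
      by (intro Bochner_Integration.integral_cong) (auto simp: power2_eq_square)
    also have "\<dots> = ?c * (LBINT x. (f x)\<^sup>2)" by (rule integral_mult_right_zero)
    finally have "?c * (LBINT x. f x * (f x * ?c)) = (?c * ?c) * (LBINT x. (f x)\<^sup>2)"
      by (simp only: mult.assoc)
    moreover have "?c * ?c = (sqrt (2 * pi) * sqrt (2 * pi)) ^ DIM('a)" by (rule power_mult_distrib[symmetric])
    moreover have "sqrt (2 * pi) * sqrt (2 * pi) = 2 * pi" by simp
    ultimately show ?thesis by (simp only:)
  qed
  moreover have "ennreal (?c * (LBINT x. f x * W m x)) = (\<integral>\<^sup>+\<xi>. ?E m \<xi> \<partial>lborel)" for m
  proof -
    have "has_bochner_integral lborel (?E m) (?c * (LBINT x. f x * W m x))"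
      unfolding W_def by (rule gaussian_power_spectrum[OF fi d0])
    then show ?thesis by (subst nn_integral_eq_integral) (auto simp: has_bochner_integral_iff)
  qed
  ultimately have 1: "(\<lambda>m. \<integral>\<^sup>+\<xi>. ?E m \<xi> \<partial>lborel) \<longlonglongrightarrow> ennreal ((2 * pi) ^ DIM('a) * (LBINT x. (f x)\<^sup>2))"
    by simp
  have 2: "(\<lambda>m. \<integral>\<^sup>+\<xi>. ?E m \<xi> \<partial>lborel) \<longlonglongrightarrow> (\<integral>\<^sup>+\<xi>. power_spectrum lborel f \<xi> \<partial>lborel)"
  proof (rule nn_integral_LIMSEQ)
    \<comment> \<open>Monotone convergence is used here because integrability of the power spectrum
      is not yet known.\<close>
    show "incseq (\<lambda>m \<xi>. ennreal (?E m \<xi>))"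
    proof (intro incseq_SucI le_funI ennreal_leI mult_right_mono)
      fix m and \<xi> :: 'a
      have "d (Suc m) \<le> d m" by (simp add: d_def field_simps)
      then have "(norm (d (Suc m) *\<^sub>R \<xi>))\<^sup>2 \<le> (norm (d m *\<^sub>R \<xi>))\<^sup>2"
        using d0[of "Suc m"] by (intro power_mono) (auto intro!: mult_right_mono)
      then show "exp (- (norm (d m *\<^sub>R \<xi>))\<^sup>2 / 2) \<le> exp (- (norm (d (Suc m) *\<^sub>R \<xi>))\<^sup>2 / 2)" by simp
    qed simp
    show "(\<lambda>\<xi>. ennreal (?E m \<xi>)) \<in> borel_measurable lborel" for m by measurable
    show "(\<lambda>m. ennreal (?E m \<xi>)) \<longlonglongrightarrow> ennreal (power_spectrum lborel f \<xi>)" for \<xi>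
    proof (intro tendsto_ennrealI)
      have "(\<lambda>m. ?E m \<xi>) \<longlonglongrightarrow> exp (- (norm (0 *\<^sub>R \<xi>))\<^sup>2 / 2) * power_spectrum lborel f \<xi>"
        by (intro tendsto_intros dlim) auto
      then show "(\<lambda>m. ?E m \<xi>) \<longlonglongrightarrow> power_spectrum lborel f \<xi>" by simp
    qed
  qed
  show ?thesis by (rule LIMSEQ_unique[OF 2 1])
qed

subsection \<open>Parseval identity in the closure of the test functions\<close>

text \<open>Integration by parts against plane waves: a derivative becomes multiplication by
  \<open>\<xi> \<bullet> b\<close> and exchanges sine and cosine, so the power spectrum is
  multiplied by \<open>(\<xi> \<bullet> b)\<^sup>2\<close>.\<close>

lemma power_spectrum_partial_deriv:
  fixes \<phi> :: "'a::euclidean_space \<Rightarrow> real"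
  assumes \<phi>: "\<phi> \<in> test_functions \<Omega>" and b: "b \<in> Basis"
  shows "(LBINT x. partial_deriv b \<phi> x * cos (\<xi> \<bullet> x)) = (\<xi> \<bullet> b) * (LBINT x. \<phi> x * sin (\<xi> \<bullet> x))"
    and "(LBINT x. partial_deriv b \<phi> x * sin (\<xi> \<bullet> x)) = - (\<xi> \<bullet> b) * (LBINT x. \<phi> x * cos (\<xi> \<bullet> x))"
proof -
  have c: "((\<lambda>x. cos (\<xi> \<bullet> x)) has_derivative (\<lambda>h. - sin (\<xi> \<bullet> x) * (\<xi> \<bullet> h))) (at x)"
    and s: "((\<lambda>x. sin (\<xi> \<bullet> x)) has_derivative (\<lambda>h. cos (\<xi> \<bullet> x) * (\<xi> \<bullet> h))) (at x)" for x
    by (auto intro!: derivative_eq_intros simp: mult_ac)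
  have pc: "partial_deriv b (\<lambda>x. cos (\<xi> \<bullet> x)) = (\<lambda>x. - (\<xi> \<bullet> b) * sin (\<xi> \<bullet> x))"
    and ps: "partial_deriv b (\<lambda>x. sin (\<xi> \<bullet> x)) = (\<lambda>x. (\<xi> \<bullet> b) * cos (\<xi> \<bullet> x))"
    by (auto simp: partial_deriv_eq[OF c] partial_deriv_eq[OF s])
  have "(LBINT x. partial_deriv b \<phi> x * cos (\<xi> \<bullet> x)) = - (LBINT x. \<phi> x * (- (\<xi> \<bullet> b) * sin (\<xi> \<bullet> x)))"
    using integration_by_parts_test_function[where g="\<lambda>x. cos (\<xi> \<bullet> x)", OF \<phi> b differentiableI[OF c]]
    unfolding pc by (simp add: continuous_intros)
  then show "(LBINT x. partial_deriv b \<phi> x * cos (\<xi> \<bullet> x)) = (\<xi> \<bullet> b) * (LBINT x. \<phi> x * sin (\<xi> \<bullet> x))"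
    by (simp add: mult.left_commute[of "\<phi> _"])
  have "(LBINT x. partial_deriv b \<phi> x * sin (\<xi> \<bullet> x)) = - (LBINT x. \<phi> x * ((\<xi> \<bullet> b) * cos (\<xi> \<bullet> x)))"
    using integration_by_parts_test_function[where g="\<lambda>x. sin (\<xi> \<bullet> x)", OF \<phi> b differentiableI[OF s]]
    unfolding ps by (simp add: continuous_intros)
  then show "(LBINT x. partial_deriv b \<phi> x * sin (\<xi> \<bullet> x)) = - (\<xi> \<bullet> b) * (LBINT x. \<phi> x * cos (\<xi> \<bullet> x))"
    by (simp add: mult.left_commute[of "\<phi> _"])
qed

definition laplacian :: "('a::euclidean_space \<Rightarrow> real) \<Rightarrow> 'a \<Rightarrow> real" where
  "laplacian \<phi> x = (\<Sum>b\<in>Basis. partial_deriv b (partial_deriv b \<phi>) x)"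

lemma test_functions_sum:
  assumes "finite A" "A \<noteq> {}" "\<And>i. i \<in> A \<Longrightarrow> f i \<in> test_functions \<Omega>"
  shows "(\<lambda>x. \<Sum>i\<in>A. f i x) \<in> test_functions \<Omega>"
  using assms by (induction A rule: finite_ne_induct) (auto intro: test_functions_add)

lemma test_functions_laplacian: "\<phi> \<in> test_functions \<Omega> \<Longrightarrow> laplacian \<phi> \<in> test_functions \<Omega>"
  unfolding laplacian_def[abs_def] by (intro test_functions_sum test_functions_partial_deriv) auto

lemma parseval_test_function:
  fixes \<phi> :: "'a::euclidean_space \<Rightarrow> real"
  assumes \<phi>: "\<phi> \<in> test_functions \<Omega>"
  shows "(\<integral>\<^sup>+\<xi>. power_spectrum lborel \<phi> \<xi> \<partial>lborel) = ennreal ((2 * pi) ^ DIM('a) * (LBINT x. (\<phi> x)\<^sup>2))"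
  by (rule parseval_continuous_compact_support[OF test_functionsD(5,2)[OF \<phi>]]) (use test_functionsD(7)[OF \<phi>] in blast)

lemma parseval_gradient:
  fixes \<phi> :: "'a::euclidean_space \<Rightarrow> real"
  assumes \<phi>: "\<phi> \<in> test_functions \<Omega>"
  shows "(\<integral>\<^sup>+\<xi>. (norm \<xi>)\<^sup>2 * power_spectrum lborel \<phi> \<xi> \<partial>lborel) =
    ennreal ((2 * pi) ^ DIM('a) * (\<Sum>b\<in>Basis. LBINT x. (partial_deriv b \<phi> x)\<^sup>2))"
proof -
  have [measurable]: "\<phi> \<in> borel_measurable borel" by (rule test_functionsD(6)[OF \<phi>])
  have ps: "power_spectrum lborel (partial_deriv b \<phi>) \<xi> = (\<xi> \<bullet> b)\<^sup>2 * power_spectrum lborel \<phi> \<xi>" if "b \<in> Basis" for b \<xi>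
    unfolding power_spectrum_def power_spectrum_partial_deriv[OF \<phi> that] by (simp add: power_mult_distrib algebra_simps)
  have "(\<integral>\<^sup>+\<xi>. (norm \<xi>)\<^sup>2 * power_spectrum lborel \<phi> \<xi> \<partial>lborel) =
    (\<integral>\<^sup>+\<xi>. (\<Sum>b\<in>Basis. ennreal (power_spectrum lborel (partial_deriv b \<phi>) \<xi>)) \<partial>lborel)"
    by (intro nn_integral_cong) (simp add: ps norm_sq_eq_sum_Basis sum_distrib_right sum_nonneg)
  also have "\<dots> = (\<Sum>b\<in>Basis. \<integral>\<^sup>+\<xi>. power_spectrum lborel (partial_deriv b \<phi>) \<xi> \<partial>lborel)"
  proof (rule nn_integral_sum)
    fix b :: 'a assume "b \<in> Basis"
    then have "power_spectrum lborel (partial_deriv b \<phi>) \<in> borel_measurable lborel"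
      using borel_measurable_power_spectrum[OF test_functionsD(6)[OF test_functions_partial_deriv[OF \<phi>]]] by simp
    then show "(\<lambda>\<xi>. ennreal (power_spectrum lborel (partial_deriv b \<phi>) \<xi>)) \<in> borel_measurable lborel"
      by measurable
  qed
  also have "\<dots> = (\<Sum>b\<in>Basis. ennreal ((2 * pi) ^ DIM('a) * (LBINT x. (partial_deriv b \<phi> x)\<^sup>2)))"
    by (intro sum.cong refl parseval_test_function[OF test_functions_partial_deriv[OF \<phi>]])
  also have "\<dots> = ennreal ((2 * pi) ^ DIM('a) * (\<Sum>b\<in>Basis. LBINT x. (partial_deriv b \<phi> x)\<^sup>2))"
    unfolding sum_distrib_left by (intro sum_ennreal) auto
  finally show ?thesis .
qed

text \<open>Two integrations by parts in each direction restore the original trigonometric function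
  with factor \<open>- (\<xi> \<bullet> b)\<^sup>2\<close>; summed over the basis this is
  \<open>- (norm \<xi>)\<^sup>2\<close>, whose square is the weight.\<close>

lemma parseval_laplacian:
  fixes \<phi> :: "'a::euclidean_space \<Rightarrow> real"
  assumes \<phi>: "\<phi> \<in> test_functions \<Omega>"
  shows "(\<integral>\<^sup>+\<xi>. norm \<xi> ^ 4 * power_spectrum lborel \<phi> \<xi> \<partial>lborel) =
    ennreal ((2 * pi) ^ DIM('a) * (LBINT x. (laplacian \<phi> x)\<^sup>2))"
proof -
  note d = test_functions_partial_deriv[OF \<phi>]
  note dd = test_functions_partial_deriv[OF d]
  have C: "(LBINT x. laplacian \<phi> x * cos (\<xi> \<bullet> x)) = - (norm \<xi>)\<^sup>2 * (LBINT x. \<phi> x * cos (\<xi> \<bullet> x))" for \<xi>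
  proof -
    have "(LBINT x. laplacian \<phi> x * cos (\<xi> \<bullet> x)) = (\<Sum>b\<in>Basis. LBINT x. partial_deriv b (partial_deriv b \<phi>) x * cos (\<xi> \<bullet> x))"
      unfolding laplacian_def sum_distrib_right
      by (intro Bochner_Integration.integral_sum integrable_test_function_mult[OF dd] continuous_intros)
    also have "\<dots> = (\<Sum>b\<in>Basis. - (\<xi> \<bullet> b)\<^sup>2 * (LBINT x. \<phi> x * cos (\<xi> \<bullet> x)))"
      by (intro sum.cong refl) (simp add: power_spectrum_partial_deriv[OF d] power_spectrum_partial_deriv[OF \<phi>] power2_eq_square)
    finally show ?thesis by (simp add: norm_sq_eq_sum_Basis sum_distrib_right sum_negf)
  qed
  have S: "(LBINT x. laplacian \<phi> x * sin (\<xi> \<bullet> x)) = - (norm \<xi>)\<^sup>2 * (LBINT x. \<phi> x * sin (\<xi> \<bullet> x))" for \<xi>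
  proof -
    have "(LBINT x. laplacian \<phi> x * sin (\<xi> \<bullet> x)) = (\<Sum>b\<in>Basis. LBINT x. partial_deriv b (partial_deriv b \<phi>) x * sin (\<xi> \<bullet> x))"
      unfolding laplacian_def sum_distrib_right
      by (intro Bochner_Integration.integral_sum integrable_test_function_mult[OF dd] continuous_intros)
    also have "\<dots> = (\<Sum>b\<in>Basis. - (\<xi> \<bullet> b)\<^sup>2 * (LBINT x. \<phi> x * sin (\<xi> \<bullet> x)))"
      by (intro sum.cong refl) (simp add: power_spectrum_partial_deriv[OF d] power_spectrum_partial_deriv[OF \<phi>] power2_eq_square)
    finally show ?thesis by (simp add: norm_sq_eq_sum_Basis sum_distrib_right sum_negf)
  qed
  have "power_spectrum lborel (laplacian \<phi>) \<xi> = norm \<xi> ^ 4 * power_spectrum lborel \<phi> \<xi>" for \<xi>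
    unfolding power_spectrum_def C S by (simp add: power_mult_distrib distrib_left flip: power_mult)
  then show ?thesis using parseval_test_function[OF test_functions_laplacian[OF \<phi>]] by simp
qed

context bounded_open
begin

lemma integral_Cauchy_Schwarz:
  assumes f: "f \<in> L2 \<Omega>" and g: "g \<in> L2 \<Omega>"
  shows "(LINT x|M. f x * g x)\<^sup>2 \<le> (LINT x|M. (f x)\<^sup>2) * (LINT x|M. (g x)\<^sup>2)"
proof -
  define A B D where "A = (LINT x|M. f x * f x)" and "B = (LINT x|M. f x * g x)"
    and "D = (LINT x|M. g x * g x)"
  have D: "D \<ge> 0" by (simp add: D_def)
  have "B\<^sup>2 \<le> A * D"
  proof (cases "D = 0")
    case True
    then have "AE x in M. g x * g x = 0"
      unfolding D_def using L2_mult_integrable[OF g g] by (subst (asm) integral_nonneg_eq_0_iff_AE) auto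
    then have "AE x in M. g x = 0" by eventually_elim simp
    then have "B = (LINT x|M. f x * 0)"
      unfolding B_def using L2_continuous[of "\<lambda>_. 0"]
      by (intro integral_mult_cong_AE[OF f f g]) auto
    then show ?thesis using True by simp
  next
    case False
    \<comment> \<open>\<open>D\<close> times the component of \<open>f\<close> orthogonal to
      \<open>g\<close>; its squared norm is \<open>D * (A * D - B\<^sup>2)\<close>.\<close>
    let ?h = "\<lambda>x. D * f x + (- B) * g x"
    have h: "?h \<in> L2 \<Omega>" by (rule L2_lin[OF f g])
    have "0 \<le> (LINT x|M. ?h x * ?h x)" by simp
    also have "\<dots> = D * (LINT x|M. f x * ?h x) + (- B) * (LINT x|M. g x * ?h x)"
      by (rule integral_add_mult[OF f g h])
    also have "(LINT x|M. f x * ?h x) = D * A + (- B) * B"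
      using integral_add_mult[OF f g f, of D "- B"] by (simp add: A_def B_def mult.commute)
    also have "(LINT x|M. g x * ?h x) = D * B + (- B) * D"
      using integral_add_mult[OF f g g, of D "- B"] by (simp add: B_def D_def mult.commute)
    finally have "0 \<le> D * (A * D - B\<^sup>2)" by (simp add: algebra_simps power2_eq_square)
    then show ?thesis using False D by (simp add: zero_le_mult_iff)
  qed
  then show ?thesis by (simp add: A_def B_def D_def power2_eq_square)
qed

lemma L2_to_0_integral_mult:
  assumes f: "\<And>m. f m \<in> L2 \<Omega>" "u \<in> L2 \<Omega>" "L2_to_0 (\<lambda>m x. f m x - u x)" and g: "g \<in> L2 \<Omega>"
  shows "(\<lambda>m. LINT x|M. f m x * g x) \<longlonglongrightarrow> (LINT x|M. u x * g x)"
proof -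
  have d: "(\<lambda>x. f m x - u x) \<in> L2 \<Omega>" for m using L2_lin[OF f(1,2), where \<alpha>=1 and \<beta>="-1"] by simp
  have "(\<lambda>m. (LINT x|M. (f m x - u x) * g x)\<^sup>2) \<longlonglongrightarrow> 0"
  proof (rule real_tendsto_sandwich[OF always_eventually always_eventually tendsto_const, rule_format])
    show "(LINT x|M. (f m x - u x) * g x)\<^sup>2 \<le>
      (LINT x|M. (f m x - u x)\<^sup>2) * (LINT x|M. (g x)\<^sup>2)" for m
      by (rule integral_Cauchy_Schwarz[OF d g])
    show "(\<lambda>m. (LINT x|M. (f m x - u x)\<^sup>2) * (LINT x|M. (g x)\<^sup>2)) \<longlonglongrightarrow> 0"
      using f(3) unfolding L2_to_0_def by (intro tendsto_mult_left_zero)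
  qed simp
  then have "(\<lambda>m. sqrt ((LINT x|M. (f m x - u x) * g x)\<^sup>2)) \<longlonglongrightarrow> sqrt 0" by (rule tendsto_real_sqrt)
  then have "(\<lambda>m. LINT x|M. (f m x - u x) * g x) \<longlonglongrightarrow> 0" by (simp add: tendsto_rabs_zero_iff)
  moreover have "(LINT x|M. (f m x - u x) * g x) = (LINT x|M. f m x * g x) - (LINT x|M. u x * g x)" for m
    using integral_add_mult[OF f(1)[of m] f(2) g, of 1 "-1"] by simp
  ultimately show ?thesis using LIM_zero_iff[of "\<lambda>m. LINT x|M. f m x * g x"] by simp
qed

lemma L2_to_0_norm:
  assumes f: "\<And>m. f m \<in> L2 \<Omega>" "u \<in> L2 \<Omega>" "L2_to_0 (\<lambda>m x. f m x - u x)"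
  shows "(\<lambda>m. LINT x|M. (f m x)\<^sup>2) \<longlonglongrightarrow> (LINT x|M. (u x)\<^sup>2)"
proof -
  have d: "(\<lambda>x. f m x - u x) \<in> L2 \<Omega>" for m using L2_lin[OF f(1,2), where \<alpha>=1 and \<beta>="-1"] by simp
  have "(LINT x|M. (f m x)\<^sup>2) = (LINT x|M. (f m x - u x)\<^sup>2) +
     2 * (LINT x|M. f m x * u x) - (LINT x|M. u x * u x)" for m
  proof -
    have "(LINT x|M. (f m x)\<^sup>2) = (LINT x|M. ((f m x - u x)\<^sup>2 + 2 * (f m x * u x)) - u x * u x)"
      by (intro Bochner_Integration.integral_cong) (auto simp: power2_eq_square algebra_simps)
    then show ?thesis using L2_D(2)[OF d] L2_mult_integrable f(1,2) by simp
  qed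
  moreover have "(\<lambda>m. (LINT x|M. (f m x - u x)\<^sup>2) +
     2 * (LINT x|M. f m x * u x) - (LINT x|M. u x * u x)) \<longlonglongrightarrow>
     0 + 2 * (LINT x|M. u x * u x) - (LINT x|M. u x * u x)"
    by (intro tendsto_add tendsto_diff tendsto_mult tendsto_const f(3)[unfolded L2_to_0_def]
        L2_to_0_integral_mult[OF assms f(2)])
  ultimately show ?thesis by (simp add: power2_eq_square)
qed

lemma power_spectrum_test_function:
  assumes \<phi>: "\<phi> \<in> test_functions \<Omega>"
  shows "power_spectrum M \<phi> \<xi> = power_spectrum lborel \<phi> \<xi>"
proof -
  note [measurable] = test_functionsD(6)[OF \<phi>]
  have "(LINT x|M. \<phi> x * cos (\<xi> \<bullet> x)) = (LBINT x. \<phi> x * cos (\<xi> \<bullet> x))"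
    "(LINT x|M. \<phi> x * sin (\<xi> \<bullet> x)) = (LBINT x. \<phi> x * sin (\<xi> \<bullet> x))"
    by (rule integral_M_borel; use test_functionsD(8)[OF \<phi>] in simp)+
  then show ?thesis by (simp add: power_spectrum_def)
qed

lemma L2_cos_sin: "(\<lambda>x. cos (\<xi> \<bullet> x)) \<in> L2 \<Omega>" "(\<lambda>x. sin (\<xi> \<bullet> x)) \<in> L2 \<Omega>"
  by (intro L2_continuous continuous_intros)+

lemma power_spectrum_tendsto:
  assumes f: "\<And>m. f m \<in> L2 \<Omega>" "u \<in> L2 \<Omega>" "L2_to_0 (\<lambda>m x. f m x - u x)"
  shows "(\<lambda>m. power_spectrum M (f m) \<xi>) \<longlonglongrightarrow> power_spectrum M u \<xi>"
  unfolding power_spectrum_def by (intro tendsto_intros L2_to_0_integral_mult assms L2_cos_sin)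

text \<open>\<open>u\<close> itself is only Lebesgue measurable on \<open>\<Omega>\<close>, so
  measurability in \<xi> is obtained from the Borel test functions, whose power spectra converge
  pointwise.\<close>

lemma power_spectrum_measurable:
  assumes \<phi>: "\<And>m. \<phi> m \<in> test_functions \<Omega>" and u: "u \<in> L2 \<Omega>" "L2_to_0 (\<lambda>m x. \<phi> m x - u x)"
  shows "power_spectrum M u \<in> borel_measurable borel"
proof (rule borel_measurable_LIMSEQ_real)
  show "(\<lambda>m. power_spectrum lborel (\<phi> m) \<xi>) \<longlonglongrightarrow> power_spectrum M u \<xi>" for \<xi>
    using power_spectrum_tendsto[OF L2_test_function[OF \<phi>] u] by (simp add: power_spectrum_test_function[OF \<phi>])
  show "power_spectrum lborel (\<phi> m) \<in> borel_measurable borel" for m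
    by (rule borel_measurable_power_spectrum[OF test_functionsD(6)[OF \<phi>]])
qed

text \<open>Fatou's lemma for the pointwise convergent power spectra. The weight covers both uses:
  \<open>1\<close> for the mass and \<open>norm \<xi> ^ 4 + a * (norm \<xi>)\<^sup>2\<close> for the
  energy.\<close>

lemma nn_integral_power_spectrum_le:
  assumes \<phi>: "\<And>m. \<phi> m \<in> test_functions \<Omega>" and u: "u \<in> L2 \<Omega>" "L2_to_0 (\<lambda>m x. \<phi> m x - u x)"
    and [measurable]: "w \<in> borel_measurable borel" and w: "\<And>\<xi>. w \<xi> \<ge> 0"
    and lim: "(\<lambda>m. \<integral>\<^sup>+\<xi>. ennreal (w \<xi> * power_spectrum lborel (\<phi> m) \<xi>) \<partial>lborel) \<longlonglongrightarrow> X"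
  shows "(\<integral>\<^sup>+\<xi>. ennreal (w \<xi> * power_spectrum M u \<xi>) \<partial>lborel) \<le> X"
proof -
  have [measurable]: "power_spectrum lborel (\<phi> m) \<in> borel_measurable borel" for m
    by (rule borel_measurable_power_spectrum[OF test_functionsD(6)[OF \<phi>]])
  have "(\<lambda>m. ennreal (w \<xi> * power_spectrum lborel (\<phi> m) \<xi>)) \<longlonglongrightarrow> ennreal (w \<xi> * power_spectrum M u \<xi>)" for \<xi>
    using power_spectrum_tendsto[OF L2_test_function[OF \<phi>] u]
    by (intro tendsto_ennrealI tendsto_mult tendsto_const) (simp add: power_spectrum_test_function[OF \<phi>])
  then have "(\<integral>\<^sup>+\<xi>. ennreal (w \<xi> * power_spectrum M u \<xi>) \<partial>lborel) =
    (\<integral>\<^sup>+\<xi>. liminf (\<lambda>m. ennreal (w \<xi> * power_spectrum lborel (\<phi> m) \<xi>)) \<partial>lborel)"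
    by (intro nn_integral_cong lim_imp_Liminf[symmetric]) auto
  also have "\<dots> \<le> liminf (\<lambda>m. \<integral>\<^sup>+\<xi>. ennreal (w \<xi> * power_spectrum lborel (\<phi> m) \<xi>) \<partial>lborel)"
    by (intro nn_integral_liminf) measurable
  also have "\<dots> = X" using lim by (intro lim_imp_Liminf) auto
  finally show ?thesis .
qed

lemma integral_M_test_function_sq:
  assumes "\<phi> \<in> test_functions \<Omega>"
  shows "(LBINT x. (\<phi> x)\<^sup>2) = (LINT x|M. (\<phi> x)\<^sup>2)"
  using integral_M_borel[of "\<lambda>x. (\<phi> x)\<^sup>2"] test_functionsD(6,8)[OF assms] by simp

lemma parseval_le:
  assumes \<phi>: "\<And>m. \<phi> m \<in> test_functions \<Omega>" and u: "u \<in> L2 \<Omega>" "L2_to_0 (\<lambda>m x. \<phi> m x - u x)"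
  shows "(\<integral>\<^sup>+\<xi>. power_spectrum M u \<xi> \<partial>lborel) \<le> ennreal ((2 * pi) ^ DIM('a) * (LINT x|M. (u x)\<^sup>2))"
proof -
  have "(\<lambda>m. \<integral>\<^sup>+\<xi>. ennreal (1 * power_spectrum lborel (\<phi> m) \<xi>) \<partial>lborel) \<longlonglongrightarrow>
      ennreal ((2 * pi) ^ DIM('a) * (LINT x|M. (u x)\<^sup>2))"
    unfolding mult_1 parseval_test_function[OF \<phi>] integral_M_test_function_sq[OF \<phi>]
    by (intro tendsto_ennrealI tendsto_mult tendsto_const L2_to_0_norm L2_test_function \<phi> u)
  from nn_integral_power_spectrum_le[OF \<phi> u _ _ this] show ?thesis by simp
qed

text \<open>Young's inequality with a parameter: for small \<open>t\<close> the first summand is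
  hardly enlarged, while the large factor on the second does no harm if that summand tends to
  \<open>0\<close>.\<close>

lemma power_spectrum_add_le:
  assumes "f \<in> L2 \<Omega>" "g \<in> L2 \<Omega>" and t: "t > 0"
  shows "power_spectrum M (\<lambda>x. f x + g x) \<xi> \<le>
    (1 + t) * power_spectrum M f \<xi> + (1 + 1 / t) * power_spectrum M g \<xi>"
proof -
  have *: "(p + q)\<^sup>2 \<le> (1 + t) * p\<^sup>2 + (1 + 1 / t) * q\<^sup>2" for p q :: real
  proof -
    have "(1 + t) * p\<^sup>2 + (1 + 1 / t) * q\<^sup>2 - (p + q)\<^sup>2 = (t * p - q)\<^sup>2 / t"
      using t by (simp add: field_simps power2_eq_square)
    moreover have "\<dots> \<ge> 0" using t by simp
    ultimately show ?thesis by linarith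
  qed
  show ?thesis
    using *[of "LINT x|M. f x * cos (\<xi> \<bullet> x)" "LINT x|M. g x * cos (\<xi> \<bullet> x)"]
      *[of "LINT x|M. f x * sin (\<xi> \<bullet> x)" "LINT x|M. g x * sin (\<xi> \<bullet> x)"]
      integral_add_mult[OF assms(1,2) L2_cos_sin(1), of 1 1 \<xi>] integral_add_mult[OF assms(1,2) L2_cos_sin(2), of 1 1 \<xi>]
    by (simp add: power_spectrum_def distrib_left)
qed

text \<open>Fatou gives one direction. For the other, \<open>\<phi> m\<close> is split into
  \<open>u\<close> and the remainder \<open>\<phi> m - u\<close>, which is itself a limit of the
  test functions \<open>\<phi> m - \<phi> l\<close>, so that the direction already known bounds its
  spectrum by its norm. First \<open>m\<close> tends to infinity, then \<open>t\<close> to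
  \<open>0\<close>.\<close>

lemma parseval:
  assumes \<phi>: "\<And>m. \<phi> m \<in> test_functions \<Omega>" and u: "u \<in> L2 \<Omega>" "L2_to_0 (\<lambda>m x. \<phi> m x - u x)"
  shows "(\<integral>\<^sup>+\<xi>. power_spectrum M u \<xi> \<partial>lborel) = ennreal ((2 * pi) ^ DIM('a) * (LINT x|M. (u x)\<^sup>2))"
proof (rule antisym[OF parseval_le[OF assms]])
  let ?c = "(2 * pi) ^ DIM('a)"
  let ?P = "power_spectrum M"
  note [measurable] = power_spectrum_measurable[OF \<phi> u]
  note \<phi>2 = L2_test_function[OF \<phi>]
  obtain P where P: "(\<integral>\<^sup>+\<xi>. ?P u \<xi> \<partial>lborel) = ennreal P" "P \<ge> 0"
    using parseval_le[OF assms] by (cases "\<integral>\<^sup>+\<xi>. ?P u \<xi> \<partial>lborel") (auto simp: top_unique)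
  have key: "?c * (LINT x|M. (\<phi> m x)\<^sup>2) \<le> (1 + t) * P + (1 + 1 / t) * (?c * (LINT x|M. (\<phi> m x - u x)\<^sup>2))"
    if t: "t > 0" for m t
  proof -
    let ?r = "\<lambda>x. \<phi> m x - u x"
    have r: "?r \<in> L2 \<Omega>" using L2_lin[OF \<phi>2 u(1), where \<alpha>=1 and \<beta>="-1"] by simp
    have psi: "(\<lambda>x. \<phi> m x - \<phi> l x) \<in> test_functions \<Omega>" for l
      using test_functions_add[OF \<phi>[of m] test_functions_cmult[OF \<phi>[of l], of "-1"]] by simp
    have psi0: "L2_to_0 (\<lambda>l x. (\<phi> m x - \<phi> l x) - ?r x)"
    proof -
      have "(\<lambda>l. LINT x|M. ((\<phi> m x - \<phi> l x) - ?r x)\<^sup>2) = (\<lambda>l. LINT x|M. (\<phi> l x - u x)\<^sup>2)"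
        by (simp add: power2_commute)
      then show ?thesis using u(2) by (simp add: L2_to_0_def)
    qed
    have Pr: "(\<integral>\<^sup>+\<xi>. ?P ?r \<xi> \<partial>lborel) \<le> ennreal (?c * (LINT x|M. (?r x)\<^sup>2))"
      by (rule parseval_le[OF psi r psi0])
    have [measurable]: "?P ?r \<in> borel_measurable borel" by (rule power_spectrum_measurable[OF psi r psi0])
    have "ennreal (?c * (LINT x|M. (\<phi> m x)\<^sup>2)) = (\<integral>\<^sup>+\<xi>. ?P (\<phi> m) \<xi> \<partial>lborel)"
      using parseval_test_function[OF \<phi>[of m]] by (simp add: integral_M_test_function_sq[OF \<phi>] power_spectrum_test_function[OF \<phi>])
    also have "\<dots> \<le> (\<integral>\<^sup>+\<xi>. ennreal (1 + t) * ennreal (?P u \<xi>) + ennreal (1 + 1 / t) * ennreal (?P ?r \<xi>) \<partial>lborel)"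
    proof (intro nn_integral_mono)
      fix \<xi>
      show "ennreal (?P (\<phi> m) \<xi>) \<le> ennreal (1 + t) * ennreal (?P u \<xi>) + ennreal (1 + 1 / t) * ennreal (?P ?r \<xi>)"
        using power_spectrum_add_le[OF u(1) r t, of \<xi>] t
        by (simp add: ennreal_mult[symmetric] ennreal_plus[symmetric] del: ennreal_plus)
    qed
    also have "\<dots> = ennreal (1 + t) * ennreal P + ennreal (1 + 1 / t) * (\<integral>\<^sup>+\<xi>. ?P ?r \<xi> \<partial>lborel)"
      unfolding P(1)[symmetric] by (subst nn_integral_add; (subst nn_integral_cmult)?) (auto simp: nn_integral_cmult)
    also have "\<dots> \<le> ennreal (1 + t) * ennreal P + ennreal (1 + 1 / t) * ennreal (?c * (LINT x|M. (?r x)\<^sup>2))"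
      by (intro add_left_mono mult_left_mono Pr) auto
    also have "\<dots> = ennreal ((1 + t) * P + (1 + 1 / t) * (?c * (LINT x|M. (?r x)\<^sup>2)))"
      using t P(2) by (simp add: ennreal_mult[symmetric] ennreal_plus[symmetric] del: ennreal_plus)
    finally show ?thesis using t P(2) by (subst (asm) ennreal_le_iff) auto
  qed
  have key2: "?c * (LINT x|M. (u x)\<^sup>2) \<le> (1 + t) * P" if t: "t > 0" for t
  proof (rule LIMSEQ_le)
    show "(\<lambda>m. ?c * (LINT x|M. (\<phi> m x)\<^sup>2)) \<longlonglongrightarrow> ?c * (LINT x|M. (u x)\<^sup>2)"
      by (intro tendsto_mult tendsto_const L2_to_0_norm \<phi>2 u)
    have "(\<lambda>m. (1 + t) * P + (1 + 1 / t) * (?c * (LINT x|M. (\<phi> m x - u x)\<^sup>2))) \<longlonglongrightarrow> (1 + t) * P + (1 + 1 / t) * (?c * 0)"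
      using u(2) unfolding L2_to_0_def by (intro tendsto_intros)
    then show "(\<lambda>m. (1 + t) * P + (1 + 1 / t) * (?c * (LINT x|M. (\<phi> m x - u x)\<^sup>2))) \<longlonglongrightarrow> (1 + t) * P" by simp
  qed (use key[OF t] in blast)
  have "?c * (LINT x|M. (u x)\<^sup>2) \<le> P"
  proof (rule field_le_epsilon)
    fix e :: real assume e: "e > 0"
    \<comment> \<open>The parameter \<open>t = e / (P + 1)\<close> makes \<open>t * P\<close> at
      most \<open>e\<close>, also when \<open>P = 0\<close>.\<close>
    have "e / (P + 1) * P \<le> e" using e P(2) by (simp add: field_simps)
    then show "?c * (LINT x|M. (u x)\<^sup>2) \<le> P + e"
      using key2[of "e / (P + 1)"] e P(2) by (simp add: distrib_right)
  qed
  then show "ennreal (?c * (LINT x|M. (u x)\<^sup>2)) \<le> (\<integral>\<^sup>+\<xi>. ?P u \<xi> \<partial>lborel)"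
    unfolding P(1) by (rule ennreal_leI)
qed

end

subsection \<open>Estimates for the spectral density\<close>

context bounded_open
begin

lemma L2_to_0_sum:
  assumes "finite A" "\<And>i m. i \<in> A \<Longrightarrow> f i m \<in> L2 \<Omega>" "\<And>i. i \<in> A \<Longrightarrow> L2_to_0 (f i)"
  shows "L2_to_0 (\<lambda>m x. \<Sum>i\<in>A. f i m x)"
  using assms
proof (induction A rule: finite_induct)
  case empty
  then show ?case by (simp add: L2_to_0_def)
next
  case (insert i A)
  have 1: "L2_to_0 (\<lambda>m x. \<Sum>i\<in>A. f i m x)" using insert by blast
  have 2: "(\<lambda>x. \<Sum>i\<in>A. f i m x) \<in> L2 \<Omega>" for m
    using L2_sum[of A "\<lambda>i. f i m" "\<lambda>_. 1"] insert by simp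
  have 3: "(\<lambda>x. \<Sum>i\<in>insert i A. f i m x) \<in> L2 \<Omega>" for m
    using L2_sum[of "insert i A" "\<lambda>i. f i m" "\<lambda>_. 1"] insert by simp
  have 4: "f i m \<in> L2 \<Omega>" for m using insert by simp
  have 5: "L2_to_0 (f i)" using insert by simp
  show ?case
    by (rule L2_to_0_lin[OF 4 5 2 1 3, where \<alpha>=1 and \<beta>=1]) (use insert in simp)
qed

text \<open>For test functions the weighted integral of the power spectrum equals the energy up to
  the constant. The energies converge along the approximating sequence, since the relevant
  derivatives converge in \<open>L2\<close>, and Fatou's lemma keeps one inequality in the
  limit.\<close>

lemma energy_ge:
  assumes u: "u \<in> H2_0 \<Omega>" and a: "a \<ge> 0"
  shows "(\<integral>\<^sup>+\<xi>. (norm \<xi> ^ 4 + a * (norm \<xi>)\<^sup>2) * power_spectrum M u \<xi> \<partial>lborel)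
    \<le> ennreal ((2 * pi) ^ DIM('a) * energy a u u)"
proof -
  let ?c = "(2 * pi) ^ DIM('a)"
  have u2: "u \<in> H2 \<Omega>" by (rule H2_0_H2[OF u])
  obtain \<phi> where \<phi>: "\<And>m::nat. \<phi> m \<in> test_functions \<Omega>" and c0: "L2_to_0 (\<lambda>m x. \<phi> m x - u x)"
    and c1: "\<And>b. b \<in> Basis \<Longrightarrow> L2_to_0 (\<lambda>m. weak_deriv \<Omega> b (\<lambda>x. \<phi> m x - u x))"
    and c2: "\<And>b c. b \<in> Basis \<Longrightarrow> c \<in> Basis \<Longrightarrow> L2_to_0 (\<lambda>m. weak_deriv \<Omega> c (weak_deriv \<Omega> b (\<lambda>x. \<phi> m x - u x)))"
    using H2_0_D[OF u] by blast
  note d\<phi> = test_functions_partial_deriv[OF \<phi>] and l\<phi> = test_functions_laplacian[OF \<phi>]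
  have [measurable]: "power_spectrum lborel (\<phi> m) \<in> borel_measurable borel" for m
    by (rule borel_measurable_power_spectrum[OF test_functionsD(6)[OF \<phi>]])
  have w: "(\<lambda>x. \<phi> m x - u x) \<in> H2 \<Omega>" for m by (rule H2_diff(1)[OF H2_test_function(1)[OF \<phi>] u2])
  have L2d: "(\<lambda>x. f x - g x) \<in> L2 \<Omega>" if "f \<in> L2 \<Omega>" "g \<in> L2 \<Omega>" for f g
    using L2_lin[OF that, where \<alpha>=1 and \<beta>="-1"] by simp
  \<comment> \<open>Classical derivatives of \<open>\<phi> m\<close> replace weak ones here, since
    Parseval speaks of classical derivatives. The two agree almost everywhere, and the
    linear-combination rule with coefficients \<open>1\<close> and \<open>0\<close> absorbs the
    difference.\<close>
  have l1: "L2_to_0 (\<lambda>m x. partial_deriv b (\<phi> m) x - weak_deriv \<Omega> b u x)" if b: "b \<in> Basis" for b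
  proof (rule L2_to_0_lin[OF H2_L2(2)[OF w b] c1[OF b] H2_L2(2)[OF w b] c1[OF b], where \<alpha>=1 and \<beta>=0])
    fix m
    show "(\<lambda>x. partial_deriv b (\<phi> m) x - weak_deriv \<Omega> b u x) \<in> L2 \<Omega>"
      by (intro L2d L2_test_function[OF d\<phi>] H2_L2(2)[OF u2] b)
    show "AE x in M. partial_deriv b (\<phi> m) x - weak_deriv \<Omega> b u x =
       1 * weak_deriv \<Omega> b (\<lambda>x. \<phi> m x - u x) x + 0 * weak_deriv \<Omega> b (\<lambda>x. \<phi> m x - u x) x"
      using H2_diff(2)[OF H2_test_function(1)[OF \<phi>[of m]] u2 b] H2_test_function(2)[OF \<phi>[of m] b]
      by eventually_elim simp
  qed
  have l2: "L2_to_0 (\<lambda>m x. partial_deriv b (partial_deriv b (\<phi> m)) x - weak_deriv \<Omega> b (weak_deriv \<Omega> b u) x)" if b: "b \<in> Basis" for b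
  proof (rule L2_to_0_lin[OF H2_L2(3)[OF w b b] c2[OF b b] H2_L2(3)[OF w b b] c2[OF b b], where \<alpha>=1 and \<beta>=0])
    fix m
    show "(\<lambda>x. partial_deriv b (partial_deriv b (\<phi> m)) x - weak_deriv \<Omega> b (weak_deriv \<Omega> b u) x) \<in> L2 \<Omega>"
      by (intro L2d L2_test_function[OF test_functions_partial_deriv[OF d\<phi>]] H2_L2(3)[OF u2] b)
    show "AE x in M. partial_deriv b (partial_deriv b (\<phi> m)) x - weak_deriv \<Omega> b (weak_deriv \<Omega> b u) x =
       1 * weak_deriv \<Omega> b (weak_deriv \<Omega> b (\<lambda>x. \<phi> m x - u x)) x + 0 * weak_deriv \<Omega> b (weak_deriv \<Omega> b (\<lambda>x. \<phi> m x - u x)) x"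
      using H2_diff(3)[OF H2_test_function(1)[OF \<phi>[of m]] u2 b b] H2_test_function(3)[OF \<phi>[of m] b b]
      by eventually_elim simp
  qed
  have l3: "L2_to_0 (\<lambda>m x. laplacian (\<phi> m) x - weak_laplacian \<Omega> u x)"
  proof -
    have "L2_to_0 (\<lambda>m x. \<Sum>b\<in>Basis. partial_deriv b (partial_deriv b (\<phi> m)) x - weak_deriv \<Omega> b (weak_deriv \<Omega> b u) x)"
      by (rule L2_to_0_sum[OF finite_Basis _ l2])
         (intro L2d L2_test_function[OF test_functions_partial_deriv[OF d\<phi>]] H2_L2(3)[OF u2])
    then show ?thesis by (simp add: laplacian_def weak_laplacian_def sum_subtractf)
  qed
  define E where "E m = (LINT x|M. (laplacian (\<phi> m) x)\<^sup>2) +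
    a * (\<Sum>b\<in>Basis. LINT x|M. (partial_deriv b (\<phi> m) x)\<^sup>2)" for m
  have En: "(LINT x|M. (weak_laplacian \<Omega> u x)\<^sup>2) +
    a * (\<Sum>b\<in>Basis. LINT x|M. (weak_deriv \<Omega> b u x)\<^sup>2) = energy a u u"
  proof -
    have "(LINT x|M. (\<Sum>b\<in>Basis. weak_deriv \<Omega> b u x * weak_deriv \<Omega> b u x))
     = (\<Sum>b\<in>Basis. LINT x|M. weak_deriv \<Omega> b u x * weak_deriv \<Omega> b u x)"
      by (intro Bochner_Integration.integral_sum L2_mult_integrable H2_L2 u2)
    then show ?thesis by (simp add: energy_def power2_eq_square)
  qed
  have "(\<lambda>m. E m) \<longlonglongrightarrow> energy a u u"
    unfolding E_def En[symmetric]
    by (intro tendsto_add tendsto_mult tendsto_const tendsto_sum L2_to_0_norm L2_test_function d\<phi> l\<phi> l1 l3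
        L2_laplacian H2_L2(2) u2)
  then have lim: "(\<lambda>m. ennreal (?c * E m)) \<longlonglongrightarrow> ennreal (?c * energy a u u)"
    by (intro tendsto_ennrealI tendsto_mult tendsto_const)
  have "(\<integral>\<^sup>+\<xi>. ennreal ((norm \<xi> ^ 4 + a * (norm \<xi>)\<^sup>2) * power_spectrum lborel (\<phi> m) \<xi>) \<partial>lborel) = ennreal (?c * E m)" for m
  proof -
    have "(\<integral>\<^sup>+\<xi>. ennreal ((norm \<xi> ^ 4 + a * (norm \<xi>)\<^sup>2) * power_spectrum lborel (\<phi> m) \<xi>) \<partial>lborel) =
      (\<integral>\<^sup>+\<xi>. ennreal (norm \<xi> ^ 4 * power_spectrum lborel (\<phi> m) \<xi>) +
         ennreal a * ennreal ((norm \<xi>)\<^sup>2 * power_spectrum lborel (\<phi> m) \<xi>) \<partial>lborel)"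
      using a by (intro nn_integral_cong) (simp add: ennreal_mult[symmetric] ennreal_plus[symmetric] algebra_simps del: ennreal_plus)
    also have "\<dots> = (\<integral>\<^sup>+\<xi>. ennreal (norm \<xi> ^ 4 * power_spectrum lborel (\<phi> m) \<xi>) \<partial>lborel) +
         ennreal a * (\<integral>\<^sup>+\<xi>. ennreal ((norm \<xi>)\<^sup>2 * power_spectrum lborel (\<phi> m) \<xi>) \<partial>lborel)"
      by (simp add: nn_integral_add nn_integral_cmult)
    also have "\<dots> = ennreal (?c * (LINT x|M. (laplacian (\<phi> m) x)\<^sup>2)) +
         ennreal a * ennreal (?c * (\<Sum>b\<in>Basis. LINT x|M. (partial_deriv b (\<phi> m) x)\<^sup>2))"
      unfolding parseval_laplacian[OF \<phi>] parseval_gradient[OF \<phi>] integral_M_test_function_sq[OF l\<phi>]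
      using integral_M_test_function_sq[OF d\<phi>] by (simp cong: sum.cong)
    also have "\<dots> = ennreal (?c * E m)"
      using a by (simp add: E_def ennreal_mult[symmetric] ennreal_plus[symmetric] sum_nonneg algebra_simps del: ennreal_plus)
    finally show ?thesis .
  qed
  then have lim': "(\<lambda>m. \<integral>\<^sup>+\<xi>. ennreal ((norm \<xi> ^ 4 + a * (norm \<xi>)\<^sup>2) * power_spectrum lborel (\<phi> m) \<xi>) \<partial>lborel)
      \<longlonglongrightarrow> ennreal (?c * energy a u u)" using lim by simp
  show ?thesis
    by (rule nn_integral_power_spectrum_le[OF \<phi> H2_L2(1)[OF u2] c0 _ _ lim']) (use a in auto)
qed

text \<open>The squared norm of \<open>g\<close> minus its projection on the span of the
  \<open>e i\<close> is nonnegative, and the projection is orthogonal to that remainder.\<close>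

lemma bessel:
  fixes e :: "nat \<Rightarrow> 'a \<Rightarrow> real"
  assumes A: "finite A" and e: "\<And>i. i \<in> A \<Longrightarrow> e i \<in> L2 \<Omega>"
    and on: "\<And>i j. i \<in> A \<Longrightarrow> j \<in> A \<Longrightarrow> (LINT x|M. e i x * e j x) = (if i = j then 1 else 0)"
    and g: "g \<in> L2 \<Omega>"
  shows "(\<Sum>i\<in>A. (LINT x|M. e i x * g x)\<^sup>2) \<le> (LINT x|M. (g x)\<^sup>2)"
proof -
  define p where "p i = (LINT x|M. e i x * g x)" for i
  define s where "s x = (\<Sum>i\<in>A. p i * e i x)" for x
  define h where "h x = 1 * g x + (-1) * s x" for x
  have s: "s \<in> L2 \<Omega>" unfolding s_def by (rule L2_sum[OF A e])
  have h: "h \<in> L2 \<Omega>" unfolding h_def by (rule L2_lin[OF g s])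
  have se: "(LINT x|M. s x * e j x) = p j" if j: "j \<in> A" for j
  proof -
    have "(LINT x|M. s x * e j x) = (\<Sum>i\<in>A. p i * (LINT x|M. e i x * e j x))"
      unfolding s_def by (rule integral_sum_mult[OF A e e[OF j]])
    also have "\<dots> = (\<Sum>i\<in>A. if i = j then p i else 0)" by (intro sum.cong) (auto simp: on j)
    also have "\<dots> = p j" using A j by simp
    finally show ?thesis .
  qed
  have "0 \<le> (LINT x|M. h x * h x)" by simp
  also have "\<dots> = (LINT x|M. g x * h x) - (LINT x|M. s x * h x)"
    using integral_add_mult[OF g s h, of 1 "-1"] by (simp add: h_def)
  also have "(LINT x|M. g x * h x) = (LINT x|M. g x * g x) - (LINT x|M. s x * g x)"
    using integral_add_mult[OF g s g, of 1 "-1"] by (simp add: h_def mult.commute)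
  also have "(LINT x|M. s x * g x) = (\<Sum>i\<in>A. p i * p i)"
    unfolding s_def p_def by (rule integral_sum_mult[OF A e g])
  also have "(LINT x|M. s x * h x) = 0"
  proof -
    have "(LINT x|M. s x * h x) = (\<Sum>i\<in>A. p i * (LINT x|M. e i x * h x))"
      unfolding s_def by (rule integral_sum_mult[OF A e h])
    also have "(LINT x|M. e i x * h x) = 0" if i: "i \<in> A" for i
      using integral_add_mult[OF g s e[OF i], of 1 "-1"] se[OF i] by (simp add: h_def p_def mult.commute)
    then have "(\<Sum>i\<in>A. p i * (LINT x|M. e i x * h x)) = 0" by simp
    finally show ?thesis .
  qed
  finally show ?thesis by (simp add: p_def power2_eq_square)
qed

text \<open>Moving the origin to \<open>c\<close> multiplies the Fourier transform by a phase, here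
  a rotation of the pair of cosine and sine integrals. The freedom to choose \<open>c\<close> brings
  in the second moment about an arbitrary point.\<close>

lemma power_spectrum_shift:
  assumes u: "u \<in> L2 \<Omega>"
  shows "power_spectrum M u \<xi> =
    (LINT x|M. u x * cos (\<xi> \<bullet> (x - c)))\<^sup>2 + (LINT x|M. u x * sin (\<xi> \<bullet> (x - c)))\<^sup>2"
proof -
  let ?C = "LINT x|M. u x * cos (\<xi> \<bullet> x)" and ?S = "LINT x|M. u x * sin (\<xi> \<bullet> x)"
  define p q where "p = cos (\<xi> \<bullet> c)" and "q = sin (\<xi> \<bullet> c)"
  have "(LINT x|M. u x * cos (\<xi> \<bullet> (x - c))) = (LINT x|M. (p * cos (\<xi> \<bullet> x) + q * sin (\<xi> \<bullet> x)) * u x)"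
    by (intro Bochner_Integration.integral_cong) (auto simp: inner_diff_right cos_diff p_def q_def algebra_simps)
  also have "\<dots> = p * ?C + q * ?S"
    unfolding integral_add_mult[OF L2_cos_sin u] by (simp add: mult.commute)
  finally have 1: "(LINT x|M. u x * cos (\<xi> \<bullet> (x - c))) = p * ?C + q * ?S" .
  have "(LINT x|M. u x * sin (\<xi> \<bullet> (x - c))) = (LINT x|M. ((-q) * cos (\<xi> \<bullet> x) + p * sin (\<xi> \<bullet> x)) * u x)"
    by (intro Bochner_Integration.integral_cong) (auto simp: inner_diff_right sin_diff p_def q_def algebra_simps)
  also have "\<dots> = (-q) * ?C + p * ?S"
    unfolding integral_add_mult[OF L2_cos_sin u] by (simp add: mult.commute)
  finally have 2: "(LINT x|M. u x * sin (\<xi> \<bullet> (x - c))) = (-q) * ?C + p * ?S" .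
  have "p\<^sup>2 + q\<^sup>2 = 1" by (simp add: p_def q_def)
  then have "?C\<^sup>2 + ?S\<^sup>2 = (p\<^sup>2 + q\<^sup>2) * (?C\<^sup>2 + ?S\<^sup>2)" by simp
  also have "\<dots> = (p * ?C + q * ?S)\<^sup>2 + ((-q) * ?C + p * ?S)\<^sup>2" by (simp add: power2_eq_square algebra_simps)
  finally show ?thesis unfolding power_spectrum_def 1 2 .
qed

lemma integral_const_M: "(LINT x|M. c) = c * volume \<Omega>"
  by (simp add: volume_def measure_restrict_space)

context
  fixes e :: "nat \<Rightarrow> 'a \<Rightarrow> real" and A :: "nat set"
  assumes A: "finite A" and e: "\<And>i. i \<in> A \<Longrightarrow> e i \<in> L2 \<Omega>"
    and on: "\<And>i j. i \<in> A \<Longrightarrow> j \<in> A \<Longrightarrow> (LINT x|M. e i x * e j x) = (if i = j then 1 else 0)"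
begin

lemma bessel_two:
  assumes f: "f \<in> L2 \<Omega>" and g: "g \<in> L2 \<Omega>"
  shows "(\<Sum>i\<in>A. (LINT x|M. e i x * f x)\<^sup>2 + (LINT x|M. e i x * g x)\<^sup>2)
    \<le> (LINT x|M. (f x)\<^sup>2 + (g x)\<^sup>2)"
  using bessel[OF A e on f] bessel[OF A e on g] L2_D(2)[OF f] L2_D(2)[OF g] by (simp add: sum.distrib)

lemma sum_power_spectrum_le: "(\<Sum>i\<in>A. power_spectrum M (e i) \<xi>) \<le> volume \<Omega>"
  using bessel_two[OF L2_cos_sin(1)[of \<xi>] L2_cos_sin(2)[of \<xi>]] integral_const_M[of 1]
  by (simp add: power_spectrum_def)

text \<open>Each difference of squares \<open>P\<^sup>2 - P'\<^sup>2\<close> is factored as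
  \<open>(P - P') * (P + P')\<close>, and Cauchy-Schwarz separates the two kinds of factors. Both
  sums are coefficients of \<open>e i\<close> against plane waves combined with sign
  \<open>-1\<close> or \<open>1\<close>, so Bessel bounds them by the integrals of
  \<open>2 - 2 * cos \<theta>\<close> and \<open>2 + 2 * cos \<theta>\<close> with
  \<open>\<theta> = (\<xi> - \<eta>) \<bullet> (x - c)\<close>. The first is at most
  \<open>\<theta>\<^sup>2\<close>, the second at most \<open>4\<close>.\<close>

lemma sum_power_spectrum_lipschitz_center:
  "((\<Sum>i\<in>A. power_spectrum M (e i) \<xi>) - (\<Sum>i\<in>A. power_spectrum M (e i) \<eta>))\<^sup>2
    \<le> 4 * volume \<Omega> * (norm (\<xi> - \<eta>))\<^sup>2 * (LINT x|M. (norm (x - c))\<^sup>2)"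
proof -
  define P where "P i \<xi> = (LINT x|M. e i x * cos (\<xi> \<bullet> (x - c)))" for i \<xi>
  define Q where "Q i \<xi> = (LINT x|M. e i x * sin (\<xi> \<bullet> (x - c)))" for i \<xi>
  have Lc: "(\<lambda>x. cos (\<xi> \<bullet> (x - c))) \<in> L2 \<Omega>" and Ls: "(\<lambda>x. sin (\<xi> \<bullet> (x - c))) \<in> L2 \<Omega>" for \<xi>
    by (intro L2_continuous continuous_intros)+
  have lin: "(LINT x|M. e i x * (f x + t * g x)) = (LINT x|M. e i x * f x) + t * (LINT x|M. e i x * g x)"
    if "i \<in> A" "f \<in> L2 \<Omega>" "g \<in> L2 \<Omega>" for i f g t
    using integral_add_mult[OF that(2,3) e[OF that(1)], of 1 t] by (simp add: mult.commute)
  have bt: "(\<Sum>i\<in>A. (P i \<xi> + t * P i \<eta>)\<^sup>2 + (Q i \<xi> + t * Q i \<eta>)\<^sup>2) \<le>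
     (LINT x|M. (1 + t\<^sup>2) + 2 * t * cos ((\<xi> - \<eta>) \<bullet> (x - c)))" for t
  proof -
    have f: "(\<lambda>x. cos (\<xi> \<bullet> (x - c)) + t * cos (\<eta> \<bullet> (x - c))) \<in> L2 \<Omega>"
      using L2_lin[OF Lc Lc, where \<alpha>=1] by simp
    have g: "(\<lambda>x. sin (\<xi> \<bullet> (x - c)) + t * sin (\<eta> \<bullet> (x - c))) \<in> L2 \<Omega>"
      using L2_lin[OF Ls Ls, where \<alpha>=1] by simp
    have "(\<Sum>i\<in>A. (P i \<xi> + t * P i \<eta>)\<^sup>2 + (Q i \<xi> + t * Q i \<eta>)\<^sup>2) =
      (\<Sum>i\<in>A. (LINT x|M. e i x * (cos (\<xi> \<bullet> (x - c)) + t * cos (\<eta> \<bullet> (x - c))))\<^sup>2 +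
        (LINT x|M. e i x * (sin (\<xi> \<bullet> (x - c)) + t * sin (\<eta> \<bullet> (x - c))))\<^sup>2)"
      by (intro sum.cong refl) (simp add: lin Lc Ls P_def Q_def)
    also have "\<dots> \<le> (LINT x|M. (cos (\<xi> \<bullet> (x - c)) + t * cos (\<eta> \<bullet> (x - c)))\<^sup>2 +
        (sin (\<xi> \<bullet> (x - c)) + t * sin (\<eta> \<bullet> (x - c)))\<^sup>2)"
      by (rule bessel_two[OF f g])
    also have "\<dots> = (LINT x|M. (1 + t\<^sup>2) + 2 * t * cos ((\<xi> - \<eta>) \<bullet> (x - c)))"
    proof (intro Bochner_Integration.integral_cong refl)
      fix x
      have "(cos \<alpha> + t * cos \<beta>)\<^sup>2 + (sin \<alpha> + t * sin \<beta>)\<^sup>2 = (1 + t\<^sup>2) + 2 * t * cos (\<alpha> - \<beta>)" for \<alpha> \<beta>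
      proof -
        have "(p + t * r)\<^sup>2 + (q + t * z)\<^sup>2 = (p\<^sup>2 + q\<^sup>2) + t\<^sup>2 * (r\<^sup>2 + z\<^sup>2) + 2 * t * (p * r + q * z)" for p q r z
          by (simp add: power2_eq_square algebra_simps)
        from this[of "cos \<alpha>" "cos \<beta>" "sin \<alpha>" "sin \<beta>"]
        show ?thesis unfolding sin_cos_squared_add2 cos_diff by simp
      qed
      then show "(cos (\<xi> \<bullet> (x - c)) + t * cos (\<eta> \<bullet> (x - c)))\<^sup>2 + (sin (\<xi> \<bullet> (x - c)) + t * sin (\<eta> \<bullet> (x - c)))\<^sup>2 =
         (1 + t\<^sup>2) + 2 * t * cos ((\<xi> - \<eta>) \<bullet> (x - c))" by (simp add: inner_diff_left)
    qed
    finally show ?thesis .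
  qed
  have ci: "integrable M (\<lambda>x. cos ((\<xi> - \<eta>) \<bullet> (x - c)))" by (rule L2_integrable[OF Lc])
  have ni: "integrable M (\<lambda>x. (norm (x - c))\<^sup>2)"
    by (intro L2_integrable L2_continuous continuous_intros)
  interpret fm: finite_measure M by (rule finite_measure_\<Omega>)
  have minus: "(\<Sum>i\<in>A. (P i \<xi> - P i \<eta>)\<^sup>2 + (Q i \<xi> - Q i \<eta>)\<^sup>2) \<le> (norm (\<xi> - \<eta>))\<^sup>2 * (LINT x|M. (norm (x - c))\<^sup>2)"
  proof -
    have "(\<Sum>i\<in>A. (P i \<xi> - P i \<eta>)\<^sup>2 + (Q i \<xi> - Q i \<eta>)\<^sup>2) \<le> (LINT x|M. 2 - 2 * cos ((\<xi> - \<eta>) \<bullet> (x - c)))"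
      using bt[of "-1"] by simp
    also have "\<dots> \<le> (LINT x|M. (norm (\<xi> - \<eta>))\<^sup>2 * (norm (x - c))\<^sup>2)"
    proof (rule integral_mono)
      fix x
      define \<theta> where "\<theta> = (\<xi> - \<eta>) \<bullet> (x - c)"
      have "2 - 2 * cos \<theta> = 4 * (sin (\<theta> / 2))\<^sup>2"
        using cos_double_sin[of "\<theta> / 2"] by simp
      also have "\<dots> \<le> 4 * (\<theta> / 2)\<^sup>2"
        using abs_sin_x_le_abs_x[of "\<theta> / 2"] by (intro mult_left_mono abs_le_square_iff[THEN iffD1]) auto
      also have "\<dots> = \<theta>\<^sup>2" by (simp add: power_divide)
      also have "\<dots> \<le> (norm (\<xi> - \<eta>) * norm (x - c))\<^sup>2"
        unfolding \<theta>_def by (rule abs_le_square_iff[THEN iffD1]) (simp add: Cauchy_Schwarz_ineq2)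
      finally show "2 - 2 * cos ((\<xi> - \<eta>) \<bullet> (x - c)) \<le> (norm (\<xi> - \<eta>))\<^sup>2 * (norm (x - c))\<^sup>2"
        by (simp add: \<theta>_def power_mult_distrib)
    qed (use ci ni in auto)
    finally show ?thesis by simp
  qed
  have plus: "(\<Sum>i\<in>A. (P i \<xi> + P i \<eta>)\<^sup>2 + (Q i \<xi> + Q i \<eta>)\<^sup>2) \<le> 4 * volume \<Omega>"
  proof -
    have "(\<Sum>i\<in>A. (P i \<xi> + P i \<eta>)\<^sup>2 + (Q i \<xi> + Q i \<eta>)\<^sup>2) \<le> (LINT x|M. 2 + 2 * cos ((\<xi> - \<eta>) \<bullet> (x - c)))"
      using bt[of 1] by simp
    also have "\<dots> \<le> (LINT x|M. 4)"
    proof (rule integral_mono)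
      show "2 + 2 * cos ((\<xi> - \<eta>) \<bullet> (x - c)) \<le> 4" for x using cos_le_one[of "(\<xi> - \<eta>) \<bullet> (x - c)"] by linarith
    qed (use ci in auto)
    finally show ?thesis unfolding integral_const_M .
  qed
  \<comment> \<open>Cosine and sine parts are treated as components of one vector indexed by
    \<open>A \<times> UNIV\<close> over \<open>bool\<close>, so that a single Cauchy-Schwarz
    inequality loses no constant.\<close>
  have cs: "(\<Sum>i\<in>A. a i * b i + a' i * b' i)\<^sup>2 \<le> (\<Sum>i\<in>A. (a i)\<^sup>2 + (a' i)\<^sup>2) * (\<Sum>i\<in>A. (b i)\<^sup>2 + (b' i)\<^sup>2)" for a b a' b' :: "nat \<Rightarrow> real"
  proof -
    have S: "(\<Sum>p\<in>A \<times> (UNIV :: bool set). h (fst p) (snd p)) = (\<Sum>i\<in>A. h i True + h i False)" for h :: "nat \<Rightarrow> bool \<Rightarrow> real"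
      using sum.cartesian_product[of h "UNIV :: bool set" A] by (simp add: split_beta UNIV_bool add.commute)
    let ?a = "\<lambda>i s. if s then a i else a' i" and ?b = "\<lambda>i s. if s then b i else b' i"
    show ?thesis
      using Cauchy_Schwarz_ineq_sum[of "\<lambda>p. ?a (fst p) (snd p)" "\<lambda>p. ?b (fst p) (snd p)" "A \<times> (UNIV :: bool set)"]
      unfolding S[of "\<lambda>i s. ?a i s * ?b i s"] S[of "\<lambda>i s. (?a i s)\<^sup>2"] S[of "\<lambda>i s. (?b i s)\<^sup>2"] by simp
  qed
  have "(\<Sum>i\<in>A. power_spectrum M (e i) \<xi>) - (\<Sum>i\<in>A. power_spectrum M (e i) \<eta>) =
     (\<Sum>i\<in>A. (P i \<xi> - P i \<eta>) * (P i \<xi> + P i \<eta>) + (Q i \<xi> - Q i \<eta>) * (Q i \<xi> + Q i \<eta>))"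
    unfolding sum_subtractf[symmetric]
    by (intro sum.cong refl) (simp add: power_spectrum_shift[OF e, of _ _ c] P_def Q_def power2_eq_square algebra_simps)
  also have "\<dots>\<^sup>2 \<le> (\<Sum>i\<in>A. (P i \<xi> - P i \<eta>)\<^sup>2 + (Q i \<xi> - Q i \<eta>)\<^sup>2) * (\<Sum>i\<in>A. (P i \<xi> + P i \<eta>)\<^sup>2 + (Q i \<xi> + Q i \<eta>)\<^sup>2)"
    by (rule cs)
  also have "\<dots> \<le> ((norm (\<xi> - \<eta>))\<^sup>2 * (LINT x|M. (norm (x - c))\<^sup>2)) * (4 * volume \<Omega>)"
    by (intro mult_mono minus plus sum_nonneg) auto
  finally show ?thesis by (simp add: mult_ac)
qed

lemma sum_power_spectrum_lipschitz:
  assumes vol: "volume \<Omega> > 0"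
  shows "\<bar>(\<Sum>i\<in>A. power_spectrum M (e i) \<xi>) - (\<Sum>i\<in>A. power_spectrum M (e i) \<eta>)\<bar>
    \<le> 2 * sqrt (volume \<Omega> * moment_of_inertia \<Omega>) * norm (\<xi> - \<eta>)"
proof (cases "\<xi> = \<eta>")
  case False
  let ?D = "(\<Sum>i\<in>A. power_spectrum M (e i) \<xi>) - (\<Sum>i\<in>A. power_spectrum M (e i) \<eta>)"
  define N where "N = 4 * volume \<Omega> * (norm (\<xi> - \<eta>))\<^sup>2"
  have N: "N > 0" using vol False by (simp add: N_def)
  \<comment> \<open>The left side does not depend on \<open>c\<close>, so the estimate for every
    centre passes to the infimum; division by \<open>N\<close> isolates the second moment and is
    possible since \<xi> and \<eta> differ.\<close>
  have "?D\<^sup>2 / N \<le> moment_of_inertia \<Omega>"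
    unfolding moment_of_inertia_def
  proof (rule cINF_greatest)
    fix c
    show "?D\<^sup>2 / N \<le> (LINT x|M. (norm (x - c))\<^sup>2)"
      using sum_power_spectrum_lipschitz_center[of \<xi> \<eta> c] N by (simp add: N_def divide_le_eq mult_ac)
  qed simp
  then have "?D\<^sup>2 \<le> N * moment_of_inertia \<Omega>" using N by (simp add: divide_le_eq mult.commute)
  then have "sqrt (?D\<^sup>2) \<le> sqrt (4 * (norm (\<xi> - \<eta>))\<^sup>2 * (volume \<Omega> * moment_of_inertia \<Omega>))"
    by (intro real_sqrt_le_mono) (simp add: N_def mult_ac)
  then show ?thesis by (simp add: real_sqrt_mult mult_ac)
qed simp

end

end

subsection \<open>The eigenvalue sum\<close>

text \<open>The mass grows with the plateau. At \<open>s = 0\<close> it is at most the target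
  because \<open>d \<le> T\<close>; at \<open>s = T\<close> the binomial expansion already contains
  the target as its leading term, with nonnegative terms left over. The intermediate value theorem
  gives \<open>s\<close>.\<close>

lemma cone_mass_solvable:
  fixes T d :: real
  assumes n: "n = 3 \<or> n = (4::nat)" and d: "0 < d" "d \<le> T"
  obtains s where "0 \<le> s" "T ^ n * ((real n + 1) * d) = (s + d) ^ (n + 1) - s ^ (n + 1)"
proof -
  have "\<exists>s. 0 \<le> s \<and> s \<le> T \<and> (s + d) ^ (n + 1) - s ^ (n + 1) = T ^ n * ((real n + 1) * d)"
  proof (rule IVT')
    have "d ^ n \<le> T ^ n" using d by (intro power_mono) auto
    then have "d ^ n * d \<le> T ^ n * d" using d by (intro mult_right_mono) auto
    moreover have "T ^ n * d \<le> T ^ n * ((real n + 1) * d)" using d by (intro mult_left_mono) auto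
    ultimately show "(0 + d) ^ (n + 1) - 0 ^ (n + 1) \<le> T ^ n * ((real n + 1) * d)" by (simp add: mult.commute)
    have "0 \<le> 6 * T\<^sup>2 * d\<^sup>2 + 4 * T * d ^ 3 + d ^ 4" "0 \<le> 10 * T ^ 3 * d\<^sup>2 + 10 * T\<^sup>2 * d ^ 3 + 5 * T * d ^ 4 + d ^ 5"
      using d by (intro add_nonneg_nonneg mult_nonneg_nonneg zero_le_power; simp)+
    then show "T ^ n * ((real n + 1) * d) \<le> (T + d) ^ (n + 1) - T ^ (n + 1)"
      using n by (auto simp: eval_nat_numeral algebra_simps)
    show "continuous_on {0..T} (\<lambda>s. (s + d) ^ (n + 1) - s ^ (n + 1))" by (intro continuous_intros)
  qed (use d in auto)
  then show ?thesis using that by metis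
qed

lemma volume_eq: "volume A = measure lborel A" if "A \<in> sets borel" for A :: "'a::euclidean_space set"
  using that by (simp add: volume_def measure_completion)

context bounded_open
begin

lemma volume_pos: "\<Omega> \<noteq> {} \<Longrightarrow> volume \<Omega> > 0"
proof -
  assume "\<Omega> \<noteq> {}"
  then have "\<not> negligible \<Omega>" using open_\<Omega> open_not_negligible by blast
  moreover have "\<Omega> \<in> lmeasurable" using open_\<Omega> bounded_\<Omega> by (rule lmeasurable_open[rotated])
  ultimately show ?thesis unfolding volume_def
    using measure_eq_0_null_sets negligible_iff_measure0 zero_less_measure_iff by (metis measure_nonneg order_le_less)
qed

lemma energy_nonneg: "a \<ge> 0 \<Longrightarrow> energy a u u \<ge> 0"
  unfolding energy_def by (intro add_nonneg_nonneg mult_nonneg_nonneg[of a] integral_nonneg_AE AE_I2 sum_nonneg) auto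

text \<open>The density of the overview is \<open>F\<close>, with upper bound \<open>L * d\<close>
  and Lipschitz constant \<open>L\<close>, so the radial comparison applies to it with weights of
  degree \<open>4\<close> and \<open>2\<close>. What is left for the theorem is arithmetic with
  \<open>s\<close>, \<open>d\<close> and \<open>k\<close>.\<close>

lemma eigenvalue_sum_ge:
  fixes a s T :: real and k :: nat and \<Gamma> :: "nat \<Rightarrow> real"
  defines "n \<equiv> DIM('a)" and "\<omega> \<equiv> measure lborel (ball (0::'a) 1)" and "V \<equiv> volume \<Omega>" and "I \<equiv> moment_of_inertia \<Omega>"
  defines "L \<equiv> 2 * sqrt (V * I) / (2 * pi) ^ n" and "d \<equiv> sqrt (V / I) / 2"
  assumes a: "a \<ge> 0" and V: "V > 0" and I: "I > 0" and \<Gamma>: "eigenvalue_sequence a \<Omega> \<Gamma>" and s: "s \<ge> 0"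
    and mass: "real k * (real n + 1) = \<omega> * L * ((s + d) ^ (n + 1) - s ^ (n + 1))"
  shows "real n * \<omega> * L * ((s + d) ^ (n + 5) - s ^ (n + 5)) / ((real n + 4) * (real n + 5))
      + a * (real n * \<omega> * L * ((s + d) ^ (n + 3) - s ^ (n + 3)) / ((real n + 2) * (real n + 3)))
    \<le> (\<Sum>j=1..k. \<Gamma> j)"
proof -
  let ?c = "(2 * pi) ^ n"
  have c: "?c > 0" by simp
  obtain e :: "nat \<Rightarrow> 'a \<Rightarrow> real" where e: "\<And>j. 1 \<le> j \<Longrightarrow> e j \<in> eigenspace a \<Omega> (\<Gamma> j)"
    and on: "\<And>i j. 1 \<le> i \<Longrightarrow> 1 \<le> j \<Longrightarrow> (LINT x|M. e i x * e j x) = (if i = j then 1 else 0)"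
    using orthonormal_eigenfunctions[OF \<Gamma>] by blast
  define A where "A = {1..k}"
  have fA: "finite A" by (simp add: A_def)
  have eA: "e i \<in> L2 \<Omega>" "e i \<in> H2_0 \<Omega>" "e i \<in> eigenspace a \<Omega> (\<Gamma> i)" if "i \<in> A" for i
    using e[of i] eigenspace_L2[OF e[of i]] that by (auto simp: A_def eigenspace_iff)
  have onA: "(LINT x|M. e i x * e j x) = (if i = j then 1 else 0)" if "i \<in> A" "j \<in> A" for i j
    using on that by (simp add: A_def)
  define F0 where "F0 \<xi> = (\<Sum>i\<in>A. power_spectrum M (e i) \<xi>)" for \<xi>
  define F where "F \<xi> = F0 \<xi> / ?c" for \<xi>
  have pars: "power_spectrum M (e i) \<in> borel_measurable borel"
    "(\<integral>\<^sup>+\<xi>. power_spectrum M (e i) \<xi> \<partial>lborel) = ennreal ?c" if i: "i \<in> A" for i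
  proof -
    obtain \<phi> where \<phi>: "\<And>m::nat. \<phi> m \<in> test_functions \<Omega>" "L2_to_0 (\<lambda>m x. \<phi> m x - e i x)"
      using H2_0_D[OF eA(2)[OF i]] by blast
    show "power_spectrum M (e i) \<in> borel_measurable borel"
      by (rule power_spectrum_measurable[OF \<phi>(1) eA(1)[OF i] \<phi>(2)])
    show "(\<integral>\<^sup>+\<xi>. power_spectrum M (e i) \<xi> \<partial>lborel) = ennreal ?c"
      using parseval[OF \<phi>(1) eA(1)[OF i] \<phi>(2)] onA[OF i i] by (simp add: n_def power2_eq_square)
  qed
  have F0nn: "F0 \<xi> \<ge> 0" for \<xi> unfolding F0_def by (intro sum_nonneg) simp
  \<comment> \<open>One computation for all weights: constant weight for the mass, and the symbol
    \<open>norm \<xi> ^ 4 + a * (norm \<xi>)\<^sup>2\<close> of the operator for the energy.\<close>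
  have weighted: "(\<integral>\<^sup>+\<xi>. ennreal (w \<xi> * F \<xi>) \<partial>lborel) =
      ennreal (1 / ?c) * (\<Sum>i\<in>A. \<integral>\<^sup>+\<xi>. ennreal (w \<xi> * power_spectrum M (e i) \<xi>) \<partial>lborel)"
    if [measurable]: "w \<in> borel_measurable borel" and w: "\<And>\<xi>. w \<xi> \<ge> 0" for w
  proof -
    have m: "(\<lambda>\<xi>. ennreal (w \<xi> * power_spectrum M (e i) \<xi>)) \<in> borel_measurable lborel" if "i \<in> A" for i
      using pars(1)[OF that] by measurable
    have "(\<integral>\<^sup>+\<xi>. ennreal (w \<xi> * F \<xi>) \<partial>lborel) =
      (\<integral>\<^sup>+\<xi>. ennreal (1 / ?c) * (\<Sum>i\<in>A. ennreal (w \<xi> * power_spectrum M (e i) \<xi>)) \<partial>lborel)"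
    proof (intro nn_integral_cong)
      fix \<xi>
      have "(\<Sum>i\<in>A. ennreal (w \<xi> * power_spectrum M (e i) \<xi>)) = ennreal (w \<xi> * F0 \<xi>)"
        unfolding F0_def sum_distrib_left using w by (intro sum_ennreal) simp
      then show "ennreal (w \<xi> * F \<xi>) = ennreal (1 / ?c) * (\<Sum>i\<in>A. ennreal (w \<xi> * power_spectrum M (e i) \<xi>))"
        using w F0nn by (simp add: F_def ennreal_mult[symmetric])
    qed
    also have "\<dots> = ennreal (1 / ?c) * (\<integral>\<^sup>+\<xi>. (\<Sum>i\<in>A. ennreal (w \<xi> * power_spectrum M (e i) \<xi>)) \<partial>lborel)"
      by (rule nn_integral_cmult) (intro borel_measurable_sum m)
    also have "(\<integral>\<^sup>+\<xi>. (\<Sum>i\<in>A. ennreal (w \<xi> * power_spectrum M (e i) \<xi>)) \<partial>lborel) =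
       (\<Sum>i\<in>A. \<integral>\<^sup>+\<xi>. ennreal (w \<xi> * power_spectrum M (e i) \<xi>) \<partial>lborel)"
      by (rule nn_integral_sum[OF m])
    finally show ?thesis .
  qed
  have mF: "(\<integral>\<^sup>+\<xi>. F \<xi> \<partial>lborel) = ennreal (real k)"
  proof -
    have "(\<integral>\<^sup>+\<xi>. F \<xi> \<partial>lborel) = ennreal (1 / ?c) * (\<Sum>i\<in>A. ennreal ?c)"
      using weighted[of "\<lambda>_. 1"] pars(2) by (simp cong: sum.cong)
    also have "(\<Sum>i\<in>A. ennreal ?c) = ennreal (\<Sum>i\<in>A. ?c)" by (intro sum_ennreal) simp
    also have "ennreal (1 / ?c) * ennreal (\<Sum>i\<in>A. ?c) = ennreal (real k)"
      by (subst ennreal_mult[symmetric]) (auto simp: A_def)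
    finally show ?thesis .
  qed
  \<comment> \<open>The product \<open>L * d\<close> is exactly the Bessel bound on
    \<open>F\<close>; \<open>I\<close> cancels between the two square roots.\<close>
  have Ld: "L * d = V / ?c"
  proof -
    have "sqrt (V * I) * sqrt (V / I) = V" using V I by (simp add: real_sqrt_mult[symmetric])
    then show ?thesis by (simp add: L_def d_def field_simps)
  qed
  have F: "0 \<le> F \<xi>" "F \<xi> \<le> L * d" for \<xi>
    using F0nn[of \<xi>] sum_power_spectrum_le[OF fA eA(1) onA, of \<xi>] unfolding Ld F_def F0_def V_def
    by (auto intro!: divide_right_mono)
  have lip: "\<bar>F \<xi> - F \<eta>\<bar> \<le> L * norm (\<xi> - \<eta>)" for \<xi> \<eta>
  proof -
    have "\<bar>F0 \<xi> - F0 \<eta>\<bar> / ?c \<le> (2 * sqrt (V * I) * norm (\<xi> - \<eta>)) / ?c"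
      using sum_power_spectrum_lipschitz[OF fA eA(1) onA, of \<xi> \<eta>] V unfolding F0_def V_def I_def
      by (intro divide_right_mono) auto
    then show ?thesis by (simp add: F_def L_def diff_divide_distrib[symmetric])
  qed
  have L0: "L \<ge> 0" and d0: "d \<ge> 0" using V I by (simp_all add: L_def d_def)
  note rb = radial_moment_bound[OF F lip L0 s d0 mass[unfolded n_def \<omega>_def] mF]
  define K4 where "K4 = real n * \<omega> * L * ((s + d) ^ (n + 5) - s ^ (n + 5)) / ((real n + 4) * (real n + 5))"
  define K2 where "K2 = real n * \<omega> * L * ((s + d) ^ (n + 3) - s ^ (n + 3)) / ((real n + 2) * (real n + 3))"
  have n5: "n + 4 + 1 = n + 5" "n + 2 + 1 = n + 3" "real (n + 4) = real n + 4" "real n + 4 + 1 = real n + 5"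
    "real (n + 2) = real n + 2" "real n + 2 + 1 = real n + 3" by auto
  have r4: "ennreal K4 \<le> (\<integral>\<^sup>+\<xi>. norm \<xi> ^ 4 * F \<xi> \<partial>lborel)"
    using rb[of 4] unfolding n_def[symmetric] \<omega>_def[symmetric] n5 K4_def by simp
  have r2: "ennreal K2 \<le> (\<integral>\<^sup>+\<xi>. (norm \<xi>)\<^sup>2 * F \<xi> \<partial>lborel)"
    using rb[of 2] unfolding n_def[symmetric] \<omega>_def[symmetric] n5 K2_def by simp
  have w0: "\<omega> \<ge> 0" by (simp add: \<omega>_def)
  have K0: "K4 \<ge> 0" "K2 \<ge> 0"
    unfolding K4_def K2_def using w0 L0 s d0 by (auto intro!: divide_nonneg_nonneg mult_nonneg_nonneg power_mono)
  have "L-lipschitz_on UNIV F" using lip L0 by (auto simp: lipschitz_on_def dist_norm)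
  then have [measurable]: "F \<in> borel_measurable borel"
    by (intro borel_measurable_continuous_onI lipschitz_on_continuous_on)
  have "ennreal (K4 + a * K2) = ennreal K4 + ennreal a * ennreal K2"
    using K0 a by (simp add: ennreal_mult[symmetric] ennreal_plus[symmetric] del: ennreal_plus)
  also have "\<dots> \<le> (\<integral>\<^sup>+\<xi>. norm \<xi> ^ 4 * F \<xi> \<partial>lborel) + ennreal a * (\<integral>\<^sup>+\<xi>. (norm \<xi>)\<^sup>2 * F \<xi> \<partial>lborel)"
    by (intro add_mono mult_left_mono r4 r2) auto
  also have "\<dots> = (\<integral>\<^sup>+\<xi>. ennreal (norm \<xi> ^ 4 * F \<xi>) + ennreal a * ennreal ((norm \<xi>)\<^sup>2 * F \<xi>) \<partial>lborel)"
    by (simp add: nn_integral_add nn_integral_cmult)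
  also have "\<dots> = (\<integral>\<^sup>+\<xi>. ennreal ((norm \<xi> ^ 4 + a * (norm \<xi>)\<^sup>2) * F \<xi>) \<partial>lborel)"
    using a F(1) by (intro nn_integral_cong) (simp add: ennreal_mult[symmetric] ennreal_plus[symmetric] algebra_simps del: ennreal_plus)
  also have "\<dots> = ennreal (1 / ?c) * (\<Sum>i\<in>A. \<integral>\<^sup>+\<xi>. ennreal ((norm \<xi> ^ 4 + a * (norm \<xi>)\<^sup>2) * power_spectrum M (e i) \<xi>) \<partial>lborel)"
    using a by (intro weighted) auto
  also have "\<dots> \<le> ennreal (1 / ?c) * (\<Sum>i\<in>A. ennreal (?c * energy a (e i) (e i)))"
    using energy_ge[OF eA(2) a] by (intro mult_left_mono sum_mono) (auto simp: n_def)
  also have "(\<Sum>i\<in>A. ennreal (?c * energy a (e i) (e i))) = ennreal (\<Sum>i\<in>A. ?c * energy a (e i) (e i))"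
    using energy_nonneg[OF a] by (intro sum_ennreal mult_nonneg_nonneg) auto
  also have "(\<Sum>i\<in>A. ?c * energy a (e i) (e i)) = ?c * (\<Sum>i\<in>A. \<Gamma> i)"
    unfolding sum_distrib_left
  proof (intro sum.cong refl arg_cong2[where f="(*)"])
    fix i assume i: "i \<in> A"
    \<comment> \<open>The weak equation for \<open>e i\<close>, tested with \<open>e i\<close>
      itself.\<close>
    show "energy a (e i) (e i) = \<Gamma> i"
      using eA(2,3)[OF i] onA[OF i i] by (simp add: eigenspace_iff)
  qed
  finally have fin: "ennreal (K4 + a * K2) \<le> ennreal (1 / ?c) * ennreal (?c * (\<Sum>i\<in>A. \<Gamma> i))" .
  have "K4 + a * K2 \<le> (\<Sum>i\<in>A. \<Gamma> i)"
  proof -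
    have "(\<Sum>i\<in>A. \<Gamma> i) \<ge> 0"
    proof (intro sum_nonneg)
      fix i assume i: "i \<in> A"
      have "energy a (e i) (e i) = \<Gamma> i" using eA(2,3)[OF i] onA[OF i i] by (simp add: eigenspace_iff)
      moreover have "energy a (e i) (e i) \<ge> 0"
        by (rule energy_nonneg[OF a])
      ultimately show "0 \<le> \<Gamma> i" by simp
    qed
    then show ?thesis using fin c by (subst (asm) ennreal_mult[symmetric]) (auto simp: ennreal_le_iff)
  qed
  then show ?thesis by (simp add: K4_def K2_def A_def)
qed

end

text \<open>Here \<open>Y\<close> stands for \<open>T * R\<close>. From \<open>pi > 3\<close> one
  gets \<open>Y ^ 3 \<ge> 27/2\<close>, and \<open>0.0735\<close> is just large enough that
  \<open>0.0735 * (27/2) powr (2/3)\<close> exceeds \<open>5/12\<close>; in cubed form this is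
  \<open>5.669 ^ 3 < (27/2)\<^sup>2\<close>.\<close>

lemma cone_parameter_bound_3:
  fixes Y :: real
  assumes "Y > 0" "Y ^ 3 \<ge> (9/2) * pi"
  shows "5/12 \<le> 0.0735 * Y\<^sup>2"
proof (rule ccontr)
  assume "\<not> 5/12 \<le> 0.0735 * Y\<^sup>2"
  then have "Y\<^sup>2 \<le> 5.669" by simp
  then have "(Y\<^sup>2) ^ 3 \<le> 5.669 ^ 3" by (intro power_mono) auto
  moreover have "(27/2)\<^sup>2 \<le> (Y ^ 3)\<^sup>2" using assms pi_gt3 by (intro power_mono) auto
  ultimately show False by (simp add: power_divide flip: power_mult)
qed

text \<open>Again \<open>Y = T * R\<close>; here \<open>Y\<^sup>2 \<ge> 8\<close>, and
  \<open>3/64 * 8 = 3/8\<close> with no slack.\<close>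

lemma cone_parameter_bound_4:
  fixes Y :: real
  assumes "Y > 0" "Y ^ 4 \<ge> 64"
  shows "3/8 \<le> 3/64 * Y\<^sup>2"
proof (rule ccontr)
  assume "\<not> 3/8 \<le> 3/64 * Y\<^sup>2"
  then have "(Y\<^sup>2)\<^sup>2 < 8\<^sup>2" by (intro power_strict_mono) auto
  then show False using assms by simp
qed

lemma measure_unit_ball_cart:
  fixes n :: nat
  assumes "n = CARD('n::finite)"
  shows "n = 3 \<Longrightarrow> measure lborel (ball (0::real^'n) 1) = 4 / 3 * pi"
    and "n = 4 \<Longrightarrow> measure lborel (ball (0::real^'n) 1) = pi\<^sup>2 / 2"
proof -
  have "measure lborel (ball (0::real^'n) 1) = unit_ball_vol (real n)"
    using content_ball[of 1 "0::real^'n"] assms by simp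
  then show "n = 3 \<Longrightarrow> measure lborel (ball (0::real^'n) 1) = 4 / 3 * pi"
    "n = 4 \<Longrightarrow> measure lborel (ball (0::real^'n) 1) = pi\<^sup>2 / 2"
    by (simp_all add: eval_unit_ball_vol)
qed

theorem theorem4:
  fixes \<Omega> :: "(real ^ 'n) set" and n k :: nat and a \<omega> V I :: real and \<Gamma> :: "nat \<Rightarrow> real"
  assumes "n = CARD('n)" and "n \<in> {3, 4}"
    and "a \<ge> 0"
    and "open \<Omega>" and "connected \<Omega>" and "\<Omega> \<noteq> {}" and "bounded \<Omega>"
    and "\<omega> = volume (ball (0 :: real ^ 'n) 1)"
    and "V = volume \<Omega>"
    and "I = moment_of_inertia \<Omega>"
    and "eigenvalue_sequence a \<Omega> \<Gamma>"
    and "k \<ge> 1"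
  shows "1 / real k * (\<Sum>j=1..k. \<Gamma> j) \<ge>
      real n / (real n + 4) * ((2 * pi) ^ 4 / (\<omega> * V) powr (4 / real n)) * real k powr (4 / real n)
    + (real n / 24 * (V / I) + real n * a / (real n + 2))
        * ((2 * pi)\<^sup>2 / (\<omega> * V) powr (2 / real n)) * real k powr (2 / real n)
    + (- (real n * ((real n)\<^sup>2 - 4) / 3840) * (V / I) + real n * a / 48 * beta n) * (V / I)"
proof -
  interpret bounded_open \<Omega> by unfold_locales fact+
  have nD: "DIM(real ^ 'n) = n" using assms(1) by simp
  have n0: "n > 0" and n34: "n = 3 \<or> n = 4" using assms(2) by auto
  have w: "\<omega> = measure lborel (ball (0 :: real ^ 'n) 1)" using assms(8) by (simp add: volume_eq)
  have w0: "\<omega> > 0" unfolding w by (rule measure_ball_pos)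
  have V0: "V > 0" using volume_pos assms(6,9) by simp
  \<comment> \<open>The radius of the ball with the volume of \<open>\<Omega>\<close>; its moment of
    inertia bounds \<open>I\<close> from below.\<close>
  define R where "R = root n (V / \<omega>)"
  have R0: "R > 0" using V0 w0 n0 by (simp add: R_def)
  have Rn: "\<omega> * R ^ n = V" using V0 w0 n0 by (simp add: R_def)
  have Ige: "real n * \<omega> * R ^ (n + 2) / (real n + 2) \<le> I"
    using moment_of_inertia_ge[OF assms(4,7), of R, unfolded nD, folded w assms(9,10)] R0 Rn by simp
  have "0 < real n * \<omega> * R ^ (n + 2) / (real n + 2)" using n0 w0 R0 by simp
  then have I0: "I > 0" using Ige by linarith
  define L where "L = 2 * sqrt (V * I) / (2 * pi) ^ n"
  define d where "d = sqrt (V / I) / 2"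
  have d0: "d > 0" using V0 I0 by (simp add: d_def)
  have d2: "d\<^sup>2 = V / I / 4" using V0 I0 by (simp add: d_def power_divide)
  have Ld: "L * d = V / (2 * pi) ^ n"
  proof -
    have "sqrt (V * I) * sqrt (V / I) = V" using V0 I0 by (simp add: real_sqrt_mult[symmetric])
    then show ?thesis by (simp add: L_def d_def field_simps)
  qed
  \<comment> \<open>Chosen so that the ball of radius \<open>T\<close> at height
    \<open>L * d\<close> has mass \<open>k\<close>; its powers are the expressions in
    \<open>k\<close> of the claim.\<close>
  define T where "T = 2 * pi * (real k / (\<omega> * V)) powr (1 / real n)"
  have k0: "real k > 0" using assms(12) by simp
  have T0: "T > 0" using k0 w0 V0 by (simp add: T_def)
  have Tp: "T ^ m = (2 * pi) ^ m / (\<omega> * V) powr (real m / real n) * real k powr (real m / real n)" for m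
  proof -
    have P: "(y powr (1 / real n)) ^ m = y powr (real m / real n)" if "y > 0" for y :: real
      using that by (simp add: powr_power)
    have "real k / (\<omega> * V) > 0" using k0 w0 V0 by simp
    from P[OF this] have "T ^ m = (2 * pi) ^ m * (real k / (\<omega> * V)) powr (real m / real n)"
      unfolding T_def by (simp only: power_mult_distrib[of "2 * pi"])
    also have "(real k / (\<omega> * V)) powr (real m / real n) = real k powr (real m / real n) / (\<omega> * V) powr (real m / real n)"
      by (rule powr_divide)
    finally show ?thesis by simp
  qed
  have Tn: "\<omega> * (L * d) * T ^ n = real k"
    unfolding Tp Ld using n0 k0 w0 V0 by simp
  \<comment> \<open>The bound on \<open>d\<^sup>2 / T\<^sup>2\<close> under which the second-moment
    estimates hold with the constants \<open>beta n\<close>.\<close>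
  define q where "q = (if n = 3 then 0.0735 else 3/64 :: real)"
  have dR: "d\<^sup>2 * R\<^sup>2 \<le> (real n + 2) / (4 * real n)"
  proof -
    have "real n * V * R\<^sup>2 / (real n + 2) \<le> I" using Ige by (simp add: Rn[symmetric] power2_eq_square mult_ac)
    then show ?thesis unfolding d2 using I0 n0 by (simp add: field_simps)
  qed
  have TR: "(real n + 2) / (4 * real n) \<le> q * (T * R)\<^sup>2"
  proof -
    \<comment> \<open>The mass condition for \<open>T\<close>, with \<open>V\<close> replaced by
      \<open>\<omega> * R ^ n\<close>, determines \<open>T * R\<close> up to the factor
      \<open>k\<close>. Since \<open>k \<ge> 1\<close>, a lower bound on \<open>T * R\<close>
      independent of the domain follows.\<close>
    have "T ^ n * (\<omega> * R ^ n) * \<omega> = (2 * pi) ^ n * real k"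
      unfolding Rn Tp using n0 w0 V0 by simp
    then have "(T * R) ^ n * \<omega>\<^sup>2 = (2 * pi) ^ n * real k" by (simp add: power_mult_distrib power2_eq_square mult_ac)
    then have e: "(T * R) ^ n * \<omega>\<^sup>2 \<ge> (2 * pi) ^ n" using assms(12) by simp
    define Y where "Y = T * R"
    have Y0: "Y > 0" using T0 R0 by (simp add: Y_def)
    show ?thesis
    proof (cases "n = 3")
      case True
      then have w3: "\<omega> = 4 / 3 * pi" using measure_unit_ball_cart(1)[OF assms(1)] w by simp
      have "8 * pi ^ 3 \<le> Y ^ 3 * (16/9 * pi\<^sup>2)"
        using e unfolding Y_def[symmetric] True w3 by (simp add: power_mult_distrib power_divide)
      then have "pi\<^sup>2 * (9/2 * pi) \<le> pi\<^sup>2 * Y ^ 3" by (simp add: eval_nat_numeral)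
      then have "Y ^ 3 \<ge> (9/2) * pi" by (rule mult_left_le_imp_le) simp
      from cone_parameter_bound_3[OF _ this] show ?thesis using Y0 True by (simp add: q_def Y_def)
    next
      case False
      then have n4: "n = 4" using n34 by simp
      then have w4: "\<omega> = pi\<^sup>2 / 2" using measure_unit_ball_cart(2)[OF assms(1)] w by simp
      have "16 * pi ^ 4 \<le> Y ^ 4 * (pi ^ 4 / 4)"
        using e unfolding Y_def[symmetric] n4 w4 by (simp add: power_mult_distrib power_divide)
      then have "pi ^ 4 * 64 \<le> pi ^ 4 * Y ^ 4" by simp
      then have "Y ^ 4 \<ge> 64" by (rule mult_left_le_imp_le) simp
      from cone_parameter_bound_4[OF _ this] show ?thesis using Y0 n4 by (simp add: q_def Y_def)
    qed
  qed
  have dT: "d\<^sup>2 \<le> q * T\<^sup>2"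
  proof -
    have "d\<^sup>2 * R\<^sup>2 \<le> (q * T\<^sup>2) * R\<^sup>2" using dR TR by (simp add: power_mult_distrib mult_ac)
    then show ?thesis using R0 by simp
  qed
  have "q \<le> 1" by (simp add: q_def)
  then have "d\<^sup>2 \<le> T\<^sup>2" using dT mult_right_mono[of q 1 "T\<^sup>2"] by simp
  then have dT1: "d \<le> T" by (rule power2_le_imp_le) (use T0 in simp)
  obtain s where s: "0 \<le> s" "T ^ n * ((real n + 1) * d) = (s + d) ^ (n + 1) - s ^ (n + 1)"
    using cone_mass_solvable[OF n34 d0 dT1] by blast
  have mass: "real k * (real n + 1) = \<omega> * L * ((s + d) ^ (n + 1) - s ^ (n + 1))"
    unfolding s(2)[symmetric] Tn[symmetric] by (simp add: mult_ac)
  have main: "real n * \<omega> * L * ((s + d) ^ (n + 5) - s ^ (n + 5)) / ((real n + 4) * (real n + 5))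
      + a * (real n * \<omega> * L * ((s + d) ^ (n + 3) - s ^ (n + 3)) / ((real n + 2) * (real n + 3)))
    \<le> (\<Sum>j=1..k. \<Gamma> j)"
    using eigenvalue_sum_ge[OF assms(3) _ _ assms(11) s(1), of k] V0 I0 mass
    unfolding nD assms(9)[symmetric] assms(10)[symmetric] w[symmetric] L_def[symmetric] d_def[symmetric]
    by blast
  have L0: "L > 0" using V0 I0 by (simp add: L_def)
  \<comment> \<open>Expansions of the fourth and second moments in the scale \<open>T\<close>,
    written uniformly in \<open>n\<close>: \<open>(n + 4) / 6\<close> is \<open>7/6\<close> or
    \<open>4/3\<close>, the last coefficient \<open>7/48\<close> or \<open>2/5\<close>, and
    \<open>(n + 2) / 12\<close> is \<open>5/12\<close> or \<open>1/2\<close>.\<close>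
  let ?X4 = "T ^ 4 + (real n + 4) / 6 * d\<^sup>2 * T\<^sup>2 - (real n + 4) * ((real n)\<^sup>2 - 4) / 240 * d ^ 4"
  let ?X2 = "T\<^sup>2 + (real n + 2) / 12 * beta n * d\<^sup>2"
  have c4: "T ^ n * ?X4 * ((real n + 5) * d)
      \<le> (s + d) ^ (n + 5) - s ^ (n + 5)"
  proof (cases "n = 3")
    case True
    then show ?thesis using cone_moments_3(1)[OF s(1) d0 T0] s(2) by simp
  next
    case False
    then have "n = 4" using n34 by simp
    then show ?thesis using cone_moments_4(1)[OF s(1) d0 T0] s(2) by simp
  qed
  have c2: "T ^ n * ?X2 * ((real n + 3) * d) \<le> (s + d) ^ (n + 3) - s ^ (n + 3)"
  proof (cases "n = 3")
    case True
    then show ?thesis using cone_moments_3(2)[OF s(1) d0 T0] s(2) dT by (simp add: beta_def q_def)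
  next
    case False
    then have "n = 4" using n34 by simp
    then show ?thesis using cone_moments_4(2)[OF s(1) d0 T0] s(2) dT by (simp add: beta_def q_def)
  qed
  have k4: "real k * (real n / (real n + 4) * ?X4)
    \<le> real n * \<omega> * L * ((s + d) ^ (n + 5) - s ^ (n + 5)) / ((real n + 4) * (real n + 5))"
  proof -
    have "real n * \<omega> * L / ((real n + 4) * (real n + 5)) * (T ^ n * ?X4 * ((real n + 5) * d))
      \<le> real n * \<omega> * L / ((real n + 4) * (real n + 5)) * ((s + d) ^ (n + 5) - s ^ (n + 5))"
      using w0 L0 by (intro mult_left_mono c4) auto
    \<comment> \<open>The factor \<open>\<omega> * L * d * T ^ n\<close> is the mass
      \<open>k\<close>, which is thus split off for the final division.\<close>
    moreover have "real n * \<omega> * L / ((real n + 4) * (real n + 5)) * (T ^ n * x * ((real n + 5) * d))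
       = real k * (real n / (real n + 4) * x)" for x
      unfolding Tn[symmetric] by (simp add: divide_simps)
    ultimately show ?thesis by (simp only: times_divide_eq_left)
  qed
  have k2: "real k * (real n / (real n + 2) * ?X2)
    \<le> real n * \<omega> * L * ((s + d) ^ (n + 3) - s ^ (n + 3)) / ((real n + 2) * (real n + 3))"
  proof -
    have "real n * \<omega> * L / ((real n + 2) * (real n + 3)) * (T ^ n * ?X2 * ((real n + 3) * d))
      \<le> real n * \<omega> * L / ((real n + 2) * (real n + 3)) * ((s + d) ^ (n + 3) - s ^ (n + 3))"
      using w0 L0 by (intro mult_left_mono c2) auto
    moreover have "real n * \<omega> * L / ((real n + 2) * (real n + 3)) * (T ^ n * x * ((real n + 3) * d))
       = real k * (real n / (real n + 2) * x)" for x
      unfolding Tn[symmetric] by (simp add: divide_simps)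
    ultimately show ?thesis by (simp only: times_divide_eq_left)
  qed
  have "real k * (real n / (real n + 4) * ?X4
      + a * (real n / (real n + 2) * ?X2)) \<le> (\<Sum>j=1..k. \<Gamma> j)"
    using order_trans[OF add_mono[OF k4 mult_left_mono[OF k2 assms(3)]] main] by (simp add: distrib_left mult_ac)
  then have fin: "real n / (real n + 4) * ?X4
      + a * (real n / (real n + 2) * ?X2) \<le> 1 / real k * (\<Sum>j=1..k. \<Gamma> j)"
    using k0 by (simp add: field_simps)
  have d4: "d ^ 4 = (V / I)\<^sup>2 / 16"
  proof -
    have "d ^ 4 = (d\<^sup>2)\<^sup>2" by simp
    then show ?thesis unfolding d2 by (simp add: power_divide)
  qed
  \<comment> \<open>Regrouping after \<open>d\<^sup>2 = V / I / 4\<close>, with \<open>x\<close>,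
    \<open>y\<close> and \<open>v\<close> standing for \<open>T ^ 4\<close>,
    \<open>T\<^sup>2\<close> and \<open>V / I\<close>: this produces the denominators
    \<open>24 = 6 * 4\<close>, \<open>3840 = 240 * 16\<close> and \<open>48 = 12 * 4\<close> of the
    claim.\<close>
  have ident: "N / (N + 4) * (x + (N + 4) / 6 * (v / 4) * y - (N + 4) * (N\<^sup>2 - 4) / 240 * (v\<^sup>2 / 16))
      + a * (N / (N + 2) * (y + (N + 2) / 12 * b * (v / 4)))
     = N / (N + 4) * x + (N / 24 * v + N * a / (N + 2)) * y + (- (N * (N\<^sup>2 - 4) / 3840) * v + N * a / 48 * b) * v"
    if "N > 0" for N x y v b :: real
  proof -
    have "N + 4 \<noteq> 0" "N + 2 \<noteq> 0" using that by auto
    then have 1: "N / (N + 4) * (x + (N + 4) / 6 * (v / 4) * y - (N + 4) * (N\<^sup>2 - 4) / 240 * (v\<^sup>2 / 16)) =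
       N / (N + 4) * x + N / 24 * v * y - N * (N\<^sup>2 - 4) / 3840 * v\<^sup>2"
      and 2: "N / (N + 2) * (y + (N + 2) / 12 * b * (v / 4)) = N / (N + 2) * y + N / 48 * b * v"
      by (simp_all add: divide_simps) (simp_all add: algebra_simps)
    show ?thesis unfolding 1 2 by (simp add: algebra_simps power2_eq_square)
  qed
  have T4: "T ^ 4 = (2 * pi) ^ 4 / (\<omega> * V) powr (4 / real n) * real k powr (4 / real n)"
    and T2: "T\<^sup>2 = (2 * pi)\<^sup>2 / (\<omega> * V) powr (2 / real n) * real k powr (2 / real n)"
    using Tp[of 4] Tp[of 2] by simp_all
  show ?thesis
    using fin ident[of "real n" "T ^ 4" "V / I" "T\<^sup>2" "beta n"] n0 unfolding d2 d4 T4 T2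
    by (simp add: mult.assoc)
qed

end
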